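(* Let $T>0$ and let $(l_e,N_e,f_{pe})$ be a constant equilibrium, i.e. $F(l_e,N_e,f_{pe})=0$, with $0<f_{pe}<1$, $0<l_e<L$ and $N_e>0$. Then there exists $\varepsilon_0>0$ (depending on $T$) and a constant $C_{\varepsilon_0}$ (depending on $\varepsilon_0$ but independent of $\varepsilon$ and of the data below) such that the following holds for every $\varepsilon\in(0,\varepsilon_0]$. Let $l^0\in(0,L)$, $f_p^0\in W^{1,\infty}(0,1)$ and $F_{in},N\in W^{1,\infty}(0,T)$ satisfy the compatibility condition $$\frac{F_{in}(0)}{\rho_o V_{eff}N(0)}=f_p^0(0)$$ and the smallness condition $$\|f_p^0-f_{pe}\|_{W^{1,\infty}(0,1)}+\Big\|\frac{F_{in}}{\rho_oV_{eff}N}-f_{pe}\Big\|_{W^{1,\infty}(0,T)}+\|N-N_e\|_{W^{1,\infty}(0,T)}+|l^0-l_e|\le\varepsilon .$$ Then the Cauchy problem $$\begin{cases}\dot l(t)=F(l(t),N(t),f_p(t,1)),\quad t\in(0,T),\\ l(0)=l^0,\end{cases}$$ $$\begin{cases}\partial_tf_p(t,x)+\alpha_p(x,N(t),l(t),f_p(t,1))\,\partial_xf_p(t,x)=0,\quad (t,x)\in Q=(0,T)\times(0,1),\\ f_p(0,x)=f_p^0(x),\quad x\in(0,1),\\ f_p(t,0)=\dfrac{F_{in}(t)}{\rho_oV_{eff}N(t)},\quad t\in(0,T),\end{cases}$$ admits a unique solution $(l,f_p)\in W^{1,\infty}(0,T)\times W^{1,\infty}(Q)$, and $$\|f_p-f_{pe}\|_{W^{1,\infty}(Q)}\le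 C_{\varepsilon_0}\,\varepsilon,\qquad \|l-l_e\|_{W^{1,\infty}(0,T)}\le C_{\varepsilon_0}\,\varepsilon .$$
   Context: The physical parameters $L,\zeta,\rho_o,V_{eff},S_{eff},B,K_d$ are fixed positive constants. For $l\in(0,L)$, $N\in\mathbb{R}$, $f\in(0,1)$, $x\in[0,1]$ set $$F_d(l,N)=\frac{K_d\,\rho_oV_{eff}\,N\,(L-l)}{B\rho_o+K_d(L-l)},\qquad F(l,N,f)=\frac{F_d(l,N)-\rho_oV_{eff}N f}{\rho_oS_{eff}(1-f)},$$ $$\alpha_p(x,N,l,f)=\frac1l\big(\zeta N-xF(l,N,f)\big).$$ A solution $(l,f_p)$ is understood to take values for which these expressions make sense, i.e. $l(t)\in(0,L)$ and $f_p(t,1)\in(0,1)$. The equations hold almost everywhere; initial and boundary values are taken in the sense of the Lipschitz continuous representatives. "Independent of $\varepsilon$" allows the constants to depend on $T$, on the equilibrium and on the physical parameters. *)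

theory Defs
  imports "HOL-Analysis.Analysis" "HOL-Probability.Essential_Supremum"
begin

section \<open>The spaces \<open>L\<^sup>\<infinity>\<close> and \<open>W\<^sup>1\<^sup>,\<^sup>\<infinity>\<close> on an open set\<close>

definition Linf_norm :: "'a::euclidean_space set \<Rightarrow> ('a \<Rightarrow> real) \<Rightarrow> ereal" where
  "Linf_norm \<Omega> u = esssup (lebesgue_on \<Omega>) (\<lambda>x. ereal \<bar>u x\<bar>)"

definition Linf :: "'a::euclidean_space set \<Rightarrow> ('a \<Rightarrow> real) set" where
  "Linf \<Omega> = {u. u \<in> borel_measurable (lebesgue_on \<Omega>) \<and> Linf_norm \<Omega> u < \<infinity>}"

text \<open>Test functions are continuously differentiable with compact support in \<open>\<Omega>\<close>.
  By mollification they determine the same weak derivatives as smooth test functions.\<close>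

definition test_functions :: "'a::euclidean_space set \<Rightarrow> ('a \<Rightarrow> real) set" where
  "test_functions \<Omega> = {\<phi>.
     (\<exists>D :: 'a \<Rightarrow> 'a \<Rightarrow>\<^sub>L real.
        continuous_on UNIV D \<and> (\<forall>x. (\<phi> has_derivative blinfun_apply (D x)) (at x))) \<and>
     compact (closure {x. \<phi> x \<noteq> 0}) \<and> closure {x. \<phi> x \<noteq> 0} \<subseteq> \<Omega>}"

definition has_weak_partial ::
  "'a::euclidean_space set \<Rightarrow> 'a \<Rightarrow> ('a \<Rightarrow> real) \<Rightarrow> ('a \<Rightarrow> real) \<Rightarrow> bool" where
  "has_weak_partial \<Omega> v u g \<longleftrightarrow>
     (\<forall>\<phi> \<in> test_functions \<Omega>.
        (LINT x|lebesgue_on \<Omega>. u x * frechet_derivative \<phi> (at x) v)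
          = - (LINT x|lebesgue_on \<Omega>. g x * \<phi> x))"

text \<open>A bounded weak derivative is determined up to a null set only, so the choice operator picks a
  representative; it is used below only almost everywhere and inside \<^const>\<open>Linf_norm\<close>.\<close>

definition weak_partial :: "'a::euclidean_space set \<Rightarrow> 'a \<Rightarrow> ('a \<Rightarrow> real) \<Rightarrow> 'a \<Rightarrow> real" where
  "weak_partial \<Omega> v u = (SOME g. g \<in> Linf \<Omega> \<and> has_weak_partial \<Omega> v u g)"

definition W1inf :: "'a::euclidean_space set \<Rightarrow> ('a \<Rightarrow> real) set" where
  "W1inf \<Omega> = {u \<in> Linf \<Omega>. \<forall>b\<in>Basis. \<exists>g \<in> Linf \<Omega>. has_weak_partial \<Omega> b u g}"

definition W1inf_norm :: "'a::euclidean_space set \<Rightarrow> ('a \<Rightarrow> real) \<Rightarrow> ereal" where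
  "W1inf_norm \<Omega> u =
     (if u \<in> W1inf \<Omega> then Linf_norm \<Omega> u + (\<Sum>b\<in>Basis. Linf_norm \<Omega> (weak_partial \<Omega> b u)) else \<infinity>)"

text \<open>Elements of \<^term>\<open>W1inf \<Omega>\<close>, for \<open>\<Omega>\<close> open, bounded and convex, given by their representative
  that is Lipschitz continuous up to the boundary; initial and boundary values are the values
  of this representative.\<close>

definition W1inf_lip :: "'a::euclidean_space set \<Rightarrow> ('a \<Rightarrow> real) set" where
  "W1inf_lip \<Omega> = {u \<in> W1inf \<Omega>. \<exists>K. K-lipschitz_on (closure \<Omega>) u}"


section \<open>The extrusion model\<close>

text \<open>Physical parameters are always passed in the order \<open>L \<zeta> \<rho>\<^sub>o V\<^sub>e\<^sub>f\<^sub>f S\<^sub>e\<^sub>f\<^sub>f B K\<^sub>d\<close>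
  (omitting those that do not occur).\<close>

definition die_flow :: "real \<Rightarrow> real \<Rightarrow> real \<Rightarrow> real \<Rightarrow> real \<Rightarrow> real \<Rightarrow> real \<Rightarrow> real" where
  "die_flow L \<rho> Veff B Kd l N = Kd * \<rho> * Veff * N * (L - l) / (B * \<rho> + Kd * (L - l))"

definition interface_speed ::
  "real \<Rightarrow> real \<Rightarrow> real \<Rightarrow> real \<Rightarrow> real \<Rightarrow> real \<Rightarrow> real \<Rightarrow> real \<Rightarrow> real \<Rightarrow> real" where
  "interface_speed L \<rho> Veff Seff B Kd l N f =
     (die_flow L \<rho> Veff B Kd l N - \<rho> * Veff * N * f) / (\<rho> * Seff * (1 - f))"

definition alpha_p ::
  "real \<Rightarrow> real \<Rightarrow> real \<Rightarrow> real \<Rightarrow> real \<Rightarrow> real \<Rightarrow> real \<Rightarrow> real \<Rightarrow> real \<Rightarrow> real \<Rightarrow> real \<Rightarrow> real" where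
  "alpha_p L \<zeta> \<rho> Veff Seff B Kd x N l f =
     (1 / l) * (\<zeta> * N - x * interface_speed L \<rho> Veff Seff B Kd l N f)"

abbreviation space_time :: "real \<Rightarrow> (real \<times> real) set" where
  "space_time T \<equiv> {0<..<T} \<times> {0<..<1}"

text \<open>Points of \<^term>\<open>space_time T\<close> are pairs \<open>(t, x)\<close>, so the directions \<open>(1, 0)\<close> and \<open>(0, 1)\<close> give
  the time and the space derivative.\<close>

definition is_solution ::
  "real \<Rightarrow> real \<Rightarrow> real \<Rightarrow> real \<Rightarrow> real \<Rightarrow> real \<Rightarrow> real \<Rightarrow> real \<Rightarrow>
   real \<Rightarrow> (real \<Rightarrow> real) \<Rightarrow> (real \<Rightarrow> real) \<Rightarrow> (real \<Rightarrow> real) \<Rightarrow>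
   (real \<Rightarrow> real) \<Rightarrow> (real \<times> real \<Rightarrow> real) \<Rightarrow> bool" where
  "is_solution L \<zeta> \<rho> Veff Seff B Kd T l0 f0 Fin N l f \<longleftrightarrow>
     l \<in> W1inf_lip {0<..<T} \<and>
     f \<in> W1inf_lip (space_time T) \<and>
     (\<forall>t\<in>{0<..<T}. l t \<in> {0<..<L} \<and> f (t, 1) \<in> {0<..<1}) \<and>
     (AE t in lebesgue_on {0<..<T}.
        weak_partial {0<..<T} 1 l t = interface_speed L \<rho> Veff Seff B Kd (l t) (N t) (f (t, 1))) \<and>
     l 0 = l0 \<and>
     (AE (t, x) in lebesgue_on (space_time T).
        weak_partial (space_time T) (1, 0) f (t, x)
        + alpha_p L \<zeta> \<rho> Veff Seff B Kd x (N t) (l t) (f (t, 1))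
          * weak_partial (space_time T) (0, 1) f (t, x) = 0) \<and>
     (\<forall>x\<in>{0<..<1}. f (0, x) = f0 x) \<and>
     (\<forall>t\<in>{0<..<T}. f (t, 0) = Fin t / (\<rho> * Veff * N t))"

end

theory Submission
  imports Defs
begin

text \<open>The key is the physical coordinate \<open>y = l(t) x\<close>. As \<open>l' = F\<close>, the equation for \<open>f\<^sub>p\<close> becomes
\<open>\<partial>\<^sub>t + \<zeta> N(t) \<partial>\<^sub>y = 0\<close>, whose speed no longer involves the unknowns. Hence with \<open>M(t) = \<zeta> \<integral>\<^sub>0\<^sup>t N\<close>
every solution should have the form \<open>f\<^sub>p(t, x) = h(l(t) x - M(t))\<close>, where the profile \<open>h\<close> is read off from
the data: the initial value gives \<open>h\<close> on \<open>[0, l\<^sup>0]\<close>, the inflow gives \<open>h\<close> on \<open>[-M(T), 0]\<close>, and the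
compatibility condition makes the two pieces fit together to a Lipschitz function. Inserting this into the
equation of the interface leaves the scalar problem \<open>l' = F(l, N(t), h(l - M(t)))\<close> with a Lipschitz right-hand
side.

Existence is then the Picard theorem (\<open>global_ode_solution\<close>). All norms in the smallness condition control
sup norms and Lipschitz constants, so \<open>h - f\<^sub>p\<^sub>e\<close>, \<open>N - N\<^sub>e\<close> and the Lipschitz constant of \<open>h\<close> are
\<open>O(\<epsilon>)\<close>; since \<open>F\<close> vanishes at the equilibrium, Gronwall's inequality gives \<open>l - l\<^sub>e = O(\<epsilon>)\<close> on
\<open>[0, T]\<close>. This keeps \<open>l\<close> inside \<open>(0, L)\<close> for small \<open>\<epsilon>\<close> and yields both estimates.

For uniqueness, an arbitrary solution is constant along its own characteristics, and these are the curves
\<open>l(t) x - M(t) = const\<close> formed with its own \<open>l\<close>. Traced backwards, such a curve reaches the initial line or the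
inflow boundary unless it first leaves through \<open>x = 1\<close>, which cannot happen as long as \<open>l - M\<close> decreases, that
is \<open>F < \<zeta> N\<close>. Near the equilibrium \<open>F\<close> is small and \<open>\<zeta> N\<close> is not. A first time at which
\<open>F < \<zeta> N\<close> fails is impossible: up to that time the solution has the form above, so it agrees with the solution
constructed before, for which \<open>F\<close> is still small there (\<open>outflow_everywhere\<close>).

What remains is to relate weak derivatives to Lipschitz functions. A Lipschitz function on the line is
differentiable almost everywhere and is the integral of its derivative (\<open>lipschitz_real_density\<close>). Limits of
difference quotients are weak derivatives (\<open>has_weak_partial_if_difference_quotients_converge\<close>), and weak
derivatives are unique up to null sets (\<open>has_weak_partial_unique\<close>). Constancy along characteristics needs
no differentiability of the solution: its average against a narrow kernel moving along the characteristic is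
differentiable, with a derivative that is small relative to the mass of the kernel as the kernel shrinks
(\<open>transport_constant_along_characteristics\<close>).\<close>

section \<open>Smooth bumps that exhaust a box\<close>

definition c1_fun :: "('a::euclidean_space \<Rightarrow> real) \<Rightarrow> bool" where
  "c1_fun \<phi> \<longleftrightarrow> (\<exists>D :: 'a \<Rightarrow> 'a \<Rightarrow>\<^sub>L real.
     continuous_on UNIV D \<and> (\<forall>x. (\<phi> has_derivative blinfun_apply (D x)) (at x)))"

lemma c1_fun_const: "c1_fun (\<lambda>_. c)"
  unfolding c1_fun_def by (rule exI[of _ "\<lambda>_. 0"]) (auto simp: zero_blinfun.rep_eq)

lemma c1_fun_inner: "c1_fun (\<lambda>z. z \<bullet> b)"
  unfolding c1_fun_def
  by (rule exI[of _ "\<lambda>_. blinfun_inner_left b"])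
     (auto intro!: derivative_eq_intros continuous_on_const simp: inner_commute)

lemma c1_fun_mult:
  assumes "c1_fun f" "c1_fun g" shows "c1_fun (\<lambda>z. f z * g z)"
proof -
  obtain D E where D: "continuous_on UNIV D" "\<And>x. (f has_derivative blinfun_apply (D x)) (at x)"
    and E: "continuous_on UNIV E" "\<And>x. (g has_derivative blinfun_apply (E x)) (at x)"
    using assms unfolding c1_fun_def by blast
  have cf: "continuous_on UNIV f" "continuous_on UNIV g"
    using D(2) E(2) by (meson continuous_at_imp_continuous_on has_derivative_continuous)+
  show ?thesis unfolding c1_fun_def
    by (rule exI[of _ "\<lambda>z. f z *\<^sub>R E z + g z *\<^sub>R D z"])
       (auto intro!: continuous_intros cf D E derivative_eq_intros
         simp: blinfun.add_left blinfun.scaleR_left)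
qed

lemma c1_fun_compose:
  assumes "c1_fun f"
    and g: "\<And>z. (g has_real_derivative g' (f z)) (at (f z))"
    and g': "continuous_on (range f) g'"
  shows "c1_fun (\<lambda>z. g (f z))"
proof -
  obtain D where D: "continuous_on UNIV D" "\<And>x. (f has_derivative blinfun_apply (D x)) (at x)"
    using assms unfolding c1_fun_def by blast
  have cf: "continuous_on UNIV f"
    using D(2) by (meson continuous_at_imp_continuous_on has_derivative_continuous)
  have "((\<lambda>z. g (f z)) has_derivative (\<lambda>v. g' (f z) * D z v)) (at z)" for z
    using has_derivative_compose[OF D(2)[of z], of g "(*) (g' (f z))"] g[of z]
    unfolding has_field_derivative_def by simp
  then show ?thesis unfolding c1_fun_def
    by (intro exI[of _ "\<lambda>z. g' (f z) *\<^sub>R D z"])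
       (auto intro!: continuous_intros continuous_on_compose2[OF g' cf] D
         simp: scaleR_blinfun.rep_eq)
qed

lemma c1_fun_prod:
  assumes "finite I" "\<And>i. i \<in> I \<Longrightarrow> c1_fun (f i)" shows "c1_fun (\<lambda>z. \<Prod>i\<in>I. f i z)"
  using assms by (induction I rule: finite_induct) (auto simp: c1_fun_const c1_fun_mult)

lemma has_real_derivative_pos_part_square:
  "((\<lambda>y::real. (max 0 y)\<^sup>2) has_real_derivative 2 * max 0 y) (at y)"
proof -
  consider "y > 0" | "y < 0" | "y = 0" by linarith
  then show ?thesis
  proof cases
    case 1
    have "((\<lambda>y::real. y\<^sup>2) has_real_derivative 2 * y) (at y)"
      by (auto intro!: derivative_eq_intros)
    then have "((\<lambda>y::real. (max 0 y)\<^sup>2) has_real_derivative 2 * y) (at y)"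
      by (rule has_field_derivative_transform_within_open[of _ _ _ "{0<..}"]) (use 1 in auto)
    then show ?thesis using 1 by simp
  next
    case 2
    have "((\<lambda>y::real. 0) has_real_derivative 0) (at y)" by simp
    then have "((\<lambda>y::real. (max 0 y)\<^sup>2) has_real_derivative 0) (at y)"
      by (rule has_field_derivative_transform_within_open[of _ _ _ "{..<0}"]) (use 2 in auto)
    then show ?thesis using 2 by simp
  next
    case 3
    have "((\<lambda>h::real. (max 0 h)\<^sup>2 / h) \<longlongrightarrow> 0) (at 0)"
    proof (rule tendsto_0_le[of "\<lambda>h. h" _ _ 1])
      show "eventually (\<lambda>h. norm ((max 0 h)\<^sup>2 / h) \<le> norm h * 1) (at (0::real))"
        by (auto simp: max_def power2_eq_square abs_mult intro!: always_eventually)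
    qed (auto intro!: tendsto_eq_intros)
    then show ?thesis using 3 by (simp add: DERIV_def)
  qed
qed

lemma c1_fun_continuous_on: "c1_fun f \<Longrightarrow> continuous_on S f"
  unfolding c1_fun_def
  by (meson continuous_at_imp_continuous_on has_derivative_continuous)

text \<open>The square of the positive part is \<open>C\<^sup>1\<close>, so a product of such squares is a \<open>C\<^sup>1\<close> function that is positive
exactly on the open box.\<close>
definition box_weight :: "'a::euclidean_space \<Rightarrow> 'a \<Rightarrow> 'a \<Rightarrow> real" where
  "box_weight a b z = (\<Prod>i\<in>Basis. (max 0 ((z \<bullet> i - a \<bullet> i) * (b \<bullet> i - z \<bullet> i)))\<^sup>2)"

lemma c1_fun_diff:
  assumes "c1_fun f" "c1_fun g" shows "c1_fun (\<lambda>z. f z - g z)"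
proof -
  obtain D E where D: "continuous_on UNIV D" "\<And>x. (f has_derivative blinfun_apply (D x)) (at x)"
    and E: "continuous_on UNIV E" "\<And>x. (g has_derivative blinfun_apply (E x)) (at x)"
    using assms unfolding c1_fun_def by blast
  show ?thesis unfolding c1_fun_def
    by (rule exI[of _ "\<lambda>z. D z - E z"])
       (auto intro!: continuous_intros D E derivative_eq_intros simp: blinfun.diff_left)
qed

lemma c1_fun_box_weight: "c1_fun (box_weight a b)"
proof -
  have "c1_fun (\<lambda>z. (max 0 ((z \<bullet> i - a \<bullet> i) * (b \<bullet> i - z \<bullet> i)))\<^sup>2)" for i
    by (rule c1_fun_compose[where g = "\<lambda>y. (max 0 y)\<^sup>2" and g' = "\<lambda>y. 2 * max 0 y"])
       (auto intro!: c1_fun_mult c1_fun_diff c1_fun_inner c1_fun_const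
          has_real_derivative_pos_part_square continuous_intros)
  then have "c1_fun (\<lambda>z. \<Prod>i\<in>Basis. (max 0 ((z \<bullet> i - a \<bullet> i) * (b \<bullet> i - z \<bullet> i)))\<^sup>2)"
    by (intro c1_fun_prod) auto
  then show ?thesis unfolding box_weight_def[abs_def] .
qed

lemma box_weight_nonneg: "box_weight a b z \<ge> 0"
  unfolding box_weight_def by (intro prod_nonneg) auto

lemma box_weight_pos_iff:
  assumes "\<And>i. i \<in> Basis \<Longrightarrow> a \<bullet> i \<le> b \<bullet> i"
  shows "box_weight a b z > 0 \<longleftrightarrow> z \<in> box a b"
proof -
  have "(max 0 ((z \<bullet> i - a \<bullet> i) * (b \<bullet> i - z \<bullet> i)))\<^sup>2 \<noteq> 0 \<longleftrightarrow> a \<bullet> i < z \<bullet> i \<and> z \<bullet> i < b \<bullet> i"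
    if "i \<in> Basis" for i
  proof -
    have "(max 0 ((z \<bullet> i - a \<bullet> i) * (b \<bullet> i - z \<bullet> i)))\<^sup>2 \<noteq> 0
        \<longleftrightarrow> 0 < (z \<bullet> i - a \<bullet> i) * (b \<bullet> i - z \<bullet> i)"
      by (auto simp: max_def order_less_le)
    then show ?thesis using assms[OF that] by (auto simp: zero_less_mult_iff)
  qed
  then have "box_weight a b z \<noteq> 0 \<longleftrightarrow> z \<in> box a b"
    unfolding box_weight_def by (auto simp: mem_box)
  then show ?thesis using box_weight_nonneg[of a b z] by auto
qed

text \<open>This is \<open>n w / (1 + n w)\<close> for the weight \<open>w\<close>: it has the support of \<open>w\<close>, stays below \<open>1\<close>, and increases to
the indicator of the open box as \<open>n\<close> grows.\<close>
definition box_bump :: "'a::euclidean_space \<Rightarrow> 'a \<Rightarrow> nat \<Rightarrow> 'a \<Rightarrow> real" where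
  "box_bump a b n z = 1 - 1 / (1 + real n * box_weight a b z)"

lemma box_bump_range: "0 \<le> box_bump a b n z" "box_bump a b n z \<le> 1"
proof -
  have "0 \<le> real n * box_weight a b z" using box_weight_nonneg[of a b z] by simp
  then show "0 \<le> box_bump a b n z" "box_bump a b n z \<le> 1"
    unfolding box_bump_def by (auto simp: divide_simps)
qed

lemma box_bump_tendsto:
  assumes "\<And>i. i \<in> Basis \<Longrightarrow> a \<bullet> i \<le> b \<bullet> i"
  shows "(\<lambda>n. box_bump a b n z) \<longlonglongrightarrow> indicator (box a b) z"
proof (cases "z \<in> box a b")
  case True
  then have w: "box_weight a b z > 0" using box_weight_pos_iff[OF assms] by blast
  have "filterlim (\<lambda>n. 1 + real n * box_weight a b z) at_top sequentially"
    by (intro filterlim_tendsto_add_at_top[OF tendsto_const]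
          filterlim_at_top_mult_tendsto_pos[OF tendsto_const w] filterlim_real_sequentially)
  then have "(\<lambda>n. 1 - 1 / (1 + real n * box_weight a b z)) \<longlonglongrightarrow> 1 - 0"
    by (intro tendsto_intros tendsto_divide_0[OF tendsto_const] filterlim_at_top_imp_at_infinity)
  then show ?thesis using True by (simp add: box_bump_def)
next
  case False
  then have "box_weight a b z = 0"
    using box_weight_pos_iff[OF assms, of z] box_weight_nonneg[of a b z] by fastforce
  then show ?thesis using False by (simp add: box_bump_def)
qed

lemma c1_fun_box_bump: "c1_fun (box_bump a b n)"
proof -
  have p: "1 + real n * box_weight a b z > 0" for z
    using box_weight_nonneg[of a b z] by (simp add: add_pos_nonneg)
  have "c1_fun (\<lambda>z. 1 - 1 / (1 + real n * box_weight a b z))"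
    apply (rule c1_fun_compose[where g = "\<lambda>y. 1 - 1 / (1 + real n * y)"
          and g' = "\<lambda>y. real n / (1 + real n * y)\<^sup>2", OF c1_fun_box_weight])
    subgoal for z using p[of z] by (auto intro!: derivative_eq_intros simp: power2_eq_square)
    subgoal using p by (auto intro!: continuous_intros simp: less_imp_neq[symmetric])
    done
  then show ?thesis unfolding box_bump_def[abs_def] .
qed

lemma box_bump_test_function:
  assumes "cbox a b \<subseteq> \<Omega>" "\<And>i. i \<in> Basis \<Longrightarrow> a \<bullet> i \<le> b \<bullet> i"
  shows "box_bump a b n \<in> test_functions \<Omega>"
proof -
  have "{z. box_bump a b n z \<noteq> 0} \<subseteq> cbox a b"
  proof safe
    fix z assume "box_bump a b n z \<noteq> 0"
    then have "box_weight a b z \<noteq> 0" by (auto simp: box_bump_def)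
    then have "z \<in> box a b" using box_weight_pos_iff[OF assms(2)] box_weight_nonneg[of a b z] by force
    then show "z \<in> cbox a b" using box_subset_cbox by blast
  qed
  then have "closure {z. box_bump a b n z \<noteq> 0} \<subseteq> cbox a b"
    by (rule closure_minimal[OF _ closed_cbox])
  moreover have "compact (closure {z. box_bump a b n z \<noteq> 0})"
    using calculation by (meson bounded_cbox bounded_subset closed_closure compact_eq_bounded_closed)
  ultimately show ?thesis
    using c1_fun_box_bump[of a b n] assms(1) unfolding test_functions_def c1_fun_def by blast
qed

section \<open>Uniqueness of weak derivatives\<close>

lemma Linf_AE_bounded:
  assumes "g \<in> Linf \<Omega>"
  obtains C where "C \<ge> 0" "AE x in lebesgue_on \<Omega>. \<bar>g x\<bar> \<le> C"
proof -
  have lt: "Linf_norm \<Omega> g < \<infinity>" using assms by (simp add: Linf_def)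
  then obtain C where C: "Linf_norm \<Omega> g \<le> ereal C" "C \<ge> 0"
  proof (cases "Linf_norm \<Omega> g")
    case (real r)
    then show thesis using that[of "max 0 r"] by simp
  qed (use lt that[of 0] in auto)
  have "AE x in lebesgue_on \<Omega>. ereal \<bar>g x\<bar> \<le> Linf_norm \<Omega> g"
    unfolding Linf_norm_def by (rule esssup_AE)
  then have "AE x in lebesgue_on \<Omega>. \<bar>g x\<bar> \<le> C"
    by eventually_elim (metis C(1) ereal_less_eq(3) order_trans)
  then show ?thesis using C that by blast
qed

lemma Linf_norm_le:
  assumes "g \<in> borel_measurable (lebesgue_on \<Omega>)" "AE x in lebesgue_on \<Omega>. \<bar>g x\<bar> \<le> C"
  shows "Linf_norm \<Omega> g \<le> ereal C"
  unfolding Linf_norm_def using assms by (intro esssup_I) auto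

lemma LinfI:
  assumes "g \<in> borel_measurable (lebesgue_on \<Omega>)" "AE x in lebesgue_on \<Omega>. \<bar>g x\<bar> \<le> C"
  shows "g \<in> Linf \<Omega>"
  using Linf_norm_le[OF assms] assms(1) unfolding Linf_def by (auto simp: le_less_trans)

lemma Linf_integrable:
  fixes \<Omega> :: "'a::euclidean_space set"
  assumes "open \<Omega>" "bounded \<Omega>" "g \<in> Linf \<Omega>"
  shows "integrable (lebesgue_on \<Omega>) g"
proof -
  obtain C where C: "AE x in lebesgue_on \<Omega>. \<bar>g x\<bar> \<le> C" using Linf_AE_bounded[OF assms(3)] by blast
  interpret finite_measure "lebesgue_on \<Omega>"
    by (rule finite_measure_lebesgue_on) (simp add: assms bounded_set_imp_lmeasurable)
  show ?thesis using assms C unfolding Linf_def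
    by (intro integrable_const_bound[where B = C]) auto
qed

lemma Linf_diff:
  assumes "f \<in> Linf \<Omega>" "g \<in> Linf \<Omega>" shows "(\<lambda>x. f x - g x) \<in> Linf \<Omega>"
proof -
  obtain C D where "AE x in lebesgue_on \<Omega>. \<bar>f x\<bar> \<le> C" "AE x in lebesgue_on \<Omega>. \<bar>g x\<bar> \<le> D"
    using assms Linf_AE_bounded by metis
  then have "AE x in lebesgue_on \<Omega>. \<bar>f x - g x\<bar> \<le> C + D" by eventually_elim linarith
  then show ?thesis using assms by (intro LinfI[where C = "C + D"]) (auto simp: Linf_def)
qed

text \<open>The bumps of the box are test functions dominated by \<open>1\<close> that converge to its indicator, so the orthogonality
passes to the box by dominated convergence.\<close>
lemma integral_cbox_eq_0_if_orthogonal_test_functions: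
  fixes \<Omega> :: "'a::euclidean_space set"
  assumes \<Omega>: "open \<Omega>" and G: "integrable lebesgue G"
    and orth: "\<And>\<phi>. \<phi> \<in> test_functions \<Omega> \<Longrightarrow> (LINT x|lebesgue. G x * \<phi> x) = 0"
    and ab: "cbox a b \<subseteq> \<Omega>" "\<And>i. i \<in> Basis \<Longrightarrow> a \<bullet> i \<le> b \<bullet> i"
  shows "integral (cbox a b) G = 0"
proof -
  have cb: "box_bump a b n \<in> borel_measurable lebesgue" for n
    by (simp add: borel_measurable_continuous_onI c1_fun_continuous_on c1_fun_box_bump measurable_completion)
  have Gm: "G \<in> borel_measurable lebesgue" using G by auto
  have "(\<lambda>n. LINT x|lebesgue. G x * box_bump a b n x) \<longlonglongrightarrow> (LINT x|lebesgue. G x * indicator (box a b) x)"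
  proof (rule integral_dominated_convergence[where w = "\<lambda>x. \<bar>G x\<bar>"])
    show "AE x in lebesgue. (\<lambda>n. G x * box_bump a b n x) \<longlonglongrightarrow> G x * indicator (box a b) x"
      by (intro AE_I2 tendsto_intros box_bump_tendsto ab)
    show "AE x in lebesgue. norm (G x * box_bump a b n x) \<le> \<bar>G x\<bar>" for n
      using box_bump_range[of a b n] by (intro AE_I2) (auto simp: abs_mult intro!: mult_left_le)
    show "(\<lambda>x. G x * indicator (box a b) x) \<in> borel_measurable lebesgue"
      using Gm by (intro borel_measurable_times borel_measurable_indicator) auto
  qed (use G Gm cb in auto)
  moreover have "(LINT x|lebesgue. G x * box_bump a b n x) = 0" for n
    by (intro orth box_bump_test_function ab)
  ultimately have "(LINT x|lebesgue. G x * indicator (box a b) x) = 0"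
    by (simp add: LIMSEQ_const_iff)
  then have "(LINT x:box a b|lebesgue. G x) = 0"
    by (simp add: set_lebesgue_integral_def mult.commute)
  moreover have "set_integrable lebesgue (box a b) G"
    using G unfolding set_integrable_def by (intro integrable_mult_indicator) auto
  ultimately have "integral (box a b) G = 0"
    using set_lebesgue_integral_eq_integral(2) by metis
  then show ?thesis by (simp add: integral_open_interval)
qed

text \<open>The fundamental lemma of the calculus of variations. The averages of the function over all small cubes vanish by
the previous lemma, and by Lebesgue's differentiation theorem they converge to its values almost everywhere.\<close>
lemma AE_eq_0_if_orthogonal_test_functions:
  fixes \<Omega> :: "'a::euclidean_space set"
  assumes \<Omega>: "open \<Omega>" and g: "integrable (lebesgue_on \<Omega>) g"
    and orth: "\<And>\<phi>. \<phi> \<in> test_functions \<Omega> \<Longrightarrow> (LINT x|lebesgue_on \<Omega>. g x * \<phi> x) = 0"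
  shows "AE x in lebesgue_on \<Omega>. g x = 0"
proof -
  define G where "G = (\<lambda>x. indicator \<Omega> x *\<^sub>R g x)"
  have \<Omega>s: "\<Omega> \<in> sets lebesgue" using \<Omega> by simp
  have G: "integrable lebesgue G"
    unfolding G_def using g \<Omega>s by (simp add: integrable_restrict_space)
  have orthG: "(LINT x|lebesgue. G x * \<phi> x) = 0" if "\<phi> \<in> test_functions \<Omega>" for \<phi>
    using orth[OF that] \<Omega>s by (simp add: integral_restrict_space G_def mult.assoc)
  have "G integrable_on cbox a b" for a b
    using integrable_mult_indicator[OF _ G, of "cbox a b"]
    by (intro set_lebesgue_integral_eq_integral(1)) (simp add: set_integrable_def)
  then obtain N where N: "negligible N"
    and lim: "\<And>x e. \<lbrakk>x \<notin> N; 0 < e\<rbrakk> \<Longrightarrow> \<exists>d>0. \<forall>h. 0 < h \<and> h < d \<longrightarrow>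
          norm (integral (cbox x (x + h *\<^sub>R One)) G /\<^sub>R h ^ DIM('a) - G x) < e"
    using integrable_ccontinuous_explicit[of G] by metis
  have "g x = 0" if x: "x \<in> \<Omega>" "x \<notin> N" for x
  proof (rule ccontr)
    assume "g x \<noteq> 0"
    then have "\<bar>G x\<bar> > 0" using x by (simp add: G_def)
    then obtain d where d: "d > 0" and less: "\<And>h. 0 < h \<Longrightarrow> h < d \<Longrightarrow>
        norm (integral (cbox x (x + h *\<^sub>R One)) G /\<^sub>R h ^ DIM('a) - G x) < \<bar>G x\<bar>"
      using lim[OF x(2)] by blast
    obtain r where r: "r > 0" "ball x r \<subseteq> \<Omega>" using \<Omega> x(1) openE by blast
    \<comment> \<open>A cube of side \<open>h\<close> with corner \<open>x\<close> has diameter at most \<open>DIM('a) * h\<close>, so it stays in \<open>ball x r\<close>.\<close>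
    define h where "h = min (d / 2) (r / (2 * DIM('a)))"
    have h: "0 < h" "h < d" "h * DIM('a) < r"
      using d r by (auto simp: h_def min_def field_simps)
    have "cbox x (x + h *\<^sub>R One) \<subseteq> ball x r"
    proof
      fix y assume "y \<in> cbox x (x + h *\<^sub>R One)"
      then have "\<bar>(y - x) \<bullet> i\<bar> \<le> h" if "i \<in> Basis" for i
        using that by (auto simp: mem_box inner_diff_left inner_add_left algebra_simps abs_if)
      then have "norm (y - x) \<le> (\<Sum>i\<in>(Basis::'a set). h)"
        by (intro order_trans[OF norm_le_l1] sum_mono)
      also have "\<dots> < r" using h(3) by (simp add: mult.commute)
      finally show "y \<in> ball x r" by (simp add: dist_norm norm_minus_commute)
    qed
    then have "integral (cbox x (x + h *\<^sub>R One)) G = 0"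
      using r h(1) by (intro integral_cbox_eq_0_if_orthogonal_test_functions[OF \<Omega> G orthG])
        (auto simp: inner_add_left)
    then show False using less[OF h(1,2)] by simp
  qed
  then have "AE x in lebesgue. x \<in> \<Omega> \<longrightarrow> g x = 0"
    using N by (intro AE_I'[of N]) (auto simp: negligible_iff_null_sets)
  then show ?thesis using \<Omega>s by (simp add: AE_restrict_space_iff)
qed

lemma test_function_bounded:
  assumes "\<phi> \<in> test_functions \<Omega>"
  obtains C where "\<And>x. \<bar>\<phi> x\<bar> \<le> C"
proof -
  have "continuous_on UNIV \<phi>"
    using assms unfolding test_functions_def by (auto intro!: c1_fun_continuous_on simp: c1_fun_def)
  then have "compact (\<phi> ` closure {x. \<phi> x \<noteq> 0})"
    using assms unfolding test_functions_def by (auto intro!: compact_continuous_image intro: continuous_on_subset)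
  then obtain C where C: "\<And>x. x \<in> closure {x. \<phi> x \<noteq> 0} \<Longrightarrow> \<bar>\<phi> x\<bar> \<le> C"
    using compact_imp_bounded bounded_iff by (metis image_eqI real_norm_def)
  have "\<bar>\<phi> x\<bar> \<le> max C 0" for x
    using C[of x] closure_subset[of "{x. \<phi> x \<noteq> 0}"] by (cases "\<phi> x = 0") auto
  then show ?thesis using that by blast
qed

lemma has_weak_partial_unique:
  fixes \<Omega> :: "'a::euclidean_space set"
  assumes \<Omega>: "open \<Omega>" "bounded \<Omega>" and g: "g \<in> Linf \<Omega>" and h: "h \<in> Linf \<Omega>"
    and wg: "has_weak_partial \<Omega> v u g" and wh: "has_weak_partial \<Omega> v u h"
  shows "AE x in lebesgue_on \<Omega>. g x = h x"
proof -
  have "(LINT x|lebesgue_on \<Omega>. (g x - h x) * \<phi> x) = 0" if \<phi>: "\<phi> \<in> test_functions \<Omega>" for \<phi>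
  proof -
    obtain C where C: "\<And>x. \<bar>\<phi> x\<bar> \<le> C" using test_function_bounded[OF \<phi>] by blast
    have m: "\<phi> \<in> borel_measurable (lebesgue_on \<Omega>)"
      using \<phi> unfolding test_functions_def
      by (auto intro!: continuous_imp_measurable_on_sets_lebesgue c1_fun_continuous_on simp: c1_fun_def \<Omega>)
    have i: "integrable (lebesgue_on \<Omega>) (\<lambda>x. k x * \<phi> x)" if k: "k \<in> Linf \<Omega>" for k
    proof (rule Bochner_Integration.integrable_bound[of _ "\<lambda>x. C * k x"])
      show "integrable (lebesgue_on \<Omega>) (\<lambda>x. C * k x)" using Linf_integrable[OF \<Omega> k] by simp
      show "AE x in lebesgue_on \<Omega>. norm (k x * \<phi> x) \<le> norm (C * k x)"
        using order_trans[OF C abs_ge_self]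
        by (intro AE_I2) (auto simp: abs_mult mult.commute[of "\<bar>C\<bar>"] intro!: mult_left_mono)
    qed (use k m in \<open>auto simp: Linf_def\<close>)
    have "(LINT x|lebesgue_on \<Omega>. (g x - h x) * \<phi> x)
        = (LINT x|lebesgue_on \<Omega>. g x * \<phi> x) - (LINT x|lebesgue_on \<Omega>. h x * \<phi> x)"
      using i g h by (simp add: left_diff_distrib Bochner_Integration.integral_diff)
    also have "\<dots> = 0" using wg wh \<phi> unfolding has_weak_partial_def by fastforce
    finally show ?thesis .
  qed
  then have "AE x in lebesgue_on \<Omega>. g x - h x = 0"
    by (intro AE_eq_0_if_orthogonal_test_functions[OF \<Omega>(1)] Linf_integrable[OF \<Omega>] Linf_diff g h)
  then show ?thesis by simp
qed

lemma weak_partial_props: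
  assumes "g \<in> Linf \<Omega>" "has_weak_partial \<Omega> v u g"
  shows "weak_partial \<Omega> v u \<in> Linf \<Omega>" "has_weak_partial \<Omega> v u (weak_partial \<Omega> v u)"
  unfolding weak_partial_def
  using someI[of "\<lambda>g. g \<in> Linf \<Omega> \<and> has_weak_partial \<Omega> v u g" g] assms by blast+

text \<open>The representative picked by the choice operator may be replaced by any other bounded weak derivative.\<close>
lemma weak_partial_eq_AE:
  fixes \<Omega> :: "'a::euclidean_space set"
  assumes "open \<Omega>" "bounded \<Omega>" "g \<in> Linf \<Omega>" "has_weak_partial \<Omega> v u g"
  shows "AE x in lebesgue_on \<Omega>. weak_partial \<Omega> v u x = g x"
  using weak_partial_props[OF assms(3,4)] assms by (intro has_weak_partial_unique)

section \<open>Weak derivatives as limits of difference quotients\<close>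

text \<open>The quantitative properties of a test function that dominated convergence needs: bounded support and a global
Lipschitz constant.\<close>
lemma test_functionE:
  assumes "\<phi> \<in> test_functions \<Omega>"
  obtains D R C where "\<And>z. (\<phi> has_derivative blinfun_apply (D z)) (at z)" "continuous_on UNIV D"
    "\<And>z. \<phi> z \<noteq> 0 \<Longrightarrow> norm z \<le> R" "\<And>x y. \<bar>\<phi> x - \<phi> y\<bar> \<le> C * norm (x - y)" "R \<ge> 0" "C \<ge> 0"
    "\<And>z. \<phi> z \<noteq> 0 \<Longrightarrow> z \<in> \<Omega>" "\<And>z. z \<notin> \<Omega> \<Longrightarrow> D z = 0"
proof -
  let ?S = "closure {z. \<phi> z \<noteq> 0}"
  obtain D where D: "continuous_on UNIV D" "\<And>z. (\<phi> has_derivative blinfun_apply (D z)) (at z)"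
    and S: "compact ?S" "?S \<subseteq> \<Omega>"
    using assms unfolding test_functions_def by blast
  obtain R where R: "\<And>z. z \<in> ?S \<Longrightarrow> norm z \<le> R"
    using compact_imp_bounded[OF S(1)] bounded_iff by blast
  have D0: "D z = 0" if "z \<notin> ?S" for z
  proof -
    have "(\<phi> has_derivative (\<lambda>_. 0)) (at z)"
    proof (rule has_derivative_transform_within_open[of "\<lambda>_. 0" _ _ "UNIV" "- ?S"])
      show "\<And>y. y \<in> - ?S \<Longrightarrow> 0 = \<phi> y" using closure_subset[of "{z. \<phi> z \<noteq> 0}"] by fastforce
    qed (use that in auto)
    then have "blinfun_apply (D z) = (\<lambda>_. 0)" using D(2) has_derivative_unique by blast
    then show ?thesis by (intro blinfun_eqI) simp
  qed
  have "compact (D ` ?S)"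
    using S(1) D(1) by (intro compact_continuous_image) (auto intro: continuous_on_subset)
  then obtain C where C: "\<And>z. z \<in> ?S \<Longrightarrow> norm (D z) \<le> C"
    using compact_imp_bounded bounded_iff by (metis image_eqI)
  have C': "norm (D z) \<le> max C 0" for z
    using C[of z] D0[of z] by (cases "z \<in> ?S") auto
  have "\<bar>\<phi> x - \<phi> y\<bar> \<le> max C 0 * norm (x - y)" for x y
  proof -
    have "norm (\<phi> x - \<phi> y) \<le> max C 0 * norm (x - y)"
      by (rule differentiable_bound[where f = \<phi> and S = UNIV and f' = "\<lambda>z. blinfun_apply (D z)"])
         (use D C' in \<open>auto simp: norm_blinfun.rep_eq[symmetric]\<close>)
    then show ?thesis by simp
  qed
  moreover have "norm z \<le> max R 0" if "\<phi> z \<noteq> 0" for z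
    using R[of z] that closure_subset[of "{z. \<phi> z \<noteq> 0}"] by fastforce
  moreover have "z \<in> \<Omega>" if "\<phi> z \<noteq> 0" for z
    using that S(2) closure_subset[of "{z. \<phi> z \<noteq> 0}"] by fastforce
  moreover have "D z = 0" if "z \<notin> \<Omega>" for z using D0 S(2) that by blast
  ultimately show ?thesis using D by (intro that[of D "max R 0" "max C 0"]) auto
qed

lemma continuous_bounded_on_cball:
  fixes f :: "'a::euclidean_space \<Rightarrow> real"
  assumes "continuous_on UNIV f"
  obtains B where "\<And>z. norm z \<le> R \<Longrightarrow> \<bar>f z\<bar> \<le> B"
proof -
  have "compact (f ` cball 0 R)"
    by (intro compact_continuous_image continuous_on_subset[OF assms]) auto
  then have "bounded (f ` cball 0 R)" by (rule compact_imp_bounded)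
  then obtain B where "\<forall>y \<in> f ` cball 0 R. norm y \<le> B" unfolding bounded_iff by blast
  then show ?thesis by (intro that[of B]) auto
qed

lemma integrable_compact_support_bounded:
  fixes f :: "'a::euclidean_space \<Rightarrow> real"
  assumes "f \<in> borel_measurable borel" "\<And>z. f z \<noteq> 0 \<Longrightarrow> norm z \<le> R" "\<And>z. norm z \<le> R \<Longrightarrow> \<bar>f z\<bar> \<le> B"
  shows "integrable lborel f"
proof (rule Bochner_Integration.integrable_bound[of _ "\<lambda>z. B * indicator (cball 0 R) z"])
  show "integrable lborel (\<lambda>z. B * indicator (cball 0 R) z)"
    by (intro integrable_mult_right integrable_real_indicator) (use emeasure_lborel_cball_finite[of 0 R] in \<open>auto simp: top.not_eq_extremum\<close>)
  show "AE z in lborel. norm (f z) \<le> norm (B * indicator (cball 0 R) z)"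
  proof (intro AE_I2)
    fix z show "norm (f z) \<le> norm (B * indicator (cball 0 R) z)"
      using assms(2)[of z] assms(3)[of z] by (cases "f z = 0") auto
  qed
qed (use assms in auto)

lemma lborel_integral_translate:
  fixes f :: "'a::euclidean_space \<Rightarrow> real"
  assumes "f \<in> borel_measurable borel"
  shows "(LINT z|lborel. f (z + c)) = (LINT z|lborel. f z)"
proof -
  have "(LINT z|lborel. f z) = (LINT z|distr lborel borel ((+) c). f z)"
    by (simp add: lborel_distr_plus)
  also have "\<dots> = (LINT z|lborel. f (c + z))"
    by (rule integral_distr) (use assms in auto)
  finally show ?thesis by (simp add: add.commute)
qed

text \<open>Summation by parts: translation invariance of the Lebesgue measure moves the shift from \<open>u\<close> to \<open>\<phi>\<close>.\<close>
lemma difference_quotient_by_parts: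
  fixes u :: "'a::euclidean_space \<Rightarrow> real"
  assumes u: "continuous_on UNIV u" and \<phi>: "\<phi> \<in> test_functions \<Omega>"
  shows "(LINT z|lborel. c * (u (z + w) - u z) * \<phi> z) = - (LINT z|lborel. u z * (c * (\<phi> z - \<phi> (z - w))))"
proof -
  obtain D R C where D: "\<And>z. (\<phi> has_derivative blinfun_apply (D z)) (at z)"
    and R: "\<And>z. \<phi> z \<noteq> 0 \<Longrightarrow> norm z \<le> R" using test_functionE[OF \<phi>] by metis
  have c\<phi>: "continuous_on UNIV \<phi>"
    using D by (meson continuous_at_imp_continuous_on has_derivative_continuous)
  have int: "integrable lborel (\<lambda>z. u (z + a) * \<phi> (z + b))" for a b
  proof -
    have c: "continuous_on UNIV (\<lambda>z. u (z + a) * \<phi> (z + b))"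
      by (intro continuous_intros continuous_on_compose2[OF u] continuous_on_compose2[OF c\<phi>]) auto
    obtain B where B: "\<And>z. norm z \<le> R + norm b \<Longrightarrow> \<bar>u (z + a) * \<phi> (z + b)\<bar> \<le> B"
      by (rule continuous_bounded_on_cball[OF c, of "R + norm b"]) blast
    show ?thesis
    proof (rule integrable_compact_support_bounded[where R = "R + norm b" and B = B])
      fix z assume "u (z + a) * \<phi> (z + b) \<noteq> 0"
      then have "norm (z + b) \<le> R" using R by auto
      then show "norm z \<le> R + norm b" using norm_triangle_ineq4[of "z + b" b] by simp
    qed (use B c in \<open>auto intro: borel_measurable_continuous_onI\<close>)
  qed
  have i0: "integrable lborel (\<lambda>z. u z * \<phi> z)" and i1: "integrable lborel (\<lambda>z. u (z + w) * \<phi> z)"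
    and i2: "integrable lborel (\<lambda>z. u z * \<phi> (z - w))"
    using int[of 0 0] int[of w 0] int[of 0 "- w"] by auto
  have "(LINT z|lborel. c * (u (z + w) - u z) * \<phi> z)
      = (LINT z|lborel. c * (u (z + w) * \<phi> z) - c * (u z * \<phi> z))"
    by (simp add: algebra_simps)
  also have "\<dots> = c * (LINT z|lborel. u (z + w) * \<phi> z) - c * (LINT z|lborel. u z * \<phi> z)"
    using i0 i1 by (subst Bochner_Integration.integral_diff) auto
  also have "(LINT z|lborel. u (z + w) * \<phi> z) = (LINT z|lborel. u z * \<phi> (z - w))"
    using lborel_integral_translate[of "\<lambda>z. u z * \<phi> (z - w)" w] i2 by simp
  also have "c * (LINT z|lborel. u z * \<phi> (z - w)) - c * (LINT z|lborel. u z * \<phi> z)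
     = (LINT z|lborel. c * (u z * \<phi> (z - w)) - c * (u z * \<phi> z))"
    using i0 i2 by (subst Bochner_Integration.integral_diff) auto
  also have "\<dots> = (LINT z|lborel. - (u z * (c * (\<phi> z - \<phi> (z - w)))))"
    by (simp add: algebra_simps)
  finally show ?thesis by simp
qed

lemma sequential_difference_quotient:
  fixes f :: "'a::real_normed_vector \<Rightarrow> real"
  assumes "((\<lambda>h. f (z + h *\<^sub>R v)) has_real_derivative d) (at 0)"
  shows "(\<lambda>n. real n * (f (z + v /\<^sub>R real n) - f z)) \<longlonglongrightarrow> d"
proof -
  have "((\<lambda>h. (f (z + h *\<^sub>R v) - f z) / h) \<longlongrightarrow> d) (at 0)"
    using assms by (simp add: DERIV_def)
  moreover have "filterlim (\<lambda>n. inverse (real n)) (at 0) sequentially"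
    unfolding filterlim_at by (auto intro!: lim_inverse_n eventually_sequentiallyI[of 1])
  ultimately have "(\<lambda>n. (f (z + inverse (real n) *\<^sub>R v) - f z) / inverse (real n)) \<longlonglongrightarrow> d"
    by (rule filterlim_compose)
  then show ?thesis by (simp add: divide_inverse mult.commute)
qed

lemma has_derivative_along_line:
  fixes f :: "'a::real_normed_vector \<Rightarrow> real"
  assumes "(f has_derivative f') (at z)"
  shows "((\<lambda>h. f (z + h *\<^sub>R v)) has_real_derivative f' v) (at 0)"
proof -
  have "((\<lambda>h. f (z + h *\<^sub>R v)) has_derivative (\<lambda>h. f' (h *\<^sub>R v))) (at 0)"
    by (rule has_derivative_compose[where f = "\<lambda>h. z + h *\<^sub>R v" and g = f])
       (use assms in \<open>auto intro!: derivative_eq_intros\<close>)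
  moreover have "(\<lambda>h. f' (h *\<^sub>R v)) = (*) (f' v)"
    using has_derivative_linear[OF assms] by (auto simp: linear_scale)
  ultimately show ?thesis by (simp add: has_field_derivative_def)
qed

lemma backward_difference_quotient:
  fixes f :: "'a::real_normed_vector \<Rightarrow> real"
  assumes "(f has_derivative f') (at z)"
  shows "(\<lambda>n. real n * (f z - f (z - v /\<^sub>R real n))) \<longlonglongrightarrow> f' v"
proof -
  have "(\<lambda>n. - (real n * (f (z + (- v) /\<^sub>R real n) - f z))) \<longlonglongrightarrow> - f' (- v)"
    by (intro tendsto_minus sequential_difference_quotient has_derivative_along_line assms)
  moreover have "- f' (- v) = f' v" using has_derivative_linear[OF assms] by (simp add: linear_neg)
  ultimately show ?thesis by (simp add: right_diff_distrib)
qed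

text \<open>Both sides of the discrete integration by parts converge by dominated convergence: on one side the difference
quotients of \<open>u\<close> are bounded by its Lipschitz constant, on the other side those of \<open>\<phi>\<close> are bounded and supported in a
common ball.\<close>
lemma has_weak_partial_if_difference_quotients_converge:
  fixes u :: "'a::euclidean_space \<Rightarrow> real"
  assumes \<Omega>: "open \<Omega>" and u: "K-lipschitz_on UNIV u"
    and g: "g \<in> borel_measurable (lebesgue_on \<Omega>)"
    and lim: "AE z in lebesgue_on \<Omega>. (\<lambda>n. real n * (u (z + v /\<^sub>R real n) - u z)) \<longlonglongrightarrow> g z"
  shows "has_weak_partial \<Omega> v u g" "AE z in lebesgue_on \<Omega>. \<bar>g z\<bar> \<le> K * norm v"
proof -
  have \<Omega>s: "\<Omega> \<in> sets lebesgue" using \<Omega> by simp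
  have cu: "continuous_on UNIV u" using u by (rule lipschitz_on_continuous_on)
  have K: "K \<ge> 0" using u by (rule lipschitz_on_nonneg)
  have qb: "\<bar>real n * (u (z + v /\<^sub>R real n) - u z)\<bar> \<le> K * norm v" for n z
  proof (cases "n = 0")
    case False
    have "\<bar>u (z + v /\<^sub>R real n) - u z\<bar> \<le> K * (norm v / real n)"
      using lipschitz_onD[OF u, of "z + v /\<^sub>R real n" z] by (simp add: dist_norm divide_inverse mult.commute)
    then have "real n * \<bar>u (z + v /\<^sub>R real n) - u z\<bar> \<le> real n * (K * (norm v / real n))"
      by (rule mult_left_mono) simp
    then show ?thesis using False by (simp only: abs_mult) simp
  qed (use K in auto)
  show "AE z in lebesgue_on \<Omega>. \<bar>g z\<bar> \<le> K * norm v"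
    using lim
  proof eventually_elim
    case (elim z)
    have "(\<lambda>n. \<bar>real n * (u (z + v /\<^sub>R real n) - u z)\<bar>) \<longlonglongrightarrow> \<bar>g z\<bar>"
      using elim by (rule tendsto_rabs)
    then show ?case by (rule Lim_bounded) (use qb in auto)
  qed
  show "has_weak_partial \<Omega> v u g"
    unfolding has_weak_partial_def
  proof
    fix \<phi> assume \<phi>: "\<phi> \<in> test_functions \<Omega>"
    obtain D R C where D: "\<And>z. (\<phi> has_derivative blinfun_apply (D z)) (at z)" "continuous_on UNIV D"
      and R: "\<And>z. \<phi> z \<noteq> 0 \<Longrightarrow> norm z \<le> R" and C: "\<And>x y. \<bar>\<phi> x - \<phi> y\<bar> \<le> C * norm (x - y)" "R \<ge> 0" "C \<ge> 0"
      and supp: "\<And>z. \<phi> z \<noteq> 0 \<Longrightarrow> z \<in> \<Omega>" "\<And>z. z \<notin> \<Omega> \<Longrightarrow> D z = 0"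
      by (rule test_functionE[OF \<phi>]) blast
    have c\<phi>: "continuous_on UNIV \<phi>"
      using D by (meson continuous_at_imp_continuous_on has_derivative_continuous)
    have fd: "frechet_derivative \<phi> (at z) v = D z v" for z
      using frechet_derivative_at[OF D(1)[of z]] by simp
    define q where "q n z = real n * (u (z + v /\<^sub>R real n) - u z)" for n z
    define G where "G z = (if z \<in> \<Omega> then g z else 0)" for z
    have Gm: "G \<in> borel_measurable lebesgue"
      unfolding G_def using g borel_measurable_if_I[OF g \<Omega>s] by simp
    have cq: "continuous_on UNIV (q n)" for n
      unfolding q_def by (intro continuous_intros continuous_on_compose2[OF cu]) auto
    have i\<phi>: "integrable lborel \<phi>"
    proof -
      obtain B where "\<And>z. norm z \<le> R \<Longrightarrow> \<bar>\<phi> z\<bar> \<le> B"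
        by (rule continuous_bounded_on_cball[OF c\<phi>, of R]) blast
      then show ?thesis using R c\<phi>
        by (intro integrable_compact_support_bounded[where R = R and B = B])
           (auto intro: borel_measurable_continuous_onI)
    qed
    have mb: "(\<lambda>z. f z) \<in> borel_measurable lebesgue" if "continuous_on UNIV f" for f :: "'a \<Rightarrow> real"
      using that by (simp add: borel_measurable_continuous_onI measurable_completion)
    have L1: "(\<lambda>n. LINT z|lebesgue. q n z * \<phi> z) \<longlonglongrightarrow> (LINT z|lebesgue. G z * \<phi> z)"
    proof (rule integral_dominated_convergence[where w = "\<lambda>z. K * norm v * \<bar>\<phi> z\<bar>"])
      show "(\<lambda>z. G z * \<phi> z) \<in> borel_measurable lebesgue"
        using Gm mb[OF c\<phi>] by simp
      show "(\<lambda>z. q n z * \<phi> z) \<in> borel_measurable lebesgue" for n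
        using mb[OF cq] mb[OF c\<phi>] by simp
      show "integrable lebesgue (\<lambda>z. K * norm v * \<bar>\<phi> z\<bar>)"
        using i\<phi> by (simp add: integrable_completion)
      show "AE z in lebesgue. norm (q n z * \<phi> z) \<le> K * norm v * \<bar>\<phi> z\<bar>" for n
        using qb[of n] by (intro AE_I2) (auto simp: q_def abs_mult intro!: mult_right_mono)
      have "AE z in lebesgue. z \<in> \<Omega> \<longrightarrow> (\<lambda>n. q n z) \<longlonglongrightarrow> g z"
        using lim \<Omega>s unfolding q_def by (simp add: AE_restrict_space_iff)
      then show "AE z in lebesgue. (\<lambda>n. q n z * \<phi> z) \<longlonglongrightarrow> G z * \<phi> z"
      proof eventually_elim
        case (elim z)
        show ?case
        proof (cases "z \<in> \<Omega>")
          case True then show ?thesis using elim by (auto simp: G_def intro!: tendsto_intros)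
        next
          case False
          then have "\<phi> z = 0" using supp(1) by blast
          then show ?thesis by simp
        qed
      qed
    qed
    define p where "p n z = real n * (\<phi> z - \<phi> (z - v /\<^sub>R real n))" for n z
    have cp: "continuous_on UNIV (p n)" for n
      unfolding p_def by (intro continuous_intros continuous_on_compose2[OF c\<phi>]) auto
    have pb: "\<bar>p n z\<bar> \<le> C * norm v" for n z
    proof (cases "n = 0")
      case False
      have "\<bar>\<phi> z - \<phi> (z - v /\<^sub>R real n)\<bar> \<le> C * (norm v / real n)"
        using C(1)[of z "z - v /\<^sub>R real n"] by (simp add: divide_inverse mult.commute)
      then have "real n * \<bar>\<phi> z - \<phi> (z - v /\<^sub>R real n)\<bar> \<le> real n * (C * (norm v / real n))"
        by (rule mult_left_mono) simp
      then show ?thesis using False by (simp only: p_def abs_mult) simp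
    qed (use C in \<open>auto simp: p_def\<close>)
    have ps: "norm z \<le> R + norm v" if "p n z \<noteq> 0" for n z
    proof -
      have n: "n > 0" using that by (auto simp: p_def intro: Nat.gr0I)
      have "norm (v /\<^sub>R real n) \<le> norm v" using n mult_left_mono[of 1 "real n" "norm v"] by (simp add: divide_simps)
      moreover have "\<phi> z \<noteq> 0 \<or> \<phi> (z - v /\<^sub>R real n) \<noteq> 0" using that by (auto simp: p_def)
      ultimately show ?thesis
        using R[of z] R[of "z - v /\<^sub>R real n"] norm_triangle_ineq[of "z - v /\<^sub>R real n" "v /\<^sub>R real n"]
          norm_ge_zero[of v] unfolding diff_add_cancel by linarith
    qed
    obtain B where B: "\<And>z. norm z \<le> R + norm v \<Longrightarrow> \<bar>u z\<bar> \<le> B"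
      by (rule continuous_bounded_on_cball[OF cu, of "R + norm v"]) blast
    have L2: "(\<lambda>n. LINT z|lebesgue. u z * p n z) \<longlonglongrightarrow> (LINT z|lebesgue. u z * D z v)"
    proof (rule integral_dominated_convergence[where w = "\<lambda>z. B * (C * norm v) * indicator (cball 0 (R + norm v)) z"])
      show "(\<lambda>z. u z * D z v) \<in> borel_measurable lebesgue"
        by (intro mb continuous_intros cu D)
      show "(\<lambda>z. u z * p n z) \<in> borel_measurable lebesgue" for n
        by (intro mb continuous_intros cu cp)
      show "integrable lebesgue (\<lambda>z. B * (C * norm v) * indicator (cball 0 (R + norm v)) z)"
        by (intro integrable_mult_right integrable_real_indicator)
           (use emeasure_lborel_cball_finite[of 0 "R + norm v"] in \<open>auto simp: top.not_eq_extremum\<close>)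
      show "AE z in lebesgue. norm (u z * p n z) \<le> B * (C * norm v) * indicator (cball 0 (R + norm v)) z" for n
      proof (intro AE_I2)
        fix z
        show "norm (u z * p n z) \<le> B * (C * norm v) * indicator (cball 0 (R + norm v)) z"
        proof (cases "z \<in> cball 0 (R + norm v)")
          case True
          have "\<bar>u z\<bar> * \<bar>p n z\<bar> \<le> B * (C * norm v)"
            using B[of z] True pb[of n z] by (intro mult_mono) auto
          then show ?thesis using True by (simp add: abs_mult)
        next
          case False
          then have "p n z = 0" using ps[of n z] by auto
          then show ?thesis using False by simp
        qed
      qed
      show "AE z in lebesgue. (\<lambda>n. u z * p n z) \<longlonglongrightarrow> u z * D z v"
        unfolding p_def by (intro AE_I2 tendsto_intros backward_difference_quotient D)
    qed
    have "(LINT z|lebesgue. q n z * \<phi> z) = - (LINT z|lebesgue. u z * p n z)" for n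
    proof -
      have "(LINT z|lborel. q n z * \<phi> z) = - (LINT z|lborel. u z * p n z)"
        unfolding q_def p_def by (rule difference_quotient_by_parts[OF cu \<phi>])
      moreover have "(\<lambda>z. q n z * \<phi> z) \<in> borel_measurable lborel" "(\<lambda>z. u z * p n z) \<in> borel_measurable lborel"
        by (auto intro!: borel_measurable_continuous_onI continuous_intros cq cp cu c\<phi>)
      ultimately show ?thesis by (simp add: integral_completion)
    qed
    then have "(\<lambda>n. LINT z|lebesgue. q n z * \<phi> z) \<longlonglongrightarrow> - (LINT z|lebesgue. u z * D z v)"
      using tendsto_minus[OF L2] by simp
    then have "(LINT z|lebesgue. G z * \<phi> z) = - (LINT z|lebesgue. u z * D z v)"
      using L1 LIMSEQ_unique by blast
    moreover have "(LINT z|lebesgue_on \<Omega>. g z * \<phi> z) = (LINT z|lebesgue. G z * \<phi> z)"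
      using \<Omega>s by (subst integral_restrict_space) (auto simp: G_def intro!: Bochner_Integration.integral_cong)
    moreover have "(LINT z|lebesgue_on \<Omega>. u z * D z v) = (LINT z|lebesgue. u z * D z v)"
      using \<Omega>s supp(2) by (subst integral_restrict_space) (auto simp: indicator_def intro!: Bochner_Integration.integral_cong)
    ultimately show "(LINT x|lebesgue_on \<Omega>. u x * frechet_derivative \<phi> (at x) v) = - (LINT x|lebesgue_on \<Omega>. g x * \<phi> x)"
      by (simp add: fd)
  qed
qed

lemma has_weak_partial_cong:
  assumes "\<And>z. z \<in> \<Omega> \<Longrightarrow> u z = u' z" "has_weak_partial \<Omega> v u g"
  shows "has_weak_partial \<Omega> v u' g"
proof -
  have "(LINT x|lebesgue_on \<Omega>. u' x * frechet_derivative \<phi> (at x) v)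
      = (LINT x|lebesgue_on \<Omega>. u x * frechet_derivative \<phi> (at x) v)" for \<phi>
    using assms(1) by (intro Bochner_Integration.integral_cong) auto
  then show ?thesis using assms(2) unfolding has_weak_partial_def by simp
qed

text \<open>The projection onto the closed convex set \<open>closure \<Omega>\<close> does not increase distances, so it extends \<open>u\<close> to the whole
space with the same Lipschitz constant; inside \<open>\<Omega>\<close> the difference quotients eventually do not see the extension.\<close>
lemma has_weak_partial_lipschitz_convex:
  fixes u :: "'a::euclidean_space \<Rightarrow> real"
  assumes \<Omega>: "open \<Omega>" "convex \<Omega>" "\<Omega> \<noteq> {}" and u: "K-lipschitz_on (closure \<Omega>) u"
    and g: "g \<in> borel_measurable (lebesgue_on \<Omega>)"
    and lim: "AE z in lebesgue_on \<Omega>. (\<lambda>n. real n * (u (z + v /\<^sub>R real n) - u z)) \<longlonglongrightarrow> g z"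
  shows "has_weak_partial \<Omega> v u g" "AE z in lebesgue_on \<Omega>. \<bar>g z\<bar> \<le> K * norm v"
proof -
  define U where "U z = u (closest_point (closure \<Omega>) z)" for z
  have cl: "convex (closure \<Omega>)" "closed (closure \<Omega>)" "closure \<Omega> \<noteq> {}"
    using \<Omega> by (auto simp: convex_closure)
  have "K-lipschitz_on UNIV U"
  proof (rule lipschitz_onI)
    fix x y
    have "dist (U x) (U y) \<le> K * dist (closest_point (closure \<Omega>) x) (closest_point (closure \<Omega>) y)"
      unfolding U_def by (rule lipschitz_onD[OF u]) (use closest_point_in_set[OF cl(2,3)] in auto)
    also have "\<dots> \<le> K * dist x y"
      by (intro mult_left_mono closest_point_lipschitz[OF cl] lipschitz_on_nonneg[OF u])
    finally show "dist (U x) (U y) \<le> K * dist x y" .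
  qed (rule lipschitz_on_nonneg[OF u])
  moreover have eq: "U z = u z" if "z \<in> \<Omega>" for z
    using that closure_subset[of \<Omega>] by (auto simp: U_def closest_point_self)
  moreover have "AE z in lebesgue_on \<Omega>. (\<lambda>n. real n * (U (z + v /\<^sub>R real n) - U z)) \<longlonglongrightarrow> g z"
    using lim AE_space
  proof eventually_elim
    case (elim z)
    then have z: "z \<in> \<Omega>" by simp
    have "(\<lambda>n. z + v /\<^sub>R real n) \<longlonglongrightarrow> z + 0 *\<^sub>R v"
      by (intro tendsto_intros lim_inverse_n)
    then have "eventually (\<lambda>n. z + v /\<^sub>R real n \<in> \<Omega>) sequentially"
      using \<Omega>(1) z by (auto intro: topological_tendstoD)
    then have "eventually (\<lambda>n. real n * (u (z + v /\<^sub>R real n) - u z) = real n * (U (z + v /\<^sub>R real n) - U z)) sequentially"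
      by eventually_elim (simp add: eq z)
    then show ?case using elim(1) by (rule Lim_transform_eventually[rotated])
  qed
  ultimately have "has_weak_partial \<Omega> v U g" "AE z in lebesgue_on \<Omega>. \<bar>g z\<bar> \<le> K * norm v"
    using has_weak_partial_if_difference_quotients_converge[OF \<Omega>(1) _ g] by blast+
  then show "has_weak_partial \<Omega> v u g" "AE z in lebesgue_on \<Omega>. \<bar>g z\<bar> \<le> K * norm v"
    using has_weak_partial_cong[of \<Omega> U u] eq by blast+
qed

section \<open>Lipschitz functions on the line are integrals of their derivatives\<close>

text \<open>Lebesgue's differentiation theorem over intervals to the right of \<open>x\<close> gives the right derivative; applied to the
reflected function it gives the left derivative.\<close>
lemma AE_derivative_if_indefinite_integral:
  fixes h k :: "real \<Rightarrow> real"
  assumes int: "\<And>a b. a \<le> b \<Longrightarrow> (k has_integral (h b - h a)) {a..b}"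
  obtains N where "negligible N" "\<And>x. x \<notin> N \<Longrightarrow> (h has_real_derivative k x) (at x)"
proof -
  have i1: "k integrable_on cbox a b" for a b
    using int[of a b] by (cases "a \<le> b") (auto intro: has_integral_integrable)
  have ref: "((\<lambda>x. k (- x)) has_integral (h (- a) - h (- b))) {a..b}" if "a \<le> b" for a b
    using int[of "- b" "- a"] that has_integral_reflect_real[of k "h (- a) - h (- b)" "- a" "- b"] by simp
  have i2: "(\<lambda>x. k (- x)) integrable_on cbox a b" for a b
    using ref[of a b] by (cases "a \<le> b") (auto intro: has_integral_integrable)
  obtain N1 where N1: "negligible N1"
    and r1: "\<And>x e. \<lbrakk>x \<notin> N1; 0 < e\<rbrakk> \<Longrightarrow> \<exists>d>0. \<forall>t. 0 < t \<and> t < d \<longrightarrow>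
        norm (integral (cbox x (x + t *\<^sub>R One)) k /\<^sub>R t ^ DIM(real) - k x) < e"
    using integrable_ccontinuous_explicit[OF i1] by metis
  obtain N2 where N2: "negligible N2"
    and r2: "\<And>x e. \<lbrakk>x \<notin> N2; 0 < e\<rbrakk> \<Longrightarrow> \<exists>d>0. \<forall>t. 0 < t \<and> t < d \<longrightarrow>
        norm (integral (cbox x (x + t *\<^sub>R One)) (\<lambda>x. k (- x)) /\<^sub>R t ^ DIM(real) - k (- x)) < e"
    using integrable_ccontinuous_explicit[OF i2] by metis
  have "negligible (uminus ` N2)"
    by (rule negligible_differentiable_image_negligible[OF _ N2]) (auto intro: differentiable_on_minus differentiable_on_ident)
  then have "negligible (N1 \<union> uminus ` N2)" using N1 by simp
  moreover have "(h has_real_derivative k x) (at x)" if x: "x \<notin> N1 \<union> uminus ` N2" for x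
    unfolding DERIV_def
  proof (rule LIM_I)
    fix e :: real assume e: "e > 0"
    have x1: "x \<notin> N1" and x2: "- x \<notin> N2" using x by (simp, metis UnI2 image_eqI minus_minus)
    obtain d1 where d1: "d1 > 0" "\<And>t. 0 < t \<Longrightarrow> t < d1 \<Longrightarrow> norm (integral {x..x + t} k / t - k x) < e"
      using r1[OF x1 e] by (auto simp: divide_inverse mult.commute)
    obtain d2 where d2: "d2 > 0" "\<And>t. 0 < t \<Longrightarrow> t < d2 \<Longrightarrow>
        norm (integral {- x..- x + t} (\<lambda>x. k (- x)) / t - k x) < e"
      using r2[OF x2 e] by (auto simp: divide_inverse mult.commute)
    show "\<exists>s>0. \<forall>t. t \<noteq> 0 \<and> norm (t - 0) < s \<longrightarrow> norm ((h (x + t) - h x) / t - k x) < e"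
    proof (intro exI[of _ "min d1 d2"] conjI allI impI)
      fix t :: real assume t: "t \<noteq> 0 \<and> norm (t - 0) < min d1 d2"
      show "norm ((h (x + t) - h x) / t - k x) < e"
      proof (cases "t > 0")
        case True
        then have "integral {x..x + t} k = h (x + t) - h x"
          using int[of x "x + t"] by (intro integral_unique) (simp add: add.commute)
        then show ?thesis using d1(2)[of t] t True by simp
      next
        case False
        then have "integral {- x..- x + - t} (\<lambda>x. k (- x)) = h x - h (x + t)"
          using ref[of "- x" "- x + - t"] by (intro integral_unique) (simp add: add.commute)
        moreover have "norm (integral {- x..- x + - t} (\<lambda>x. k (- x)) / (- t) - k x) < e"
          using d2(2)[of "- t"] t False by simp
        moreover have "(h x - h (x + t)) / (- t) = (h (x + t) - h x) / t"
          using t by (simp add: divide_simps)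
        ultimately show ?thesis by simp
      qed
    qed (use d1 d2 in auto)
  qed
  ultimately show ?thesis by (rule that)
qed

text \<open>Such a function is a bijection of the line with a contracting inverse \<open>J\<close>. The image of the Lebesgue measure under \<open>J\<close>
gives \<open>{a..b}\<close> the mass \<open>F b - F a\<close>; it has no mass on null sets because the Lipschitz function \<open>F\<close> maps null sets to
null sets. Its Radon-Nikodym density is the derivative.\<close>
lemma expanding_lipschitz_density:
  fixes F :: "real \<Rightarrow> real"
  assumes low: "\<And>x y. x \<le> y \<Longrightarrow> y - x \<le> F y - F x" and up: "\<And>x y. x \<le> y \<Longrightarrow> F y - F x \<le> K * (y - x)"
  obtains k where "k \<in> borel_measurable borel"
    "\<And>a b. a \<le> b \<Longrightarrow> (k has_integral (F b - F a)) {a..b}"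
proof -
  have lip: "\<bar>F y - F x\<bar> \<le> K * \<bar>y - x\<bar>" for x y
    using low[of x y] up[of x y] low[of y x] up[of y x] by (cases x y rule: linorder_le_cases) (simp_all add: abs_if)
  have cF: "continuous_on S F" for S
  proof (rule lipschitz_on_continuous_on[of "max K 0"], rule lipschitz_onI)
    fix x y
    have "\<bar>F x - F y\<bar> \<le> K * \<bar>x - y\<bar>" by (rule lip)
    also have "\<dots> \<le> max K 0 * \<bar>x - y\<bar>" by (rule mult_right_mono) auto
    finally show "dist (F x) (F y) \<le> max K 0 * dist x y" by (simp add: dist_real_def)
  qed simp
  have mono: "F x \<le> F y \<longleftrightarrow> x \<le> y" for x y using low[of x y] low[of y x] by linarith
  have "inj F" using mono by (intro injI) (metis order.antisym order_refl)
  moreover have "surj F"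
  proof -
    have "\<exists>x. F x = y" for y
    proof -
    let ?r = "\<bar>y - F 0\<bar>"
    have "F (- ?r) \<le> y" "y \<le> F ?r" using low[of "- ?r" 0] low[of 0 ?r] by auto
    then show "\<exists>x. F x = y"
      using IVT'[of F "- ?r" y ?r] cF by force
    qed
    then show ?thesis by (metis surjI)
  qed
  ultimately have bij: "bij F" by (simp add: bij_def)
  define J where "J = inv F"
  have FJ: "F (J y) = y" for y using bij by (simp add: J_def surj_f_inv_f bij_def)
  have JF: "J (F x) = x" for x using bij by (simp add: J_def bij_def)
  have JL: "\<bar>J y - J x\<bar> \<le> \<bar>y - x\<bar>" for x y
    using low[of "J x" "J y"] low[of "J y" "J x"]
    by (cases "J x" "J y" rule: linorder_le_cases) (simp_all add: FJ abs_if)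
  have "continuous_on UNIV J"
    by (rule lipschitz_on_continuous_on[of 1], rule lipschitz_onI) (use JL in \<open>auto simp: dist_real_def\<close>)
  then have Jm: "J \<in> borel \<rightarrow>\<^sub>M borel" by (rule borel_measurable_continuous_onI)
  define \<nu> where "\<nu> = distr lborel borel J"
  have vim: "J -` A = F ` A" for A 

  proof (intro equalityI subsetI)
    fix y assume "y \<in> J -` A"
    then show "y \<in> F ` A" by (intro image_eqI[of _ _ "J y"]) (simp_all add: FJ)
  qed (auto simp: JF)
  have em: "emeasure \<nu> A = emeasure lborel (F ` A)" if "A \<in> sets borel" for A
    using that Jm by (simp add: \<nu>_def emeasure_distr vim)
  have "absolutely_continuous lborel \<nu>"
    unfolding absolutely_continuous_def
  proof
    fix A :: "real set" assume A: "A \<in> null_sets lborel"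
    then have nA: "negligible A" by (simp add: negligible_iff_null_sets null_sets_completionI)
    have "negligible (F ` A)"
      by (rule negligible_locally_Lipschitz_image[OF _ nA]) (use lip in \<open>auto intro!: exI[of _ UNIV]\<close>)
    moreover have "F ` A \<in> sets borel"
      using measurable_sets[OF Jm, of A] A vim[of A] by (auto simp: null_sets_def)
    ultimately have "emeasure lborel (F ` A) = 0"
      by (auto simp: negligible_iff_null_sets null_sets_completion_iff null_sets_def)
    then show "A \<in> null_sets \<nu>" using A em by (auto simp: null_sets_def \<nu>_def)
  qed
  then obtain f where f: "f \<in> borel_measurable lborel" "density lborel f = \<nu>"
    using sigma_finite_measure.Radon_Nikodym[OF sigma_finite_lborel, of \<nu>] by (auto simp: \<nu>_def)
  define k where "k x = enn2real (f x)" for x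
  have km: "k \<in> borel_measurable borel" using f(1) unfolding k_def by simp
  have "(k has_integral (F b - F a)) {a..b}" if ab: "a \<le> b" for a b
  proof -
    have img: "F ` {a..b} = {F a..F b}"
    proof (intro equalityI subsetI)
      fix y assume "y \<in> {F a..F b}"
      then show "y \<in> F ` {a..b}" using mono[of a "J y"] mono[of "J y" b]
        by (intro image_eqI[of _ _ "J y"]) (simp_all add: FJ)
    qed (auto simp: mono)
    have "(\<integral>\<^sup>+x. f x * indicator {a..b} x \<partial>lborel) = emeasure \<nu> {a..b}"
      unfolding f(2)[symmetric] using f(1) by (simp add: emeasure_density)
    also have "\<dots> = ennreal (F b - F a)" using mono[of a b] ab by (simp add: em img)
    finally have I: "(\<integral>\<^sup>+x. f x * indicator {a..b} x \<partial>lborel) = ennreal (F b - F a)" .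
    have "AE x in lborel. f x * indicator {a..b} x \<noteq> \<infinity>"
      using f(1) I by (intro nn_integral_PInf_AE) auto
    then have "(\<integral>\<^sup>+x. ennreal (k x * indicator {a..b} x) \<partial>lborel) = (\<integral>\<^sup>+x. f x * indicator {a..b} x \<partial>lborel)"
      by (intro nn_integral_cong_AE, eventually_elim)
         (auto simp: k_def indicator_def ennreal_enn2real top.not_eq_extremum)
    then have "((\<lambda>x. k x * indicator {a..b} x) has_integral (F b - F a)) UNIV"
    proof (intro nn_integral_has_integral)
      show "(\<lambda>x. k x * indicator {a..b} x) \<in> borel_measurable borel"
        using km by (intro borel_measurable_times borel_measurable_indicator) auto
    qed (use I mono[of a b] ab in \<open>auto simp: k_def\<close>)
    moreover have "(\<lambda>x. k x * indicator {a..b} x) = (\<lambda>x. if x \<in> {a..b} then k x else 0)" by auto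
    ultimately show ?thesis using has_integral_restrict_UNIV[of "{a..b}" k] by simp
  qed
  then show ?thesis using km that by blast
qed

text \<open>Adding \<open>(K + 1) x\<close> turns a \<open>K\<close>-Lipschitz function into an expanding one.\<close>
lemma lipschitz_real_density:
  fixes h :: "real \<Rightarrow> real"
  assumes h: "K-lipschitz_on UNIV h"
  obtains k N where "k \<in> borel_measurable borel" "\<And>x. \<bar>k x\<bar> \<le> K"
    "\<And>a b. a \<le> b \<Longrightarrow> (k has_integral (h b - h a)) {a..b}"
    "negligible N" "\<And>x. x \<notin> N \<Longrightarrow> (h has_real_derivative k x) (at x)"
proof -
  have K: "K \<ge> 0" using h by (rule lipschitz_on_nonneg)
  have lip: "\<bar>h y - h x\<bar> \<le> K * \<bar>y - x\<bar>" for x y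
    using lipschitz_onD[OF h, of y x] by (simp add: dist_real_def)
  obtain k0 where k0: "k0 \<in> borel_measurable borel"
    and i0: "\<And>a b. a \<le> b \<Longrightarrow> (k0 has_integral (h b + (K + 1) * b - (h a + (K + 1) * a))) {a..b}"
  proof (rule expanding_lipschitz_density[of "\<lambda>x. h x + (K + 1) * x" "2 * K + 1"])
    fix x y :: real assume "x \<le> y"
    then have "\<bar>h y - h x\<bar> \<le> K * (y - x)" using lip[of x y] by simp
    then show "y - x \<le> h y + (K + 1) * y - (h x + (K + 1) * x)"
      "h y + (K + 1) * y - (h x + (K + 1) * x) \<le> (2 * K + 1) * (y - x)"
      by (auto simp: algebra_simps abs_le_iff)
  qed blast
  define k1 where "k1 x = k0 x - (K + 1)" for x
  have i1: "(k1 has_integral (h b - h a)) {a..b}" if ab: "a \<le> b" for a b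
    using has_integral_diff[OF i0[OF ab] has_integral_const_real[of "K + 1" a b]] ab
    by (simp add: k1_def[abs_def] algebra_simps)
  obtain N where N: "negligible N" and d: "\<And>x. x \<notin> N \<Longrightarrow> (h has_real_derivative k1 x) (at x)"
    using AE_derivative_if_indefinite_integral[OF i1] by metis
  \<comment> \<open>Off a null set the density is a derivative and hence at most \<open>K\<close> in size; truncation makes the bound hold everywhere.\<close>
  define k where "k x = max (- K) (min K (k1 x))" for x
  have "k x = k1 x" if "x \<notin> N" for x
  proof -
    have "((\<lambda>t. \<bar>(h (x + t) - h x) / t\<bar>) \<longlongrightarrow> \<bar>k1 x\<bar>) (at 0)"
      using d[OF that] unfolding DERIV_def by (rule tendsto_rabs)
    moreover have "eventually (\<lambda>t. \<bar>(h (x + t) - h x) / t\<bar> \<le> K) (at 0)"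
      using lip[of "x + t" x for t] by (auto simp: eventually_at_filter divide_simps)
    ultimately have "\<bar>k1 x\<bar> \<le> K" by (rule tendsto_upperbound) simp
    then show ?thesis by (auto simp: k_def)
  qed
  note kk = this
  show ?thesis
  proof (rule that[of k N])
    show "k \<in> borel_measurable borel" using k0 unfolding k_def k1_def by simp
    show "\<bar>k x\<bar> \<le> K" for x using K by (auto simp: k_def)
    show "(k has_integral (h b - h a)) {a..b}" if "a \<le> b" for a b
      by (rule has_integral_spike[OF N _ i1[OF that]]) (use kk in auto)
  qed (use N d kk in auto)
qed

section \<open>The \<open>W\<^sup>1\<^sup>,\<^sup>\<infinity>\<close> norm and Lipschitz constants\<close>

lemma W1infI:
  assumes "u \<in> Linf \<Omega>" "\<And>b. b \<in> Basis \<Longrightarrow> g b \<in> Linf \<Omega>"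
    "\<And>b. b \<in> Basis \<Longrightarrow> has_weak_partial \<Omega> b u (g b)"
  shows "u \<in> W1inf \<Omega>"
  using assms unfolding W1inf_def by blast

lemma W1inf_weak_partial:
  assumes "u \<in> W1inf \<Omega>" "b \<in> Basis"
  shows "weak_partial \<Omega> b u \<in> Linf \<Omega>" "has_weak_partial \<Omega> b u (weak_partial \<Omega> b u)"
  using assms weak_partial_props unfolding W1inf_def by blast+

lemma W1inf_norm_le:
  fixes \<Omega> :: "'a::euclidean_space set"
  assumes \<Omega>: "open \<Omega>" "bounded \<Omega>"
    and u: "u \<in> borel_measurable (lebesgue_on \<Omega>)" "AE x in lebesgue_on \<Omega>. \<bar>u x\<bar> \<le> c"
    and g: "\<And>b. b \<in> Basis \<Longrightarrow> g b \<in> borel_measurable (lebesgue_on \<Omega>)"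
      "\<And>b. b \<in> Basis \<Longrightarrow> AE x in lebesgue_on \<Omega>. \<bar>g b x\<bar> \<le> d b"
      "\<And>b. b \<in> Basis \<Longrightarrow> has_weak_partial \<Omega> b u (g b)"
  shows "u \<in> W1inf \<Omega>" "W1inf_norm \<Omega> u \<le> ereal (c + (\<Sum>b\<in>Basis. d b))"
proof -
  have gL: "g b \<in> Linf \<Omega>" if "b \<in> Basis" for b
    using g(1,2)[OF that] by (rule LinfI)
  show uW: "u \<in> W1inf \<Omega>"
    using LinfI[OF u] gL g(3) by (rule W1infI)
  have "Linf_norm \<Omega> (weak_partial \<Omega> b u) \<le> ereal (d b)" if b: "b \<in> Basis" for b
  proof (rule Linf_norm_le)
    show "weak_partial \<Omega> b u \<in> borel_measurable (lebesgue_on \<Omega>)"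
      using W1inf_weak_partial(1)[OF uW b] by (simp add: Linf_def)
    show "AE x in lebesgue_on \<Omega>. \<bar>weak_partial \<Omega> b u x\<bar> \<le> d b"
      using weak_partial_eq_AE[OF \<Omega> gL[OF b] g(3)[OF b]] g(2)[OF b] by eventually_elim simp
  qed
  then have "(\<Sum>b\<in>Basis. Linf_norm \<Omega> (weak_partial \<Omega> b u)) \<le> (\<Sum>b\<in>Basis. ereal (d b))"
    by (rule sum_mono)
  then have "W1inf_norm \<Omega> u \<le> ereal c + (\<Sum>b\<in>Basis. ereal (d b))"
    unfolding W1inf_norm_def if_P[OF uW] by (intro add_mono Linf_norm_le u)
  then show "W1inf_norm \<Omega> u \<le> ereal (c + (\<Sum>b\<in>Basis. d b))" by simp
qed

lemma AE_lebesgue_on_open_nonempty: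
  fixes \<Omega> :: "'a::euclidean_space set"
  assumes "open \<Omega>" "\<Omega> \<noteq> {}" "AE x in lebesgue_on \<Omega>. P x"
  obtains x where "x \<in> \<Omega>" "P x"
proof -
  have "AE x in lebesgue. x \<in> \<Omega> \<longrightarrow> P x"
    using assms by (simp add: AE_restrict_space_iff)
  then obtain N where N: "{x. \<not> (x \<in> \<Omega> \<longrightarrow> P x)} \<subseteq> N" "N \<in> null_sets lebesgue"
    by (auto elim!: AE_E simp: null_sets_def)
  have "\<not> \<Omega> \<subseteq> N"
    using open_not_negligible[OF assms(1,2)] N(2) negligible_subset
    by (auto simp: negligible_iff_null_sets[symmetric])
  then show ?thesis using N(1) that by blast
qed

text \<open>A continuous function that exceeds the bound at one point of \<open>\<Omega>\<close> does so on a nonempty open set, which is not null.\<close>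
lemma AE_le_imp_le_on_closure:
  fixes u :: "'a::euclidean_space \<Rightarrow> real"
  assumes \<Omega>: "open \<Omega>" and cont: "continuous_on (closure \<Omega>) u"
    and ae: "AE x in lebesgue_on \<Omega>. u x \<le> c" and x: "x \<in> closure \<Omega>"
  shows "u x \<le> c"
proof -
  have "u y \<le> c" if y: "y \<in> \<Omega>" for y
  proof (rule ccontr)
    assume "\<not> u y \<le> c"
    define V where "V = \<Omega> \<inter> u -` {c<..}"
    have cu: "continuous_on \<Omega> u" using cont closure_subset continuous_on_subset by blast
    have V: "open V" unfolding V_def by (rule continuous_open_preimage[OF cu \<Omega>]) simp
    have "y \<in> V" using y \<open>\<not> u y \<le> c\<close> by (simp add: V_def)
    then have "V \<noteq> {}" by blast
    have "AE x in lebesgue. x \<in> \<Omega> \<longrightarrow> u x \<le> c" using ae \<Omega> by (simp add: AE_restrict_space_iff)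
    then have "AE x in lebesgue. x \<in> V \<longrightarrow> u x \<le> c" by eventually_elim (auto simp: V_def)
    then have "AE x in lebesgue_on V. u x \<le> c" using V by (simp add: AE_restrict_space_iff)
    then obtain z where "z \<in> V" "u z \<le> c"
      using AE_lebesgue_on_open_nonempty[OF V \<open>V \<noteq> {}\<close>] by blast
    then show False by (simp add: V_def)
  qed
  then show ?thesis using continuous_le_on_closure[OF cont x] by blast
qed

lemma Linf_norm_nonneg:
  fixes \<Omega> :: "'a::euclidean_space set"
  assumes "open \<Omega>" "\<Omega> \<noteq> {}"
  shows "0 \<le> Linf_norm \<Omega> u"
proof -
  have "AE x in lebesgue_on \<Omega>. ereal \<bar>u x\<bar> \<le> Linf_norm \<Omega> u"
    unfolding Linf_norm_def by (rule esssup_AE)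
  then obtain x where "ereal \<bar>u x\<bar> \<le> Linf_norm \<Omega> u"
    using AE_lebesgue_on_open_nonempty[OF assms] by blast
  then show ?thesis by (metis abs_ge_zero ereal_less_eq(5) order_trans)
qed

lemma W1inf_norm_nonneg:
  fixes \<Omega> :: "'a::euclidean_space set"
  assumes "open \<Omega>" "\<Omega> \<noteq> {}"
  shows "0 \<le> W1inf_norm \<Omega> u"
  using Linf_norm_nonneg[OF assms] unfolding W1inf_norm_def by (auto intro!: add_nonneg_nonneg sum_nonneg)

text \<open>Extending \<open>u\<close> constantly beyond the interval makes the results for Lipschitz functions on the line applicable.\<close>
lemma lipschitz_interval_weak_derivative:
  fixes u :: "real \<Rightarrow> real"
  assumes ab: "a < b" and u: "K-lipschitz_on {a..b} u"
  obtains k where "k \<in> borel_measurable borel" "\<And>x. \<bar>k x\<bar> \<le> K"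
    "has_weak_partial {a<..<b} 1 u k"
    "\<And>x y. a \<le> x \<Longrightarrow> x \<le> y \<Longrightarrow> y \<le> b \<Longrightarrow> (k has_integral (u y - u x)) {x..y}"
proof -
  define c where "c x = max a (min b x)" for x
  have c: "c x \<in> {a..b}" "\<bar>c x - c y\<bar> \<le> \<bar>x - y\<bar>" for x y using ab by (auto simp: c_def)
  have K: "K \<ge> 0" using u by (rule lipschitz_on_nonneg)
  have clip: "K-lipschitz_on UNIV (\<lambda>x. u (c x))"
  proof (rule lipschitz_onI)
    fix x y
    have "dist (u (c x)) (u (c y)) \<le> K * dist (c x) (c y)" using c by (intro lipschitz_onD[OF u])
    also have "\<dots> \<le> K * dist x y" using c K by (intro mult_left_mono) (auto simp: dist_real_def)
    finally show "dist (u (c x)) (u (c y)) \<le> K * dist x y" .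
  qed (rule K)
  from lipschitz_real_density[OF clip] obtain k N where k: "k \<in> borel_measurable borel" "\<And>x. \<bar>k x\<bar> \<le> K"
    and I: "\<And>x y. x \<le> y \<Longrightarrow> (k has_integral (u (c y) - u (c x))) {x..y}"
    and N: "negligible N" and D: "\<And>x. x \<notin> N \<Longrightarrow> ((\<lambda>x. u (c x)) has_real_derivative k x) (at x)"
    by metis
  have ceq: "c x = x" if "a \<le> x" "x \<le> b" for x using that by (simp add: c_def)
  have km: "k \<in> borel_measurable (lebesgue_on {a<..<b})"
    using k(1) by (intro measurable_restrict_space1 measurable_completion) simp
  have "has_weak_partial {a<..<b} 1 (\<lambda>x. u (c x)) k"
  proof (rule has_weak_partial_if_difference_quotients_converge(1)[OF _ clip km])
    have "AE x in lebesgue. x \<notin> N" using N by (simp add: negligible_iff_null_sets AE_not_in)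
    then have "AE x in lebesgue. x \<in> {a<..<b} \<longrightarrow>
        (\<lambda>n. real n * (u (c (x + 1 /\<^sub>R real n)) - u (c x))) \<longlonglongrightarrow> k x"
    proof eventually_elim
      case (elim x)
      have "((\<lambda>h. u (c (x + h *\<^sub>R 1))) has_real_derivative k x) (at 0)"
        using D[OF elim] DERIV_shift[of "\<lambda>x. u (c x)" "k x" 0 x] by (simp add: add.commute)
      from sequential_difference_quotient[of "\<lambda>x. u (c x)", OF this] show ?case by simp
    qed
    then show "AE x in lebesgue_on {a<..<b}. (\<lambda>n. real n * (u (c (x + 1 /\<^sub>R real n)) - u (c x))) \<longlonglongrightarrow> k x"
      by (simp add: AE_restrict_space_iff)
  qed simp
  then have "has_weak_partial {a<..<b} 1 u k"
    by (rule has_weak_partial_cong[rotated]) (auto simp: ceq)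
  moreover have "(k has_integral (u y - u x)) {x..y}" if "a \<le> x" "x \<le> y" "y \<le> b" for x y
    using I[OF that(2)] that by (simp add: ceq)
  ultimately show ?thesis using k that by blast
qed

text \<open>The fundamental theorem of calculus for weak derivatives. It turns equations that hold almost everywhere into
statements about increments.\<close>
lemma weak_partial_interval_has_integral:
  fixes u :: "real \<Rightarrow> real"
  assumes ab: "a < b" and u: "K-lipschitz_on {a..b} u"
    and g: "AE x in lebesgue_on {a<..<b}. weak_partial {a<..<b} 1 u x = g x"
    and xy: "a \<le> x" "x \<le> y" "y \<le> b"
  shows "(g has_integral (u y - u x)) {x..y}"
proof -
  obtain k where k: "k \<in> borel_measurable borel" "\<And>x. \<bar>k x\<bar> \<le> K" "has_weak_partial {a<..<b} 1 u k"
    "(k has_integral (u y - u x)) {x..y}"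
    using lipschitz_interval_weak_derivative[OF ab u] xy by metis
  have km: "k \<in> borel_measurable (lebesgue_on {a<..<b})"
    using k(1) by (intro measurable_restrict_space1 measurable_completion) simp
  have "k \<in> Linf {a<..<b}" using km k(2) by (intro LinfI[where C = K]) auto
  then have "AE x in lebesgue_on {a<..<b}. weak_partial {a<..<b} 1 u x = k x"
    using k(3) by (intro weak_partial_eq_AE) auto
  with g have "AE x in lebesgue_on {a<..<b}. g x = k x" by eventually_elim simp
  then have "AE x in lebesgue. x \<in> {a<..<b} \<longrightarrow> g x = k x" by (simp add: AE_restrict_space_iff)
  then obtain N where N: "{x. \<not> (x \<in> {a<..<b} \<longrightarrow> g x = k x)} \<subseteq> N" "N \<in> null_sets lebesgue"
    by (auto elim!: AE_E simp: null_sets_def)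
  have "negligible (insert a (insert b N))" using N(2) by (simp add: negligible_iff_null_sets[symmetric])
  then show ?thesis
  proof (rule has_integral_spike[OF _ _ k(4)])
    fix z assume "z \<in> {x..y} - insert a (insert b N)"
    then have "z \<in> {a<..<b}" "z \<notin> N" using xy by auto
    then show "g z = k z" using N(1) by blast
  qed
qed

text \<open>The sup norm of the weak derivative is a Lipschitz constant, because increments are integrals of the weak derivative.\<close>
lemma W1inf_norm_interval_bounds:
  fixes u :: "real \<Rightarrow> real"
  assumes ab: "a < b" and u: "K-lipschitz_on {a..b} u" and e: "W1inf_norm {a<..<b} u \<le> ereal e"
  shows "e-lipschitz_on {a..b} u" "\<And>x. x \<in> {a..b} \<Longrightarrow> \<bar>u x\<bar> \<le> e"
proof -
  let ?\<Omega> = "{a<..<b}" let ?w = "weak_partial {a<..<b} 1 u"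
  have ne: "open ?\<Omega>" "?\<Omega> \<noteq> {}" using ab by auto
  have W: "u \<in> W1inf ?\<Omega>" and sum: "Linf_norm ?\<Omega> u + Linf_norm ?\<Omega> ?w \<le> ereal e"
    using e unfolding W1inf_norm_def by (auto split: if_splits)
  have nn: "0 \<le> Linf_norm ?\<Omega> u" "0 \<le> Linf_norm ?\<Omega> ?w" by (intro Linf_norm_nonneg ne)+
  have le: "Linf_norm ?\<Omega> u \<le> ereal e" "Linf_norm ?\<Omega> ?w \<le> ereal e"
    using sum nn by (meson add_increasing add_increasing2 order_refl order_trans)+
  have "AE x in lebesgue_on ?\<Omega>. ereal \<bar>u x\<bar> \<le> Linf_norm ?\<Omega> u"
    unfolding Linf_norm_def by (rule esssup_AE)
  then have aeu: "AE x in lebesgue_on ?\<Omega>. \<bar>u x\<bar> \<le> e"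
    by eventually_elim (metis le(1) ereal_less_eq(3) order_trans)
  have "AE x in lebesgue_on ?\<Omega>. ereal \<bar>?w x\<bar> \<le> Linf_norm ?\<Omega> ?w"
    unfolding Linf_norm_def by (rule esssup_AE)
  then have aew: "AE x in lebesgue_on ?\<Omega>. \<bar>?w x\<bar> \<le> e"
    by eventually_elim (metis le(2) ereal_less_eq(3) order_trans)
  have cu: "continuous_on {a..b} u" using u by (rule lipschitz_on_continuous_on)
  show "\<bar>u x\<bar> \<le> e" if "x \<in> {a..b}" for x
    using AE_le_imp_le_on_closure[OF ne(1) _ aeu, of x] ab that cu by (auto intro!: continuous_intros)
  have e0: "e \<ge> 0" using nn(1) le(1) by (metis ereal_less_eq(5) order_trans)
  define g where "g x = max (- e) (min e (?w x))" for x
  have "AE x in lebesgue_on ?\<Omega>. ?w x = g x"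
    using aew by eventually_elim (auto simp: g_def)
  note I = weak_partial_interval_has_integral[OF ab u this]
  have le: "\<bar>u y - u x\<bar> \<le> e * (y - x)" if "a \<le> x" "x \<le> y" "y \<le> b" for x y
  proof -
    have "norm (u y - u x) \<le> e * measure lborel {x..y}"
      by (rule has_integral_bound_real[OF e0 finite.emptyI I[OF that]]) (use e0 in \<open>auto simp: g_def\<close>)
    then show ?thesis using that by simp
  qed
  show "e-lipschitz_on {a..b} u"
  proof (rule lipschitz_onI)
    fix x y assume "x \<in> {a..b}" "y \<in> {a..b}"
    then show "dist (u x) (u y) \<le> e * dist x y"
      using le[of x y] le[of y x] by (cases x y rule: linorder_le_cases) (auto simp: dist_real_def abs_minus_commute)
  qed (rule e0)
qed

text \<open>If the weak derivative has a continuous representative, the function is an integral of it and hence classically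
differentiable.\<close>
lemma weak_partial_continuous_imp_derivative:
  fixes u :: "real \<Rightarrow> real"
  assumes ab: "a < b" and u: "K-lipschitz_on {a..b} u"
    and g: "AE x in lebesgue_on {a<..<b}. weak_partial {a<..<b} 1 u x = g x"
    and cg: "continuous_on {a<..<b} g" and x: "x \<in> {a<..<b}"
  shows "(u has_real_derivative g x) (at x)"
proof -
  obtain p q where pq: "a < p" "p < x" "x < q" "q < b"
    using x dense[of a x] dense[of x b] by auto
  have "((\<lambda>y. integral {p..y} g) has_real_derivative g x) (at x within {p..q})"
    by (rule integral_has_real_derivative) (use cg pq in \<open>auto intro: continuous_on_subset\<close>)
  then have "((\<lambda>y. integral {p..y} g) has_real_derivative g x) (at x)"
    using pq by (simp add: at_within_Icc_at)
  then have "((\<lambda>y. u p + integral {p..y} g) has_real_derivative g x) (at x)"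
    by (auto intro!: derivative_eq_intros)
  then show ?thesis
  proof (rule has_field_derivative_transform_within_open[of _ _ _ "{p<..<q}"])
    fix y assume "y \<in> {p<..<q}"
    then have "integral {p..y} g = u y - u p"
      using weak_partial_interval_has_integral[OF ab u g, of p y] pq by (intro integral_unique) auto
    then show "u p + integral {p..y} g = u y" by simp
  qed (use pq in auto)
qed

lemma W1inf_norm_offset_bounds:
  fixes u :: "real \<Rightarrow> real"
  assumes ab: "a < b" and u: "K-lipschitz_on {a..b} u" and e: "W1inf_norm {a<..<b} (\<lambda>x. u x - c) \<le> ereal e"
  shows "e-lipschitz_on {a..b} u" "\<And>x. x \<in> {a..b} \<Longrightarrow> \<bar>u x - c\<bar> \<le> e"
proof -
  have shift: "k-lipschitz_on {a..b} (\<lambda>x. u x - c) \<longleftrightarrow> k-lipschitz_on {a..b} u" for k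
    by (simp add: lipschitz_on_def dist_real_def)
  have "K-lipschitz_on {a..b} (\<lambda>x. u x - c)" using u shift by simp
  note bounds = W1inf_norm_interval_bounds[OF ab this e]
  show "e-lipschitz_on {a..b} u" using bounds(1) shift by simp
  show "\<And>x. x \<in> {a..b} \<Longrightarrow> \<bar>u x - c\<bar> \<le> e" by (rule bounds(2))
qed

section \<open>Scalar ordinary differential equations\<close>

text \<open>The derivative of \<open>exp (- c t) w(t)\<close> is nonpositive.\<close>
lemma gronwall_derivative:
  fixes w w' :: "real \<Rightarrow> real"
  assumes ab: "a \<le> b" and cont: "continuous_on {a..b} w"
    and der: "\<And>t. a < t \<Longrightarrow> t < b \<Longrightarrow> (w has_real_derivative w' t) (at t)"
    and le: "\<And>t. a < t \<Longrightarrow> t < b \<Longrightarrow> w' t \<le> c * w t"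
  shows "w b \<le> exp (c * (b - a)) * w a"
proof -
  define v where "v t = exp (- c * t) * w t" for t
  have cv: "continuous_on {a..b} v" unfolding v_def by (intro continuous_intros cont)
  have "v b \<le> v a"
  proof (cases "a = b")
    case False
    have "\<exists>l z. a < z \<and> z < b \<and> DERIV v z :> l \<and> v b - v a = (b - a) * l"
    proof (rule MVT)
      show "v differentiable (at x)" if "a < x" "x < b" for x
      proof -
        have "(v has_real_derivative exp (- c * x) * (w' x - c * w x)) (at x)"
          unfolding v_def using der[OF that] by (auto intro!: derivative_eq_intros simp: algebra_simps)
        then show ?thesis by (auto simp: real_differentiable_def)
      qed
    qed (use ab False cv in auto)
    then obtain l z where z: "a < z" "z < b" "DERIV v z :> l" "v b - v a = (b - a) * l" by blast
    have "DERIV v z :> exp (- c * z) * (w' z - c * w z)"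
      unfolding v_def using der[OF z(1,2)] by (auto intro!: derivative_eq_intros simp: algebra_simps)
    then have "l = exp (- c * z) * (w' z - c * w z)" using z(3) DERIV_unique by blast
    also have "\<dots> \<le> 0" using le[OF z(1,2)] by (simp add: mult_nonneg_nonpos)
    finally show ?thesis using z(4) ab by (smt (verit) mult_nonneg_nonpos)
  qed simp
  then have "exp (c * b) * v b \<le> exp (c * b) * v a" by simp
  moreover have "exp (c * b) * v b = w b" by (simp add: v_def exp_minus)
  moreover have "exp (c * b) * v a = exp (c * (b - a)) * w a"
    by (simp add: v_def exp_minus right_diff_distrib exp_diff divide_inverse)
  ultimately show ?thesis by simp
qed

text \<open>Picard's theorem on the whole interval. For the unknown \<open>v(t) = exp (- m t) l(t)\<close> the integral operator contracts the
sup norm by the factor \<open>K / m\<close>, so the choice \<open>m = 2 K + 1\<close> gives a fixed point without any restriction on the length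
of the interval.\<close>
lemma global_ode_solution:
  fixes G :: "real \<Rightarrow> real \<Rightarrow> real"
  assumes T: "T \<ge> 0" and K: "K \<ge> 0" and lip: "\<And>t x y. t \<in> {0..T} \<Longrightarrow> \<bar>G t x - G t y\<bar> \<le> K * \<bar>x - y\<bar>"
    and cont: "continuous_on ({0..T} \<times> UNIV) (\<lambda>(t, x). G t x)"
  obtains l where "l 0 = l0" "continuous_on {0..T} l"
    "\<And>t. t \<in> {0..T} \<Longrightarrow> (l has_real_derivative G t (l t)) (at t within {0..T})"
proof -
  define m where "m = 2 * K + 1"
  have m: "m > 0" "2 * K \<le> m" using K by (auto simp: m_def)
  define g where "g v s = G s (exp (m * s) * v s)" for v s
  define P where "P v t = exp (- m * t) * (l0 + integral {0..t} (g v))" for v t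
  have cg: "continuous_on {0..T} (g v)" if "continuous_on {0..T} v" for v
  proof -
    have "continuous_on {0..T} (\<lambda>s. (s, exp (m * s) * v s))" by (intro continuous_intros that)
    from continuous_on_compose2[OF cont this] show ?thesis unfolding g_def by (simp add: image_subset_iff)
  qed
  have ci: "continuous_on {0..T} (\<lambda>t. integral {0..t} (g v))" if "continuous_on {0..T} v" for v
    by (rule indefinite_integral_continuous_1) (use cg[OF that] in \<open>auto intro: integrable_continuous_interval\<close>)
  have cP: "continuous_on {0..T} (P v)" if "continuous_on {0..T} v" for v
    unfolding P_def by (intro continuous_intros ci that)
  \<comment> \<open>The fixed point theorem needs a complete space: functions on \<open>[0, T]\<close> are extended constantly to bounded continuous functions.\<close>
  have "\<exists>w :: real \<Rightarrow>\<^sub>C real. \<forall>x. apply_bcontfun w x = P v (clamp 0 T x)" for v :: "real \<Rightarrow>\<^sub>C real"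
  proof -
    have "continuous_on (cbox 0 T) (P v)" using cP[of v] by simp
    from continuous_on_cbox_bcontfunE[OF this] show ?thesis by metis
  qed
  then obtain \<Phi> :: "(real \<Rightarrow>\<^sub>C real) \<Rightarrow> (real \<Rightarrow>\<^sub>C real)"
    where \<Phi>: "\<And>v x. apply_bcontfun (\<Phi> v) x = P v (clamp 0 T x)" by metis
  have contr: "dist (\<Phi> v) (\<Phi> w) \<le> 1 / 2 * dist v w" for v w
  proof (rule dist_bound)
    fix x
    define t where "t = clamp 0 T x"
    have t: "0 \<le> t" "t \<le> T" using clamp_in_interval[of 0 T x] T by (auto simp: t_def)
    let ?d = "dist v w"
    have I: "g v integrable_on {0..t}" "g w integrable_on {0..t}"
      using cg[of v] cg[of w] t by (auto intro!: integrable_continuous_interval intro: continuous_on_subset)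
    have E: "((\<lambda>s. K * ?d * exp (m * s)) has_integral (K * ?d * exp (m * t) / m - K * ?d * exp (m * 0) / m)) {0..t}"
      by (rule fundamental_theorem_of_calculus)
         (use t m in \<open>auto simp: has_real_derivative_iff_has_vector_derivative[symmetric] intro!: derivative_eq_intros\<close>)
    have "\<bar>integral {0..t} (g v) - integral {0..t} (g w)\<bar> = norm (integral {0..t} (\<lambda>s. g v s - g w s))"
      using I by (simp add: integral_diff)
    also have "\<dots> \<le> integral {0..t} (\<lambda>s. K * ?d * exp (m * s))"
    proof (rule integral_norm_bound_integral)
      fix s assume s: "s \<in> {0..t}"
      have "\<bar>g v s - g w s\<bar> \<le> K * \<bar>exp (m * s) * v s - exp (m * s) * w s\<bar>"
        unfolding g_def using s t by (intro lip) auto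
      also have "\<dots> = K * (exp (m * s) * \<bar>v s - w s\<bar>)"
        by (simp add: right_diff_distrib[symmetric] abs_mult)
      also have "\<dots> \<le> K * (exp (m * s) * ?d)"
        using dist_bounded[of v s w] K by (intro mult_left_mono) (auto simp: dist_real_def)
      finally show "norm (g v s - g w s) \<le> K * ?d * exp (m * s)" by (simp add: algebra_simps)
    qed (use I E in \<open>auto intro: integrable_diff has_integral_integrable\<close>)
    also have "\<dots> \<le> K * ?d * exp (m * t) / m"
      using integral_unique[OF E] K m by simp
    finally have "\<bar>integral {0..t} (g v) - integral {0..t} (g w)\<bar> \<le> K * ?d * exp (m * t) / m" .
    then have "exp (- m * t) * \<bar>integral {0..t} (g v) - integral {0..t} (g w)\<bar> \<le> exp (- m * t) * (K * ?d * exp (m * t) / m)"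
      by (rule mult_left_mono) simp
    also have "\<dots> = K * ?d / m" by (simp add: exp_minus)
    also have "\<dots> \<le> 1 / 2 * ?d"
      using mult_right_mono[OF m(2), of ?d] m(1) by (simp add: field_simps)
    finally have "\<bar>P v t - P w t\<bar> \<le> 1 / 2 * ?d"
      by (simp add: P_def right_diff_distrib[symmetric] abs_mult)
    then show "dist (\<Phi> v x) (\<Phi> w x) \<le> 1 / 2 * ?d"
      by (simp add: \<Phi> t_def dist_real_def)
  qed
  then obtain v where v: "\<Phi> v = v"
    using banach_fix_type[of "1 / 2" \<Phi>] by auto
  define l where "l t = l0 + integral {0..t} (g v)" for t
  have vt: "exp (m * t) * v t = l t" if "t \<in> {0..T}" for t
  proof -
    have "clamp 0 T t = t" using that by simp
    then have "v t = exp (- m * t) * l t" using \<Phi>[of v t] v by (simp add: P_def l_def)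
    then show ?thesis by (simp add: exp_minus)
  qed
  have cv: "continuous_on {0..T} v" by simp
  show ?thesis
  proof (rule that[of l])
    show "l 0 = l0" by (simp add: l_def)
    show "continuous_on {0..T} l" unfolding l_def by (intro continuous_intros ci cv)
    fix t assume t: "t \<in> {0..T}"
    have "((\<lambda>t. integral {0..t} (g v)) has_real_derivative g v t) (at t within {0..T})"
      by (rule integral_has_real_derivative[OF cg[OF cv] t])
    then have "(l has_real_derivative g v t) (at t within {0..T})"
      unfolding l_def by (auto intro!: derivative_eq_intros)
    then show "(l has_real_derivative G t (l t)) (at t within {0..T})"
      using vt[OF t] by (simp add: g_def)
  qed
qed

section \<open>Lipschitz solutions of transport equations\<close>

lemma continuous_on_cbox_integral_box:
  fixes h :: "'a::euclidean_space \<Rightarrow> real"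
  assumes "continuous_on (cbox a b) h"
  shows "h \<in> Linf (box a b)" "integrable (lebesgue_on (box a b)) h"
    "(LINT z|lebesgue_on (box a b). h z) = integral (cbox a b) h"
proof -
  have "bounded (h ` cbox a b)" using assms by (intro compact_imp_bounded compact_continuous_image) auto
  then obtain C where C: "\<And>z. z \<in> cbox a b \<Longrightarrow> \<bar>h z\<bar> \<le> C"
    unfolding bounded_iff by (metis image_eqI real_norm_def)
  have "h \<in> borel_measurable (lebesgue_on (box a b))"
    using assms box_subset_cbox
    by (intro continuous_imp_measurable_on_sets_lebesgue) (auto intro: continuous_on_subset)
  then show L: "h \<in> Linf (box a b)"
  proof (rule LinfI[where C = C])
    have "\<bar>h z\<bar> \<le> C" if "z \<in> box a b" for z using C that box_subset_cbox[of a b] by blast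
    then show "AE z in lebesgue_on (box a b). \<bar>h z\<bar> \<le> C" by (intro AE_I2) auto
  qed
  show I: "integrable (lebesgue_on (box a b)) h" by (rule Linf_integrable[OF _ _ L]) auto
  show "(LINT z|lebesgue_on (box a b). h z) = integral (cbox a b) h"
    using lebesgue_integral_eq_integral[OF I] by (simp add: integral_open_interval)
qed

lemma kernel_integral_translate:
  fixes \<Omega> :: "'a::euclidean_space set" and \<phi> :: "'a \<Rightarrow> real"
  assumes \<Omega>: "open \<Omega>" and \<phi>: "continuous_on UNIV \<phi>" "integrable lborel \<phi>"
    and supp: "\<And>z. \<phi> (z - p) \<noteq> 0 \<Longrightarrow> z \<in> \<Omega>"
  shows "integrable (lebesgue_on \<Omega>) (\<lambda>z. \<phi> (z - p))"
    "(LINT z|lebesgue_on \<Omega>. \<phi> (z - p)) = (LINT z|lborel. \<phi> z)"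
proof -
  have \<Omega>s: "\<Omega> \<in> sets lebesgue" using \<Omega> by simp
  have \<phi>p: "continuous_on UNIV (\<lambda>z. \<phi> (z - p))"
    by (rule continuous_on_compose2[OF \<phi>(1)]) (auto intro!: continuous_intros)
  have b\<phi>: "\<phi> \<in> borel_measurable borel" "(\<lambda>z. \<phi> (z - p)) \<in> borel_measurable borel"
    using \<phi>(1) \<phi>p by (auto intro: borel_measurable_continuous_onI)
  have "integrable lborel (\<lambda>z. \<phi> (z - p))"
  proof -
    have "integrable (distr lborel borel ((+) (- p))) \<phi>" using \<phi>(2) by (simp add: lborel_distr_plus)
    then have "integrable lborel (\<lambda>z. \<phi> (- p + z))"
      by (intro integrable_distr[of "(+) (- p)" lborel borel \<phi>]) auto
    then show ?thesis by simp
  qed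
  then have i: "integrable lebesgue (\<lambda>z. \<phi> (z - p))" using b\<phi> by (simp add: integrable_completion)
  have ind: "indicator \<Omega> z *\<^sub>R \<phi> (z - p) = \<phi> (z - p)" for z
    using supp[of z] by (auto simp: indicator_def)
  show "integrable (lebesgue_on \<Omega>) (\<lambda>z. \<phi> (z - p))"
    using i \<Omega>s by (subst integrable_restrict_space) (auto simp only: ind sets.Int_space_eq2)
  have "(LINT z|lebesgue_on \<Omega>. \<phi> (z - p)) = (LINT z|lebesgue. \<phi> (z - p))"
    using \<Omega>s by (subst integral_restrict_space) (auto simp only: ind sets.Int_space_eq2)
  also have "\<dots> = (LINT z|lborel. \<phi> (z - p))" using b\<phi> by (intro integral_completion) auto
  also have "\<dots> = (LINT z|lborel. \<phi> z)"
    using lborel_integral_translate[OF b\<phi>(1), of "- p"] by simp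
  finally show "(LINT z|lebesgue_on \<Omega>. \<phi> (z - p)) = (LINT z|lborel. \<phi> z)" .
qed

lemma kernel_integral_bound:
  fixes \<Omega> :: "'a::euclidean_space set" and \<phi> h :: "'a \<Rightarrow> real"
  assumes \<Omega>: "open \<Omega>" and \<phi>: "continuous_on UNIV \<phi>" "integrable lborel \<phi>" "\<And>z. 0 \<le> \<phi> z"
    and supp: "\<And>z. \<phi> (z - p) \<noteq> 0 \<Longrightarrow> z \<in> \<Omega>"
    and h: "h \<in> borel_measurable (lebesgue_on \<Omega>)"
    and B: "AE z in lebesgue_on \<Omega>. \<phi> (z - p) \<noteq> 0 \<longrightarrow> \<bar>h z\<bar> \<le> B"
  shows "integrable (lebesgue_on \<Omega>) (\<lambda>z. h z * \<phi> (z - p))"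
    "\<bar>LINT z|lebesgue_on \<Omega>. h z * \<phi> (z - p)\<bar> \<le> B * (LINT z|lborel. \<phi> z)"
proof -
  note kt = kernel_integral_translate[OF \<Omega> \<phi>(1,2) supp]
  have le: "AE z in lebesgue_on \<Omega>. \<bar>h z * \<phi> (z - p)\<bar> \<le> B * \<phi> (z - p)"
    using B
  proof eventually_elim
    case (elim z)
    then show ?case using \<phi>(3)[of "z - p"]
      by (cases "\<phi> (z - p) = 0") (auto simp: abs_mult intro!: mult_right_mono)
  qed
  have hm: "(\<lambda>z. h z * \<phi> (z - p)) \<in> borel_measurable (lebesgue_on \<Omega>)"
    using kt(1) by (intro borel_measurable_times h) auto
  show I: "integrable (lebesgue_on \<Omega>) (\<lambda>z. h z * \<phi> (z - p))"
  proof (rule Bochner_Integration.integrable_bound[of _ "\<lambda>z. B * \<phi> (z - p)"])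
    show "AE z in lebesgue_on \<Omega>. norm (h z * \<phi> (z - p)) \<le> norm (B * \<phi> (z - p))"
      using le by eventually_elim (metis abs_ge_self order_trans real_norm_def)
  qed (use kt(1) hm in auto)
  have "\<bar>LINT z|lebesgue_on \<Omega>. h z * \<phi> (z - p)\<bar> \<le> (LINT z|lebesgue_on \<Omega>. \<bar>h z * \<phi> (z - p)\<bar>)"
    by (rule integral_abs_bound)
  also have "\<dots> \<le> (LINT z|lebesgue_on \<Omega>. B * \<phi> (z - p))"
    using I kt(1) le by (intro integral_mono_AE) auto
  also have "\<dots> = B * (LINT z|lborel. \<phi> z)" by (simp add: kt(2))
  finally show "\<bar>LINT z|lebesgue_on \<Omega>. h z * \<phi> (z - p)\<bar> \<le> B * (LINT z|lborel. \<phi> z)" .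
qed

text \<open>The kernel is smooth, so the average of the merely continuous function \<open>f\<close> can be differentiated in the centre of the
kernel. As the kernels are test functions, the derivative falls onto the weak derivatives of \<open>f\<close>.\<close>
lemma mollified_transport_derivative:
  fixes f :: "'a::euclidean_space \<Rightarrow> real"
  assumes f: "continuous_on (cbox A B) f"
    and gv: "gv \<in> Linf (box A B)" "has_weak_partial (box A B) v f gv"
    and gw: "gw \<in> Linf (box A B)" "has_weak_partial (box A B) w f gw"
    and \<phi>: "c1_fun \<phi>" and \<phi>t: "\<And>t. t \<in> {t1..t2} \<Longrightarrow> (\<lambda>z. \<phi> (z - c t)) \<in> test_functions (box A B)"
    and c: "\<And>t. t \<in> {t1..t2} \<Longrightarrow> (c has_vector_derivative (v + s t *\<^sub>R w)) (at t within {t1..t2})"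
    and s: "continuous_on {t1..t2} s" and t: "t \<in> {t1..t2}"
  shows "((\<lambda>t. integral (cbox A B) (\<lambda>z. f z * \<phi> (z - c t))) has_real_derivative
           (LINT z|lebesgue_on (box A B). gv z * \<phi> (z - c t)) + s t * (LINT z|lebesgue_on (box A B). gw z * \<phi> (z - c t)))
         (at t within {t1..t2})"
proof -
  obtain D where D: "continuous_on UNIV D" "\<And>z. (\<phi> has_derivative blinfun_apply (D z)) (at z)"
    using \<phi> unfolding c1_fun_def by blast
  have c\<phi>: "continuous_on S \<phi>" for S using \<phi> by (rule c1_fun_continuous_on)
  have cc: "continuous_on {t1..t2} c"
    using c by (meson continuous_on_eq_continuous_within has_vector_derivative_continuous)
  have shift: "((\<lambda>z. \<phi> (z - p)) has_derivative blinfun_apply (D (z - p))) (at z)" for z p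
  proof -
    have "((\<lambda>z. z - p) has_derivative (\<lambda>h. h)) (at z)" by (auto intro!: derivative_eq_intros)
    from has_derivative_compose[OF this D(2)[of "z - p"]] show ?thesis .
  qed
  have fd: "frechet_derivative (\<lambda>z. \<phi> (z - p)) (at z) u = D (z - p) u" for z p u
    using frechet_derivative_at[OF shift[of p z]] by simp
  have "((\<lambda>t. integral (cbox A B) (\<lambda>z. f z * \<phi> (z - c t))) has_real_derivative
     integral (cbox A B) (\<lambda>z. - (f z * D (z - c t) (v + s t *\<^sub>R w)))) (at t within {t1..t2})"
  proof (rule leibniz_rule_field_derivative[where fx = "\<lambda>t z. - (f z * D (z - c t) (v + s t *\<^sub>R w))"])
    fix r z assume r: "r \<in> {t1..t2}" and z: "z \<in> cbox A B"
    have "((\<lambda>t. z - c t) has_derivative (\<lambda>h. - (h *\<^sub>R (v + s r *\<^sub>R w)))) (at r within {t1..t2})"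
      using c[OF r] unfolding has_vector_derivative_def by (auto intro!: derivative_eq_intros)
    from has_derivative_compose[OF this D(2)[of "z - c r"]]
    have "((\<lambda>t. \<phi> (z - c t)) has_derivative (\<lambda>h. - (D (z - c r) (v + s r *\<^sub>R w)) * h)) (at r within {t1..t2})"
      by (simp add: blinfun.minus_right blinfun.scaleR_right mult.commute)
    then have "((\<lambda>t. \<phi> (z - c t)) has_real_derivative - (D (z - c r) (v + s r *\<^sub>R w))) (at r within {t1..t2})"
      unfolding has_field_derivative_def by (rule has_derivative_eq_rhs) auto
    then show "((\<lambda>t. f z * \<phi> (z - c t)) has_real_derivative - (f z * D (z - c r) (v + s r *\<^sub>R w))) (at r within {t1..t2})"
      by (auto intro!: derivative_eq_intros)
  next
    fix r
    show "(\<lambda>z. f z * \<phi> (z - c r)) integrable_on cbox A B"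
      by (intro integrable_continuous continuous_intros f continuous_on_compose2[OF c\<phi>]) auto
  next
    have 1: "continuous_on ({t1..t2} \<times> cbox A B) (\<lambda>x. f (snd x))"
      by (rule continuous_on_compose2[OF f]) (auto intro!: continuous_intros)
    have 2: "continuous_on ({t1..t2} \<times> cbox A B) (\<lambda>x. c (fst x))"
      by (rule continuous_on_compose2[OF cc]) (auto intro!: continuous_intros)
    have 3: "continuous_on ({t1..t2} \<times> cbox A B) (\<lambda>x. s (fst x))"
      by (rule continuous_on_compose2[OF s]) (auto intro!: continuous_intros)
    have 4: "continuous_on ({t1..t2} \<times> cbox A B) (\<lambda>x. D (snd x - c (fst x)))"
      by (rule continuous_on_compose2[OF D(1)]) (auto intro!: continuous_intros 2)
    show "continuous_on ({t1..t2} \<times> cbox A B) (\<lambda>(t, z). - (f z * D (z - c t) (v + s t *\<^sub>R w)))"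
      unfolding case_prod_unfold
      by (intro continuous_intros 1 3 blinfun.continuous_on 4)
  qed (use t in auto)
  moreover have "integral (cbox A B) (\<lambda>z. - (f z * D (z - c t) (v + s t *\<^sub>R w)))
      = (LINT z|lebesgue_on (box A B). gv z * \<phi> (z - c t)) + s t * (LINT z|lebesgue_on (box A B). gw z * \<phi> (z - c t))"
  proof -
    have cD: "continuous_on (cbox A B) (\<lambda>z. f z * D (z - c t) u)" for u
      by (intro continuous_intros f blinfun.continuous_on continuous_on_compose2[OF D(1)]) auto
    note I = continuous_on_cbox_integral_box[OF cD]
    have "integral (cbox A B) (\<lambda>z. - (f z * D (z - c t) (v + s t *\<^sub>R w)))
        = - (LINT z|lebesgue_on (box A B). f z * D (z - c t) (v + s t *\<^sub>R w))"
      using I(3) by simp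
    also have "(LINT z|lebesgue_on (box A B). f z * D (z - c t) (v + s t *\<^sub>R w))
        = (LINT z|lebesgue_on (box A B). f z * D (z - c t) v + s t * (f z * D (z - c t) w))"
      by (simp add: blinfun.add_right blinfun.scaleR_right algebra_simps)
    also have "\<dots> = (LINT z|lebesgue_on (box A B). f z * D (z - c t) v) + s t * (LINT z|lebesgue_on (box A B). f z * D (z - c t) w)"
      using I(2) by (subst Bochner_Integration.integral_add) auto
    also have "(LINT z|lebesgue_on (box A B). f z * D (z - c t) v) = - (LINT z|lebesgue_on (box A B). gv z * \<phi> (z - c t))"
      using gv(2) \<phi>t[OF t] unfolding has_weak_partial_def by (fastforce simp: fd)
    also have "(LINT z|lebesgue_on (box A B). f z * D (z - c t) w) = - (LINT z|lebesgue_on (box A B). gw z * \<phi> (z - c t))"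
      using gw(2) \<phi>t[OF t] unfolding has_weak_partial_def by (fastforce simp: fd)
    finally show ?thesis by simp
  qed
  ultimately show ?thesis by simp
qed

lemma norm_le_box_cube:
  fixes z :: "'a::euclidean_space"
  assumes "z \<in> box (- d *\<^sub>R One) (d *\<^sub>R One)"
  shows "norm z \<le> real DIM('a) * d"
proof -
  have "\<bar>z \<bullet> i\<bar> \<le> d" if "i \<in> Basis" for i using assms that by (auto simp: mem_box abs_le_iff)
  then have "norm z \<le> (\<Sum>i\<in>(Basis::'a set). d)" by (intro order_trans[OF norm_le_l1] sum_mono)
  then show ?thesis by simp
qed

text \<open>Along a characteristic the average of \<open>f\<close> over a small cube has the derivative
\<open>\<integral> (a (c t) - a z) gw z \<phi> (z - c t) dz\<close>, since \<open>gv = - a gw\<close>. By uniform continuity of \<open>a\<close> near the curve this is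
small compared with \<open>\<integral> \<phi>\<close> when the cube is small, while the average itself differs little from \<open>f (c t) \<integral> \<phi>\<close>.\<close>
lemma transport_constant_along_characteristics:
  fixes f :: "'a::euclidean_space \<Rightarrow> real"
  assumes f: "K-lipschitz_on (cbox A B) f"
    and gv: "gv \<in> Linf (box A B)" "has_weak_partial (box A B) v f gv"
    and gw: "gw \<in> Linf (box A B)" "has_weak_partial (box A B) w f gw"
    and a: "continuous_on (box A B) a"
    and eq: "AE z in lebesgue_on (box A B). gv z + a z * gw z = 0"
    and t12: "t1 \<le> t2" and cin: "\<And>t. t \<in> {t1..t2} \<Longrightarrow> c t \<in> box A B"
    and c: "\<And>t. t \<in> {t1..t2} \<Longrightarrow> (c has_vector_derivative (v + a (c t) *\<^sub>R w)) (at t within {t1..t2})"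
  shows "f (c t2) = f (c t1)"
proof -
  let ?\<Omega> = "box A B"
  have cc: "continuous_on {t1..t2} c"
    using c by (meson continuous_on_eq_continuous_within has_vector_derivative_continuous)
  have cf: "continuous_on (cbox A B) f" using f by (rule lipschitz_on_continuous_on)
  have K: "K \<ge> 0" using f by (rule lipschitz_on_nonneg)
  define S where "S = c ` {t1..t2}"
  have S: "compact S" "S \<subseteq> ?\<Omega>" using cc cin by (auto simp: S_def intro!: compact_continuous_image)
  obtain r where r: "r > 0" "(\<Union>x\<in>S. cball x r) \<subseteq> ?\<Omega>"
    using compact_subset_open_imp_cball_epsilon_subset[OF S(1) open_box S(2)] by blast
  \<comment> \<open>A compact neighbourhood of the curve that contains the supports of all kernels below.\<close>
  define S' where "S' = {x + y |x y. x \<in> S \<and> y \<in> cball 0 r}"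
  have "compact S'" unfolding S'_def by (intro compact_sums S) auto
  have memS': "z \<in> S'" if "p \<in> S" "norm (z - p) \<le> r" for z p
  proof -
    have "z = p + (z - p)" "z - p \<in> cball 0 r" using that by auto
    then show ?thesis unfolding S'_def using that(1) by blast
  qed
  have S'sub: "S' \<subseteq> ?\<Omega>"
  proof
    fix z assume "z \<in> S'"
    then obtain x y where "z = x + y" "x \<in> S" "norm y \<le> r" unfolding S'_def by auto
    then have "z \<in> cball x r" by (simp add: dist_norm)
    then show "z \<in> ?\<Omega>" using r(2) \<open>x \<in> S\<close> by blast
  qed
  have ua: "uniformly_continuous_on S' a"
    using \<open>compact S'\<close> a S'sub by (intro compact_uniformly_continuous) (auto intro: continuous_on_subset)
  obtain C where C: "C \<ge> 0" "AE z in lebesgue_on ?\<Omega>. \<bar>gw z\<bar> \<le> C" using Linf_AE_bounded[OF gw(1)] by blast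
  have main: "\<bar>f (c t2) - f (c t1)\<bar> \<le> e * (C * (t2 - t1) + 2 * K)" if e: "e > 0" for e
  proof -
    obtain d where d: "d > 0" "\<And>x y. x \<in> S' \<Longrightarrow> y \<in> S' \<Longrightarrow> dist y x < d \<Longrightarrow> dist (a y) (a x) < e"
      using ua e unfolding uniformly_continuous_on_def by metis
    \<comment> \<open>Half the side of the cube; its points have distance at most \<open>DIM('a) * \<delta>\<close> from the centre.\<close>
    define \<delta> where "\<delta> = min (min e r) (d / 2) / DIM('a)"
    have \<delta>: "\<delta> > 0" "real DIM('a) * \<delta> = min (min e r) (d / 2)" using e r(1) d(1) by (simp_all add: \<delta>_def)
    define \<phi> where "\<phi> = box_bump (- \<delta> *\<^sub>R One) (\<delta> *\<^sub>R One :: 'a) 1"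
    have \<phi>c1: "c1_fun \<phi>" unfolding \<phi>_def by (rule c1_fun_box_bump)
    have \<phi>0: "\<phi> z \<ge> 0" for z unfolding \<phi>_def by (rule box_bump_range)
    have ord: "(- \<delta> *\<^sub>R One) \<bullet> i \<le> (\<delta> *\<^sub>R One) \<bullet> i" if "i \<in> Basis" for i :: 'a using that \<delta> by simp
    have \<phi>pos: "\<phi> z \<noteq> 0 \<longleftrightarrow> z \<in> box (- \<delta> *\<^sub>R One) (\<delta> *\<^sub>R One)" for z
      using box_weight_pos_iff[OF ord, of z] box_weight_nonneg[of "- \<delta> *\<^sub>R One" "\<delta> *\<^sub>R One" z]
      unfolding \<phi>_def box_bump_def by (auto simp: divide_simps)
    have supp: "norm z \<le> real DIM('a) * \<delta>" if "\<phi> z \<noteq> 0" for z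
      using norm_le_box_cube[of z \<delta>] \<phi>pos[of z] that by simp
    have \<phi>int: "integrable lborel \<phi>"
    proof (rule integrable_compact_support_bounded[OF _ supp])
      show "\<phi> \<in> borel_measurable borel"
        using \<phi>c1 by (intro borel_measurable_continuous_onI c1_fun_continuous_on)
      show "\<bar>\<phi> z\<bar> \<le> 1" for z
        using box_bump_range[of "- \<delta> *\<^sub>R One" "\<delta> *\<^sub>R One" 1 z] by (simp add: \<phi>_def)
    qed
    have c\<phi>: "continuous_on UNIV \<phi>" using \<phi>c1 by (rule c1_fun_continuous_on)
    define m where "m = (LINT z|lborel. \<phi> z)"
    have "m > 0"
    proof -
      have "m \<noteq> 0"
      proof
        assume "m = 0"
        then have "AE z in lborel. \<phi> z = 0"
          using integral_nonneg_eq_0_iff_AE[OF \<phi>int] \<phi>0 by (simp add: m_def)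
        then have "AE z in lebesgue. \<phi> z = 0" by (rule AE_completion)
        then have "AE z in lebesgue. z \<in> box (- \<delta> *\<^sub>R One) (\<delta> *\<^sub>R One) \<longrightarrow> \<phi> z = 0"
          by eventually_elim simp
        then have ae: "AE z in lebesgue_on (box (- \<delta> *\<^sub>R One) (\<delta> *\<^sub>R One)). \<phi> z = 0"
          by (simp add: AE_restrict_space_iff)
        have ne: "box (- \<delta> *\<^sub>R One) (\<delta> *\<^sub>R One :: 'a) \<noteq> {}" using \<delta>(1) by (simp add: box_ne_empty)
        obtain z where "z \<in> box (- \<delta> *\<^sub>R One) (\<delta> *\<^sub>R One)" "\<phi> z = 0"
          by (rule AE_lebesgue_on_open_nonempty[OF open_box ne ae])
        then show False using \<phi>pos by blast
      qed
      moreover have "m \<ge> 0" unfolding m_def using \<phi>0 by (intro Bochner_Integration.integral_nonneg) auto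
      ultimately show ?thesis by simp
    qed
    have near: "norm (z - c t) \<le> e" "norm (z - c t) < d" "z \<in> S'" "c t \<in> S'" "z \<in> ?\<Omega>"
      if "t \<in> {t1..t2}" "\<phi> (z - c t) \<noteq> 0" for z t
    proof -
      have n: "norm (z - c t) \<le> min (min e r) (d / 2)" using supp[OF that(2)] \<delta>(2) by simp
      then show "norm (z - c t) \<le> e" "norm (z - c t) < d" using d(1) by auto
      have "c t \<in> S" using that by (simp add: S_def)
      then show "z \<in> S'" "c t \<in> S'" using n r(1) by (auto intro!: memS'[of "c t"])
      then show "z \<in> ?\<Omega>" using S'sub by blast
    qed
    have \<phi>t: "(\<lambda>z. \<phi> (z - c t)) \<in> test_functions ?\<Omega>" if t: "t \<in> {t1..t2}" for t
    proof -
      have sub: "cbox (- \<delta> *\<^sub>R One + c t) (\<delta> *\<^sub>R One + c t) \<subseteq> ?\<Omega>"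
      proof
        fix z assume "z \<in> cbox (- \<delta> *\<^sub>R One + c t) (\<delta> *\<^sub>R One + c t)"
        then have "\<bar>(z - c t) \<bullet> i\<bar> \<le> \<delta>" if "i \<in> Basis" for i
          using that by (auto simp: mem_box inner_add_left inner_diff_left abs_le_iff algebra_simps)
        then have "norm (z - c t) \<le> (\<Sum>i\<in>(Basis::'a set). \<delta>)" by (intro order_trans[OF norm_le_l1] sum_mono)
        then have "norm (z - c t) \<le> r" using \<delta>(2) by simp
        then have "z \<in> S'" using t by (intro memS'[of "c t"]) (auto simp: S_def)
        then show "z \<in> ?\<Omega>" using S'sub by blast
      qed
      have eqw: "box_weight (- \<delta> *\<^sub>R One + c t) (\<delta> *\<^sub>R One + c t) z = box_weight (- \<delta> *\<^sub>R One) (\<delta> *\<^sub>R One) (z - c t)" for z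
        unfolding box_weight_def by (intro prod.cong) (auto simp: inner_add_left inner_diff_left algebra_simps)
      have "box_bump (- \<delta> *\<^sub>R One + c t) (\<delta> *\<^sub>R One + c t) 1 = (\<lambda>z. \<phi> (z - c t))"
        unfolding \<phi>_def box_bump_def eqw by simp
      moreover have "(- \<delta> *\<^sub>R One + c t) \<bullet> i \<le> (\<delta> *\<^sub>R One + c t) \<bullet> i" if "i \<in> Basis" for i
        using ord[OF that] by (simp only: inner_add_left)
      ultimately show ?thesis
        using box_bump_test_function[OF sub, of 1] by simp
    qed
    define J where "J t = integral (cbox A B) (\<lambda>z. f z * \<phi> (z - c t))" for t
    define J' where "J' t = (LINT z|lebesgue_on ?\<Omega>. gv z * \<phi> (z - c t)) + a (c t) * (LINT z|lebesgue_on ?\<Omega>. gw z * \<phi> (z - c t))" for t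
    have sc: "continuous_on {t1..t2} (\<lambda>t. a (c t))"
      by (rule continuous_on_compose2[OF a cc]) (use cin in auto)
    have J': "(J has_real_derivative J' t) (at t within {t1..t2})" if "t \<in> {t1..t2}" for t
      unfolding J_def J'_def
      by (rule mollified_transport_derivative[OF cf gv gw \<phi>c1 \<phi>t c sc that])
    have gvm: "gv \<in> borel_measurable (lebesgue_on ?\<Omega>)" and gwm: "gw \<in> borel_measurable (lebesgue_on ?\<Omega>)"
      using gv(1) gw(1) by (auto simp: Linf_def)
    have J'b: "\<bar>J' t\<bar> \<le> e * C * m" if t: "t \<in> {t1..t2}" for t
    proof -
      note kb = kernel_integral_bound[OF open_box c\<phi> \<phi>int \<phi>0 near(5)[OF t]]
      obtain C' where C': "AE z in lebesgue_on ?\<Omega>. \<bar>gv z\<bar> \<le> C'" using Linf_AE_bounded[OF gv(1)] by blast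
      have iv: "integrable (lebesgue_on ?\<Omega>) (\<lambda>z. gv z * \<phi> (z - c t))"
      proof (rule kb(1)[OF _ gvm])
        show "AE z in lebesgue_on ?\<Omega>. \<phi> (z - c t) \<noteq> 0 \<longrightarrow> \<bar>gv z\<bar> \<le> C'"
          using C' by eventually_elim simp
      qed
      have iw: "integrable (lebesgue_on ?\<Omega>) (\<lambda>z. gw z * \<phi> (z - c t))"
      proof (rule kb(1)[OF _ gwm])
        show "AE z in lebesgue_on ?\<Omega>. \<phi> (z - c t) \<noteq> 0 \<longrightarrow> \<bar>gw z\<bar> \<le> C"
          using C(2) by eventually_elim simp
      qed
      have "J' t = (LINT z|lebesgue_on ?\<Omega>. gv z * \<phi> (z - c t) + a (c t) * (gw z * \<phi> (z - c t)))"
        unfolding J'_def using iv iw by (subst Bochner_Integration.integral_add) auto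
      also have "\<dots> = (LINT z|lebesgue_on ?\<Omega>. (gv z + a (c t) * gw z) * \<phi> (z - c t))"
        by (simp add: algebra_simps)
      also have "\<bar>\<dots>\<bar> \<le> (e * C) * (LINT z|lborel. \<phi> z)"
      proof (rule kb(2))
        show "(\<lambda>z. gv z + a (c t) * gw z) \<in> borel_measurable (lebesgue_on ?\<Omega>)" using gvm gwm by simp
        show "AE z in lebesgue_on ?\<Omega>. \<phi> (z - c t) \<noteq> 0 \<longrightarrow> \<bar>gv z + a (c t) * gw z\<bar> \<le> e * C"
          using eq C(2)
        proof eventually_elim
          case (elim z)
          show ?case
          proof
            assume nz: "\<phi> (z - c t) \<noteq> 0"
            have "\<bar>a (c t) - a z\<bar> \<le> e"
              using d(2)[OF near(3)[OF t nz] near(4)[OF t nz]] near(2)[OF t nz]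
              by (simp add: dist_norm norm_minus_commute)
            moreover have "gv z + a (c t) * gw z = (a (c t) - a z) * gw z"
              using elim(1) by (simp add: algebra_simps)
            ultimately show "\<bar>gv z + a (c t) * gw z\<bar> \<le> e * C"
              using elim(2) e by (auto simp: abs_mult intro!: mult_mono)
          qed
        qed
      qed
      finally show ?thesis by (simp add: m_def)
    qed
    have "norm (J t2 - J t1) \<le> e * C * m * norm (t2 - t1)"
      by (rule field_differentiable_bound[where S = "{t1..t2}" and f' = J'])
         (use J' J'b t12 in auto)
    then have d1: "\<bar>J t2 - J t1\<bar> \<le> e * C * m * (t2 - t1)" using t12 by simp
    have Jf: "\<bar>J t - f (c t) * m\<bar> \<le> K * e * m" if t: "t \<in> {t1..t2}" for t
    proof -
      note kb = kernel_integral_bound[OF open_box c\<phi> \<phi>int \<phi>0 near(5)[OF t]]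
      have cfp: "continuous_on (cbox A B) (\<lambda>z. f z * \<phi> (z - c t))"
        by (intro continuous_intros cf continuous_on_compose2[OF c\<phi>]) auto
      note kt = kernel_integral_translate[OF open_box c\<phi> \<phi>int near(5)[OF t]]
      have "J t - f (c t) * m = (LINT z|lebesgue_on ?\<Omega>. f z * \<phi> (z - c t)) - (LINT z|lebesgue_on ?\<Omega>. f (c t) * \<phi> (z - c t))"
        using kt(2) continuous_on_cbox_integral_box(3)[OF cfp] by (simp add: J_def m_def)
      also have "\<dots> = (LINT z|lebesgue_on ?\<Omega>. (f z - f (c t)) * \<phi> (z - c t))"
        using continuous_on_cbox_integral_box(2)[OF cfp] kt(1)
        by (subst Bochner_Integration.integral_diff[symmetric]) (auto simp: algebra_simps)
      also have "\<bar>\<dots>\<bar> \<le> (K * e) * (LINT z|lborel. \<phi> z)"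
      proof (rule kb(2))
        show "(\<lambda>z. f z - f (c t)) \<in> borel_measurable (lebesgue_on ?\<Omega>)"
          using continuous_on_cbox_integral_box(1)[OF cf] by (auto simp: Linf_def)
        show "AE z in lebesgue_on ?\<Omega>. \<phi> (z - c t) \<noteq> 0 \<longrightarrow> \<bar>f z - f (c t)\<bar> \<le> K * e"
        proof (intro AE_I2 impI)
          fix z assume nz: "\<phi> (z - c t) \<noteq> 0"
          have "z \<in> cbox A B" "c t \<in> cbox A B"
            using near(5)[OF t nz] cin[OF t] box_subset_cbox[of A B] by auto
          then have "\<bar>f z - f (c t)\<bar> \<le> K * norm (z - c t)"
            using lipschitz_onD[OF f, of z "c t"] by (simp add: dist_norm)
          also have "\<dots> \<le> K * e" using near(1)[OF t nz] K by (intro mult_left_mono)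
          finally show "\<bar>f z - f (c t)\<bar> \<le> K * e" .
        qed
      qed
      finally show ?thesis by (simp add: m_def)
    qed
    have "\<bar>f (c t2) - f (c t1)\<bar> * m = \<bar>f (c t2) * m - f (c t1) * m\<bar>"
      using \<open>m > 0\<close> abs_mult[of "f (c t2) - f (c t1)" m] by (simp add: left_diff_distrib)
    also have "\<dots> \<le> e * C * m * (t2 - t1) + K * e * m + K * e * m"
      using Jf[of t1] Jf[of t2] d1 t12 by (auto simp: abs_le_iff)
    also have "\<dots> = e * (C * (t2 - t1) + 2 * K) * m" by (simp add: algebra_simps)
    finally show ?thesis using \<open>m > 0\<close> by simp
  qed
  \<comment> \<open>The estimate holds for every positive \<open>e\<close> with the same factor, so the difference is zero.\<close>
  define M where "M = C * (t2 - t1) + 2 * K + 1"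
  have M: "M > 0" using C K t12 by (simp add: M_def add_nonneg_pos)
  show ?thesis
  proof (rule ccontr)
    assume "f (c t2) \<noteq> f (c t1)"
    then have pos: "\<bar>f (c t2) - f (c t1)\<bar> > 0" by simp
    define e where "e = \<bar>f (c t2) - f (c t1)\<bar> / (2 * M)"
    have e: "e > 0" using pos M by (simp add: e_def)
    have "\<bar>f (c t2) - f (c t1)\<bar> \<le> e * M"
      using main[OF e] e by (simp add: M_def algebra_simps)
    then show False using pos M by (simp add: e_def)
  qed
qed

section \<open>The speed of the interface\<close>

locale extrusion =
  fixes L \<zeta> \<rho> Veff Seff B Kd :: real
  assumes pos: "L > 0" "\<zeta> > 0" "\<rho> > 0" "Veff > 0" "Seff > 0" "B > 0" "Kd > 0"
begin

abbreviation F :: "real \<Rightarrow> real \<Rightarrow> real \<Rightarrow> real" where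
  "F \<equiv> interface_speed L \<rho> Veff Seff B Kd"

text \<open>One minus the die flow as a fraction of \<open>\<rho> Veff N\<close>.\<close>
definition leak :: "real \<Rightarrow> real" where "leak l = B * \<rho> / (B * \<rho> + Kd * (L - l))"

lemma leak_denominator: "l \<le> L \<Longrightarrow> 0 < B * \<rho> \<and> B * \<rho> \<le> B * \<rho> + Kd * (L - l)"
  using pos by auto

lemma leak_range: "l \<le> L \<Longrightarrow> 0 < leak l \<and> leak l \<le> 1"
  using leak_denominator[of l] by (auto simp: leak_def divide_simps)

lemma leak_lipschitz:
  assumes "l \<le> L" "l' \<le> L"
  shows "\<bar>leak l - leak l'\<bar> \<le> Kd / (B * \<rho>) * \<bar>l - l'\<bar>"
proof -
  define p where "p = B * \<rho> + Kd * (L - l)"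
  define p' where "p' = B * \<rho> + Kd * (L - l')"
  have p: "p \<ge> B * \<rho>" "p' \<ge> B * \<rho>" "B * \<rho> > 0" using leak_denominator assms by (auto simp: p_def p'_def)
  have pp: "p > 0" "p' > 0" using p by linarith+
  have "leak l = B * \<rho> / p" "leak l' = B * \<rho> / p'" by (simp_all only: leak_def p_def p'_def)
  then have "leak l - leak l' = B * \<rho> * (p' - p) / (p * p')"
    using p by (simp add: field_simps)
  also have "p' - p = Kd * (l - l')" by (simp add: p_def p'_def algebra_simps)
  finally have "\<bar>leak l - leak l'\<bar> = B * \<rho> / p * (Kd * \<bar>l - l'\<bar> / p')"
    using pp pos by (simp add: abs_mult)
  also have "\<dots> \<le> 1 * (Kd * \<bar>l - l'\<bar> / (B * \<rho>))"
  proof (rule mult_mono)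
    show "B * \<rho> / p \<le> 1" using p pp by (simp add: pos_divide_le_eq)
    show "Kd * \<bar>l - l'\<bar> / p' \<le> Kd * \<bar>l - l'\<bar> / (B * \<rho>)"
      by (rule divide_left_mono) (use p pp pos in auto)
  qed (use pp pos in auto)
  finally show ?thesis by simp
qed

text \<open>This form separates the dependence on \<open>l\<close> from that on \<open>f\<close>: both factors are bounded and Lipschitz as long as \<open>l \<le> L\<close>
and \<open>f\<close> stays away from \<open>1\<close>.\<close>
lemma interface_speed_eq:
  assumes "l \<le> L" "f < 1"
  shows "F l N f = Veff / Seff * (N * (1 - leak l * (1 / (1 - f))))"
proof -
  define p where "p = B * \<rho> + Kd * (L - l)"
  have p: "p > 0" using leak_denominator[OF assms(1)] by (auto simp: p_def)
  have kd: "Kd * (L - l) = p - B * \<rho>" by (simp add: p_def)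
  have "die_flow L \<rho> Veff B Kd l N = \<rho> * Veff * N * (Kd * (L - l)) / p"
    by (simp add: die_flow_def p_def ac_simps)
  then have "F l N f = (\<rho> * Veff * N * (p - B * \<rho>) / p - \<rho> * Veff * N * f) / (\<rho> * Seff * (1 - f))"
    by (simp add: interface_speed_def kd)
  also have "\<dots> = Veff / Seff * (N * (1 - B * \<rho> / p * (1 / (1 - f))))"
    using p pos assms(2) by (simp add: field_simps)
  finally show ?thesis by (simp add: leak_def p_def)
qed

lemma interface_speed_lipschitz:
  assumes m: "0 < m" and R: "R \<ge> 0"
  obtains \<Lambda> where "\<Lambda> > 0" "\<And>l l' N N' f f'. \<lbrakk>l \<le> L; l' \<le> L; \<bar>N\<bar> \<le> R; \<bar>N'\<bar> \<le> R; f \<le> 1 - m; f' \<le> 1 - m\<rbrakk>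
    \<Longrightarrow> \<bar>F l N f - F l' N' f'\<bar> \<le> \<Lambda> * (\<bar>l - l'\<bar> + \<bar>N - N'\<bar> + \<bar>f - f'\<bar>)"
proof -
  define a where "a = Kd / (B * \<rho>) / m"
  define b where "b = 1 / m ^ 2"
  define c where "c = 1 + 1 / m"
  define \<Lambda> where "\<Lambda> = Veff / Seff * (c + R * a + R * b)"
  have abc: "a \<ge> 0" "b \<ge> 0" "c > 0" using pos m by (auto simp: a_def b_def c_def add_pos_pos)
  have "c + R * a + R * b > 0" using abc R by (simp add: add_pos_nonneg)
  then have "\<Lambda> > 0" using pos by (simp add: \<Lambda>_def)
  moreover have "\<bar>F l N f - F l' N' f'\<bar> \<le> \<Lambda> * (\<bar>l - l'\<bar> + \<bar>N - N'\<bar> + \<bar>f - f'\<bar>)"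
    if H: "l \<le> L" "l' \<le> L" "\<bar>N\<bar> \<le> R" "\<bar>N'\<bar> \<le> R" "f \<le> 1 - m" "f' \<le> 1 - m" for l l' N N' f f'
  proof -
    define Q where "Q = 1 / (1 - f)"
    define Q' where "Q' = 1 / (1 - f')"
    have Q: "0 < Q" "Q \<le> 1 / m" "0 < Q'" "Q' \<le> 1 / m" using H m by (auto simp: Q_def Q'_def divide_simps)
    have "Q - Q' = Q * Q' * (f - f')" using H m by (simp add: Q_def Q'_def field_simps)
    then have "\<bar>Q - Q'\<bar> = Q * Q' * \<bar>f - f'\<bar>" using Q by (simp add: abs_mult)
    also have "\<dots> \<le> (1 / m) * (1 / m) * \<bar>f - f'\<bar>" using Q m by (intro mult_mono) auto
    finally have dQ: "\<bar>Q - Q'\<bar> \<le> b * \<bar>f - f'\<bar>" by (simp add: b_def power2_eq_square)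
    note P = leak_range[OF H(1)] leak_range[OF H(2)]
    have PQ: "\<bar>leak l * Q\<bar> \<le> 1 / m" using P Q mult_mono[of "leak l" 1 Q "1 / m"] by (simp add: abs_mult)
    have "\<bar>leak l * Q - leak l' * Q'\<bar> = \<bar>(leak l - leak l') * Q + leak l' * (Q - Q')\<bar>"
      by (simp add: algebra_simps)
    also have "\<dots> \<le> \<bar>leak l - leak l'\<bar> * Q + leak l' * \<bar>Q - Q'\<bar>"
      using Q P by (intro order_trans[OF abs_triangle_ineq]) (simp add: abs_mult)
    also have "\<dots> \<le> (Kd / (B * \<rho>) * \<bar>l - l'\<bar>) * (1 / m) + 1 * (b * \<bar>f - f'\<bar>)"
      using Q P dQ leak_lipschitz[OF H(1,2)] pos by (intro add_mono mult_mono) auto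
    finally have dE: "\<bar>leak l * Q - leak l' * Q'\<bar> \<le> a * \<bar>l - l'\<bar> + b * \<bar>f - f'\<bar>"
      by (simp add: a_def)
    have "\<bar>N * (1 - leak l * Q) - N' * (1 - leak l' * Q')\<bar>
        = \<bar>(N - N') * (1 - leak l * Q) + N' * (leak l' * Q' - leak l * Q)\<bar>"
      by (simp add: algebra_simps)
    also have "\<dots> \<le> \<bar>N - N'\<bar> * \<bar>1 - leak l * Q\<bar> + \<bar>N'\<bar> * \<bar>leak l' * Q' - leak l * Q\<bar>"
      by (intro order_trans[OF abs_triangle_ineq]) (simp add: abs_mult)
    also have "\<dots> \<le> \<bar>N - N'\<bar> * c + R * (a * \<bar>l - l'\<bar> + b * \<bar>f - f'\<bar>)"
      using PQ dE H R by (intro add_mono mult_mono) (auto simp: c_def)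
    also have "\<dots> = R * a * \<bar>l - l'\<bar> + c * \<bar>N - N'\<bar> + R * b * \<bar>f - f'\<bar>" by (simp add: algebra_simps)
    also have "\<dots> \<le> (c + R * a + R * b) * \<bar>l - l'\<bar> + (c + R * a + R * b) * \<bar>N - N'\<bar> + (c + R * a + R * b) * \<bar>f - f'\<bar>"
      using abc R by (intro add_mono mult_right_mono) auto
    finally have "\<bar>N * (1 - leak l * Q) - N' * (1 - leak l' * Q')\<bar>
        \<le> (c + R * a + R * b) * (\<bar>l - l'\<bar> + \<bar>N - N'\<bar> + \<bar>f - f'\<bar>)" by (simp add: algebra_simps)
    then have "Veff / Seff * \<bar>N * (1 - leak l * Q) - N' * (1 - leak l' * Q')\<bar>
        \<le> Veff / Seff * ((c + R * a + R * b) * (\<bar>l - l'\<bar> + \<bar>N - N'\<bar> + \<bar>f - f'\<bar>))"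
      using pos by (intro mult_left_mono) auto
    moreover have "F l N f = Veff / Seff * (N * (1 - leak l * Q))" "F l' N' f' = Veff / Seff * (N' * (1 - leak l' * Q'))"
      using interface_speed_eq H m by (auto simp: Q_def Q'_def)
    then have "\<bar>F l N f - F l' N' f'\<bar> = Veff / Seff * \<bar>N * (1 - leak l * Q) - N' * (1 - leak l' * Q')\<bar>"
      using pos by (simp only: right_diff_distrib[symmetric] abs_mult) simp
    ultimately show ?thesis by (simp add: \<Lambda>_def mult.assoc)
  qed
  ultimately show ?thesis by (rule that)
qed

lemma continuous_on_interface_speed:
  assumes "continuous_on S l" "continuous_on S N" "continuous_on S f"
    and "\<And>x. x \<in> S \<Longrightarrow> l x \<le> L" "\<And>x. x \<in> S \<Longrightarrow> f x < 1"
  shows "continuous_on S (\<lambda>x. F (l x) (N x) (f x))"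
proof -
  have "B * \<rho> + Kd * (L - l x) \<noteq> 0" if "x \<in> S" for x
    using leak_denominator[OF assms(4)[OF that]] by linarith
  moreover have "\<rho> * Seff * (1 - f x) \<noteq> 0" if "x \<in> S" for x
    using assms(5)[OF that] pos by auto
  ultimately show ?thesis unfolding interface_speed_def die_flow_def
    by (intro continuous_intros assms) auto
qed

end

section \<open>Small data, the profile and the reduced equation\<close>

text \<open>The smallness condition in the form in which it is used: \<open>\<epsilon>\<close> bounds the oscillation and the Lipschitz constants of all
data, and \<open>\<epsilon>\<close> itself is so small that \<open>N\<close>, \<open>l\<^sup>0\<close> and the values of \<open>f\<^sub>p\<close> stay in a fixed compact range, that the
bound \<open>2 exp (2 \<Lambda> T) \<epsilon>\<close> on the displacement of the interface keeps it inside \<open>(0, L)\<close>, and that the resulting bound on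
the speed of the interface is smaller than \<open>\<zeta> N\<close>. The constant \<open>\<Lambda>\<close> is a Lipschitz constant of the speed on that range.\<close>
locale extrusion_data = extrusion +
  fixes T le Ne fpe \<epsilon> \<Lambda> l0 :: real and f0 Fin N :: "real \<Rightarrow> real"
  assumes T: "T > 0"
    and equilibrium: "interface_speed L \<rho> Veff Seff B Kd le Ne fpe = 0"
    and eq_range: "0 < fpe" "fpe < 1" "0 < le" "le < L" "Ne > 0"
    and \<Lambda>: "\<Lambda> > 0"
    and \<Lambda>_lipschitz: "\<And>l l' n n' f f'. \<lbrakk>l \<le> L; l' \<le> L; \<bar>n\<bar> \<le> 2 * Ne; \<bar>n'\<bar> \<le> 2 * Ne;
          f \<le> (1 + fpe) / 2; f' \<le> (1 + fpe) / 2\<rbrakk> \<Longrightarrow>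
          \<bar>interface_speed L \<rho> Veff Seff B Kd l n f - interface_speed L \<rho> Veff Seff B Kd l' n' f'\<bar>
            \<le> \<Lambda> * (\<bar>l - l'\<bar> + \<bar>n - n'\<bar> + \<bar>f - f'\<bar>)"
    and \<epsilon>: "\<epsilon> > 0" "2 * \<epsilon> \<le> Ne" "2 * \<epsilon> \<le> 1 - fpe" "2 * \<epsilon> \<le> fpe" "2 * \<epsilon> \<le> le"
    and \<epsilon>_l: "2 * exp (2 * \<Lambda> * T) * \<epsilon> < le" "2 * exp (2 * \<Lambda> * T) * \<epsilon> < L - le"
    and \<epsilon>_speed: "2 * (\<Lambda> * (2 * exp (2 * \<Lambda> * T) + 2) * \<epsilon>) < \<zeta> * Ne"
    and f0: "\<epsilon>-lipschitz_on {0..1} f0" "\<And>x. x \<in> {0..1} \<Longrightarrow> \<bar>f0 x - fpe\<bar> \<le> \<epsilon>"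
    and inflow: "\<epsilon>-lipschitz_on {0..T} (\<lambda>t. Fin t / (\<rho> * Veff * N t))"
      "\<And>t. t \<in> {0..T} \<Longrightarrow> \<bar>Fin t / (\<rho> * Veff * N t) - fpe\<bar> \<le> \<epsilon>"
    and N: "\<epsilon>-lipschitz_on {0..T} N" "\<And>t. t \<in> {0..T} \<Longrightarrow> \<bar>N t - Ne\<bar> \<le> \<epsilon>"
    and l0: "\<bar>l0 - le\<bar> \<le> \<epsilon>"
    and compatible: "Fin 0 / (\<rho> * Veff * N 0) = f0 0"
begin

definition q :: "real \<Rightarrow> real" where "q t = Fin t / (\<rho> * Veff * N t)"

lemma q: "\<epsilon>-lipschitz_on {0..T} q" "\<And>t. t \<in> {0..T} \<Longrightarrow> \<bar>q t - fpe\<bar> \<le> \<epsilon>" "q 0 = f0 0"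
  using inflow compatible unfolding q_def[abs_def] by auto

lemma l0_bounds: "le / 2 \<le> l0" "0 < l0" "l0 < L"
proof -
  show "le / 2 \<le> l0" using l0 \<epsilon>(5) by (simp add: abs_le_iff)
  then show "0 < l0" using eq_range by simp
  have "1 \<le> exp (2 * \<Lambda> * T)" using \<Lambda> T by simp
  then have "1 \<le> 2 * exp (2 * \<Lambda> * T)" by linarith
  then have "1 * \<epsilon> \<le> 2 * exp (2 * \<Lambda> * T) * \<epsilon>" by (rule mult_right_mono) (use \<epsilon>(1) in auto)
  then show "l0 < L" using l0 \<epsilon>_l(2) by (simp add: abs_le_iff)
qed

lemma N_bounds: "t \<in> {0..T} \<Longrightarrow> Ne / 2 \<le> N t \<and> N t \<le> 2 * Ne"
  using N(2)[of t] \<epsilon> by (auto simp: abs_le_iff)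

lemma N_continuous: "continuous_on {0..T} N"
  using N(1) by (rule lipschitz_on_continuous_on)

text \<open>The distance that the material is transported up to time \<open>t\<close> in the coordinate \<open>y = l(t) x\<close>.\<close>
definition M :: "real \<Rightarrow> real" where "M t = \<zeta> * integral {0..t} N"

lemma M_0 [simp]: "M 0 = 0" by (simp add: M_def)

lemma M_deriv: "t \<in> {0..T} \<Longrightarrow> (M has_real_derivative \<zeta> * N t) (at t within {0..T})"
  unfolding M_def
  by (rule DERIV_cmult, rule integral_has_real_derivative[OF N_continuous])

lemma M_continuous: "continuous_on {0..T} M"
  using M_deriv by (rule DERIV_continuous_on)

lemma M_diff:
  assumes "0 \<le> x" "x \<le> y" "y \<le> T"
  shows "\<zeta> * Ne / 2 * (y - x) \<le> M y - M x" "M y - M x \<le> 2 * \<zeta> * Ne * (y - x)"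
proof -
  have i: "N integrable_on {a..b}" if "0 \<le> a" "b \<le> T" for a b
    using that by (intro integrable_continuous_interval continuous_on_subset[OF N_continuous]) auto
  have "integral {0..x} N + integral {x..y} N = integral {0..y} N"
    using assms by (intro Henstock_Kurzweil_Integration.integral_combine[OF assms(1,2)] i) auto
  then have e: "M y - M x = \<zeta> * integral {x..y} N"
    by (simp add: M_def right_diff_distrib[symmetric] flip: \<open>integral {0..x} N + integral {x..y} N = integral {0..y} N\<close>)
  have I: "(N has_integral integral {x..y} N) {x..y}" using assms by (intro integrable_integral i) auto
  have "Ne / 2 * (y - x) \<le> integral {x..y} N"
    by (rule has_integral_le[OF _ I, of "\<lambda>_. Ne / 2"])
       (use N_bounds assms has_integral_const_real[of "Ne / 2" x y] in \<open>auto simp: mult.commute\<close>)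
  moreover have "integral {x..y} N \<le> 2 * Ne * (y - x)"
    by (rule has_integral_le[OF I, of "\<lambda>_. 2 * Ne"])
       (use N_bounds assms has_integral_const_real[of "2 * Ne" x y] in \<open>auto simp: mult.commute\<close>)
  ultimately show "\<zeta> * Ne / 2 * (y - x) \<le> M y - M x" "M y - M x \<le> 2 * \<zeta> * Ne * (y - x)"
    using pos mult_left_mono[of "Ne / 2 * (y - x)" "integral {x..y} N" \<zeta>]
      mult_left_mono[of "integral {x..y} N" "2 * Ne * (y - x)" \<zeta>] unfolding e by (auto simp: ac_simps)
qed

lemma M_lipschitz: "x \<in> {0..T} \<Longrightarrow> y \<in> {0..T} \<Longrightarrow> \<bar>M x - M y\<bar> \<le> 2 * \<zeta> * Ne * \<bar>x - y\<bar>"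
proof (induction x y rule: linorder_wlog)
  case (le x y)
  have "0 \<le> \<zeta> * Ne / 2 * (y - x)" using pos eq_range le by simp
  then show ?case using M_diff[of x y] le by (auto simp: abs_if)
next
  case (sym x y)
  then show ?case by (simp add: abs_minus_commute)
qed

lemma M_inverse_lipschitz: "x \<in> {0..T} \<Longrightarrow> y \<in> {0..T} \<Longrightarrow> \<bar>x - y\<bar> \<le> 2 / (\<zeta> * Ne) * \<bar>M x - M y\<bar>"
proof (induction x y rule: linorder_wlog)
  case (le x y)
  have "\<zeta> * Ne > 0" using pos eq_range by simp
  moreover have "\<zeta> * Ne / 2 * (y - x) \<le> \<bar>M x - M y\<bar>" 
  proof -
    have "\<zeta> * Ne / 2 * (y - x) \<le> M y - M x" using le by (intro M_diff(1)) auto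
    then show ?thesis by linarith
  qed
  ultimately have "y - x \<le> \<bar>M x - M y\<bar> / (\<zeta> * Ne / 2)"
    by (subst pos_le_divide_eq) (auto simp: mult.commute)
  moreover have "\<bar>x - y\<bar> = y - x" using le by simp
  moreover have "\<bar>M x - M y\<bar> / (\<zeta> * Ne / 2) = 2 / (\<zeta> * Ne) * \<bar>M x - M y\<bar>" by simp
  ultimately show ?case by linarith
next
  case (sym x y)
  then show ?case by (simp add: abs_minus_commute)
qed

text \<open>The time at which the transported distance equals \<open>s\<close>; it is meaningful for \<open>0 \<le> s \<le> M T\<close>.\<close>
definition \<tau> :: "real \<Rightarrow> real" where "\<tau> s = (SOME t. t \<in> {0..T} \<and> M t = s)"

lemma \<tau>: assumes "0 \<le> s" "s \<le> M T" shows "\<tau> s \<in> {0..T}" "M (\<tau> s) = s"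
proof -
  have "\<exists>t\<ge>0. t \<le> T \<and> M t = s"
    using assms T by (intro IVT' M_continuous) auto
  then have "\<exists>t. t \<in> {0..T} \<and> M t = s" by auto
  from someI_ex[OF this] show "\<tau> s \<in> {0..T}" "M (\<tau> s) = s" by (simp_all add: \<tau>_def)
qed

lemma M_range: "t \<in> {0..T} \<Longrightarrow> 0 \<le> M t \<and> M t \<le> M T"
proof -
  assume t: "t \<in> {0..T}"
  have "0 \<le> \<zeta> * Ne / 2 * (t - 0)" "0 \<le> \<zeta> * Ne / 2 * (T - t)" using pos eq_range t by auto
  then show ?thesis using M_diff(1)[of 0 t] M_diff(1)[of t T] t by auto
qed

lemma \<tau>_M: assumes t: "t \<in> {0..T}" shows "\<tau> (M t) = t"
  using M_inverse_lipschitz[of "\<tau> (M t)" t] \<tau>[of "M t"] M_range[OF t] t by auto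

text \<open>The profile: a particle with label \<open>s = y - M(t)\<close> was inside at time zero at \<open>x = s / l\<^sup>0\<close> if \<open>s \<ge> 0\<close>, and entered at the
time \<open>\<tau>(- s)\<close> if \<open>s \<le> 0\<close>. With the arguments truncated, one of the first two summands always equals the common corner
value \<open>q 0 = f0 0\<close>, which is subtracted. As a sum, \<open>h\<close> is visibly Lipschitz, and it is defined for all labels.\<close>
definition h :: "real \<Rightarrow> real" where
  "h s = q (\<tau> (max 0 (min (M T) (- s)))) + f0 (max 0 (min 1 (s / l0))) - f0 0"

definition H :: real where "H = 2 / le + 2 / (\<zeta> * Ne)"

lemma H_pos: "H > 0" using pos eq_range by (simp add: H_def add_pos_pos)

lemma \<tau>_0 [simp]: "\<tau> 0 = 0" using \<tau>_M[of 0] T by simp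

lemma h_neg: assumes "s \<le> 0" shows "h s = q (\<tau> (min (M T) (- s)))"
proof -
  have "s / l0 \<le> 0" using assms l0_bounds by (intro divide_nonpos_pos) auto
  then have "max 0 (min 1 (s / l0)) = 0" by simp
  moreover have "max 0 (min (M T) (- s)) = min (M T) (- s)" using M_range[of T] T assms by simp
  ultimately show ?thesis by (simp add: h_def)
qed

lemma h_nonneg: assumes "s \<ge> 0" shows "h s = f0 (min 1 (s / l0))"
proof -
  have "max 0 (min 1 (s / l0)) = min 1 (s / l0)" using assms l0_bounds by simp
  moreover have "max 0 (min (M T) (- s)) = 0" using assms by simp
  ultimately show ?thesis by (simp add: h_def q(3))
qed

lemma h_inflow: "t \<in> {0..T} \<Longrightarrow> h (- M t) = q t"
  using M_range[of t] h_neg[of "- M t"] by (simp add: \<tau>_M min_absorb2)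

lemma h_initial: "x \<in> {0..1} \<Longrightarrow> h (l0 * x) = f0 x"
  using h_nonneg[of "l0 * x"] l0_bounds by simp

lemma h_range: "\<bar>h s - fpe\<bar> \<le> \<epsilon>"
proof (cases "s \<ge> 0")
  case True
  then show ?thesis using l0_bounds f0(2)[of "min 1 (s / l0)"] by (simp add: h_nonneg)
next
  case False
  have "\<tau> (min (M T) (- s)) \<in> {0..T}"
    using False M_range[of T] T by (intro \<tau>(1)) auto
  then show ?thesis using False q(2) by (simp add: h_neg)
qed

text \<open>The factor \<open>2 / le\<close> comes from rescaling the initial value by \<open>l\<^sup>0 \<ge> le / 2\<close>, the factor \<open>2 / (\<zeta> Ne)\<close> from the
inverse of \<open>M\<close>, whose derivative is at least \<open>\<zeta> Ne / 2\<close>.\<close>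
lemma h_lipschitz: "(\<epsilon> * H)-lipschitz_on UNIV h"
proof (rule lipschitz_onI)
  fix x y :: real
  define c where "c s = max 0 (min (M T) (- s))" for s
  define d where "d s = max 0 (min 1 (s / l0))" for s
  have c: "0 \<le> c s" "c s \<le> M T" "\<bar>c x - c y\<bar> \<le> \<bar>x - y\<bar>" for s
    using M_range[of T] T by (auto simp: c_def)
  have d: "d s \<in> {0..1}" for s by (auto simp: d_def)
  have "\<bar>d x - d y\<bar> \<le> \<bar>x / l0 - y / l0\<bar>" by (auto simp: d_def)
  also have "\<dots> = \<bar>x - y\<bar> / l0" using l0_bounds by (simp add: diff_divide_distrib[symmetric])
  also have "\<dots> \<le> \<bar>x - y\<bar> / (le / 2)" using l0_bounds eq_range by (intro divide_left_mono) auto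
  finally have dd: "\<bar>d x - d y\<bar> \<le> 2 / le * \<bar>x - y\<bar>" by (simp add: mult.commute)
  have "\<bar>q (\<tau> (c x)) - q (\<tau> (c y))\<bar> \<le> \<epsilon> * \<bar>\<tau> (c x) - \<tau> (c y)\<bar>"
    using lipschitz_onD[OF q(1) \<tau>(1)[OF c(1,2)] \<tau>(1)[OF c(1,2)], of x y] by (simp add: dist_real_def)
  also have "\<dots> \<le> \<epsilon> * (2 / (\<zeta> * Ne) * \<bar>c x - c y\<bar>)"
    using M_inverse_lipschitz[OF \<tau>(1)[OF c(1,2)] \<tau>(1)[OF c(1,2)], of x y] \<epsilon>
    by (intro mult_left_mono) (simp_all add: \<tau>(2)[OF c(1,2)])
  also have "\<dots> \<le> \<epsilon> * (2 / (\<zeta> * Ne) * \<bar>x - y\<bar>)"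
    using c(3) \<epsilon> pos eq_range by (intro mult_left_mono) auto
  finally have 1: "\<bar>q (\<tau> (c x)) - q (\<tau> (c y))\<bar> \<le> \<epsilon> * (2 / (\<zeta> * Ne) * \<bar>x - y\<bar>)" .
  have "\<bar>f0 (d x) - f0 (d y)\<bar> \<le> \<epsilon> * \<bar>d x - d y\<bar>"
    using lipschitz_onD[OF f0(1) d d, of x y] by (simp add: dist_real_def)
  also have "\<dots> \<le> \<epsilon> * (2 / le * \<bar>x - y\<bar>)" using dd \<epsilon> by (intro mult_left_mono) auto
  finally have 2: "\<bar>f0 (d x) - f0 (d y)\<bar> \<le> \<epsilon> * (2 / le * \<bar>x - y\<bar>)" .
  have "\<bar>h x - h y\<bar> \<le> \<bar>q (\<tau> (c x)) - q (\<tau> (c y))\<bar> + \<bar>f0 (d x) - f0 (d y)\<bar>"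
    unfolding h_def c_def[symmetric] d_def[symmetric] by linarith
  also have "\<dots> \<le> \<epsilon> * H * \<bar>x - y\<bar>" using 1 2 by (simp add: H_def algebra_simps)
  finally show "dist (h x) (h y) \<le> \<epsilon> * H * dist x y" by (simp add: dist_real_def)
qed (use \<epsilon> H_pos in simp)

lemma h_dist: "\<bar>h x - h y\<bar> \<le> \<epsilon> * H * \<bar>x - y\<bar>"
  using lipschitz_onD[OF h_lipschitz, of x y] by (simp add: dist_real_def)

lemma h_le: "h s \<le> (1 + fpe) / 2" "0 < h s" "h s < 1"
  using h_range[of s] \<epsilon> eq_range by (auto simp: abs_le_iff)

lemma h_continuous: "continuous_on S h"
  using lipschitz_on_continuous_on[OF h_lipschitz] continuous_on_subset by blast

abbreviation A :: real where "A \<equiv> 2 * exp (2 * \<Lambda> * T)"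

text \<open>The speed vanishes at the equilibrium, so its Lipschitz constant bounds it by the distance from the equilibrium.\<close>
lemma speed_bound:
  assumes "t \<in> {0..T}" "l \<le> L"
  shows "\<bar>F l (N t) (h s)\<bar> \<le> \<Lambda> * (\<bar>l - le\<bar> + 2 * \<epsilon>)"
proof -
  have "\<bar>F l (N t) (h s) - F le Ne fpe\<bar> \<le> \<Lambda> * (\<bar>l - le\<bar> + \<bar>N t - Ne\<bar> + \<bar>h s - fpe\<bar>)"
    using assms eq_range h_le N_bounds[OF assms(1)] by (intro \<Lambda>_lipschitz) auto
  also have "\<dots> \<le> \<Lambda> * (\<bar>l - le\<bar> + 2 * \<epsilon>)"
    using \<Lambda> N(2)[OF assms(1)] h_range[of s] by (intro mult_left_mono) auto
  finally show ?thesis using equilibrium by simp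
qed

lemma speed_lipschitz:
  assumes "t \<in> {0..T}" "x \<le> L" "y \<le> L"
  shows "\<bar>F x (N t) (h a) - F y (N t) (h b)\<bar> \<le> \<Lambda> * (\<bar>x - y\<bar> + \<epsilon> * H * \<bar>a - b\<bar>)"
proof -
  have "\<bar>F x (N t) (h a) - F y (N t) (h b)\<bar> \<le> \<Lambda> * (\<bar>x - y\<bar> + \<bar>N t - N t\<bar> + \<bar>h a - h b\<bar>)"
    using assms eq_range h_le N_bounds[OF assms(1)] by (intro \<Lambda>_lipschitz) auto
  also have "\<dots> \<le> \<Lambda> * (\<bar>x - y\<bar> + \<epsilon> * H * \<bar>a - b\<bar>)"
    using \<Lambda> h_dist[of a b] by (intro mult_left_mono) auto
  finally show ?thesis .
qed

text \<open>The speed is Lipschitz only for \<open>l \<le> L\<close>, so the equation is solved with \<open>l\<close> truncated at \<open>L\<close>. Gronwall's inequality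
for \<open>(l - le)\<^sup>2 + \<epsilon>\<^sup>2\<close> shows that the solution stays so close to \<open>le\<close> that the truncation is never active.\<close>
lemma interface_exists:
  obtains l where "l 0 = l0" "continuous_on {0..T} l"
    "\<And>t. t \<in> {0..T} \<Longrightarrow> \<bar>l t - le\<bar> \<le> A * \<epsilon>"
    "\<And>t. t \<in> {0..T} \<Longrightarrow> (l has_real_derivative F (l t) (N t) (h (l t - M t))) (at t within {0..T})"
proof -
  define c where "c x = min L x" for x
  have c: "c x \<le> L" "\<bar>c x - c y\<bar> \<le> \<bar>x - y\<bar>" for x y by (auto simp: c_def)
  define G where "G t x = F (c x) (N t) (h (x - M t))" for t x
  obtain l where l: "l 0 = l0" "continuous_on {0..T} l"
    and dl: "\<And>t. t \<in> {0..T} \<Longrightarrow> (l has_real_derivative G t (l t)) (at t within {0..T})"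
  proof (rule global_ode_solution[of T "\<Lambda> * (1 + \<epsilon> * H)" G l0])
    fix t x y assume t: "t \<in> {0..T}"
    have "\<bar>G t x - G t y\<bar> \<le> \<Lambda> * (\<bar>c x - c y\<bar> + \<epsilon> * H * \<bar>(x - M t) - (y - M t)\<bar>)"
      unfolding G_def by (rule speed_lipschitz[OF t c(1) c(1)])
    also have "\<dots> \<le> \<Lambda> * (\<bar>x - y\<bar> + \<epsilon> * H * \<bar>x - y\<bar>)"
      using \<Lambda> c by (intro mult_left_mono) auto
    finally show "\<bar>G t x - G t y\<bar> \<le> \<Lambda> * (1 + \<epsilon> * H) * \<bar>x - y\<bar>" by (simp add: algebra_simps)
  next
    have "continuous_on ({0..T} \<times> UNIV) (\<lambda>p. F (c (snd p)) (N (fst p)) (h (snd p - M (fst p))))"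
    proof (intro continuous_on_interface_speed)
      show "continuous_on ({0..T} \<times> (UNIV :: real set)) (\<lambda>p. c (snd p))"
        unfolding c_def by (intro continuous_intros)
      show "continuous_on ({0..T} \<times> (UNIV :: real set)) (\<lambda>p. N (fst p))"
        by (rule continuous_on_compose2[OF N_continuous]) (auto intro!: continuous_intros)
      have "continuous_on ({0..T} \<times> (UNIV :: real set)) (\<lambda>p. M (fst p))"
        by (rule continuous_on_compose2[OF M_continuous]) (auto intro!: continuous_intros)
      then show "continuous_on ({0..T} \<times> UNIV) (\<lambda>p. h (snd p - M (fst p)))"
        by (intro continuous_on_compose2[OF h_continuous[of UNIV]] continuous_intros) auto
    qed (use c h_le in auto)
    then show "continuous_on ({0..T} \<times> UNIV) (\<lambda>(t, x). G t x)"
      by (simp add: G_def case_prod_unfold)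
  qed (use T \<Lambda> \<epsilon> H_pos in auto)
  have lb: "\<bar>l t - le\<bar> \<le> A * \<epsilon>" if t: "t \<in> {0..T}" for t
  proof -
    have "(l t - le)\<^sup>2 + \<epsilon>\<^sup>2 \<le> exp (4 * \<Lambda> * (t - 0)) * ((l 0 - le)\<^sup>2 + \<epsilon>\<^sup>2)"
    proof (rule gronwall_derivative[where w' = "\<lambda>s. 2 * (l s - le) * G s (l s)"])
      show "continuous_on {0..t} (\<lambda>t. (l t - le)\<^sup>2 + \<epsilon>\<^sup>2)"
        using t by (intro continuous_intros continuous_on_subset[OF l(2)]) auto
      fix s assume s: "0 < s" "s < t"
      then have "(l has_real_derivative G s (l s)) (at s)"
        using dl[of s] t at_within_Icc_at[of 0 s T] by simp
      then show "((\<lambda>t. (l t - le)\<^sup>2 + \<epsilon>\<^sup>2) has_real_derivative 2 * (l s - le) * G s (l s)) (at s)"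
        by (auto intro!: derivative_eq_intros)
      define u where "u = \<bar>l s - le\<bar>"
      have "\<bar>c (l s) - le\<bar> \<le> u" using eq_range by (auto simp: c_def u_def)
      then have "\<Lambda> * (\<bar>c (l s) - le\<bar> + 2 * \<epsilon>) \<le> \<Lambda> * (u + 2 * \<epsilon>)" using \<Lambda> by simp
      then have "\<bar>G s (l s)\<bar> \<le> \<Lambda> * (u + 2 * \<epsilon>)"
        using speed_bound[of s "c (l s)" "l s - M s"] c s t unfolding G_def by fastforce
      then have "u * \<bar>G s (l s)\<bar> \<le> u * (\<Lambda> * (u + 2 * \<epsilon>))" by (intro mult_left_mono) (auto simp: u_def)
      moreover have "(l s - le) * G s (l s) \<le> u * \<bar>G s (l s)\<bar>"
        unfolding u_def abs_mult[symmetric] by simp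
      moreover have "2 * (u * \<epsilon>) \<le> u\<^sup>2 + \<epsilon>\<^sup>2" using sum_squares_bound[of u \<epsilon>] by simp
      then have "\<Lambda> * (2 * (u * \<epsilon>)) \<le> \<Lambda> * (u\<^sup>2 + \<epsilon>\<^sup>2)" using \<Lambda> by simp
      moreover have "0 \<le> \<Lambda> * \<epsilon>\<^sup>2" using \<Lambda> by simp
      ultimately have "2 * ((l s - le) * G s (l s)) \<le> 4 * (\<Lambda> * (u\<^sup>2 + \<epsilon>\<^sup>2))"
        by (simp add: algebra_simps power2_eq_square)
      then show "2 * (l s - le) * G s (l s) \<le> 4 * \<Lambda> * ((l s - le)\<^sup>2 + \<epsilon>\<^sup>2)"
        by (simp add: u_def algebra_simps)
    qed (use t in auto)
    also have "\<dots> \<le> exp (4 * \<Lambda> * T) * (\<epsilon>\<^sup>2 + \<epsilon>\<^sup>2)"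
    proof (intro mult_mono add_mono)
      have "\<bar>l 0 - le\<bar>\<^sup>2 \<le> \<epsilon>\<^sup>2" using l0 l(1) by (intro power_mono) auto
      then show "(l 0 - le)\<^sup>2 \<le> \<epsilon>\<^sup>2" by simp
    qed (use t \<Lambda> in auto)
    also have "\<dots> \<le> (A * \<epsilon>)\<^sup>2"
    proof -
      have "exp (4 * \<Lambda> * T) = (exp (2 * \<Lambda> * T))\<^sup>2" by (simp add: exp_double[symmetric])
      then show ?thesis by (simp add: power_mult_distrib)
    qed
    finally have "(l t - le)\<^sup>2 \<le> (A * \<epsilon>)\<^sup>2" by (smt (verit) zero_le_power2)
    then show ?thesis using \<epsilon> by (intro abs_le_square_iff[THEN iffD2, of "l t - le" "A * \<epsilon>", THEN order_trans]) auto
  qed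
  show ?thesis
  proof (rule that[OF l lb])
    fix t assume t: "t \<in> {0..T}"
    have "l t \<le> L" using lb[OF t] \<epsilon>_l by (auto simp: abs_le_iff)
    then show "(l has_real_derivative F (l t) (N t) (h (l t - M t))) (at t within {0..T})"
      using dl[OF t] by (simp add: G_def c_def min_absorb2)
  qed
qed

end

section \<open>The solution built from the profile\<close>

text \<open>For fixed \<open>t\<close> the exceptional values of \<open>x\<close> form the preimage of a null set under a nonconstant affine map. The claim
follows by Fubini's theorem, after enclosing the null set in a Borel null set.\<close>
lemma AE_affine_fibre_avoids_negligible:
  fixes a b :: "real \<Rightarrow> real"
  assumes T: "T > 0" and a: "continuous_on {0..T} a" "\<And>t. t \<in> {0..T} \<Longrightarrow> a t > 0" and b: "continuous_on {0..T} b"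
    and N: "negligible N"
  shows "AE z in lebesgue_on (space_time T). a (fst z) * snd z + b (fst z) \<notin> N"
proof -
  obtain N' where N': "N' \<in> null_sets lborel" "N \<subseteq> N'"
    using N by (auto simp: negligible_iff_null_sets null_sets_completion_iff2)
  define c where "c t = max 0 (min T t)" for t
  have c: "c t \<in> {0..T}" "continuous_on UNIV c" for t
    using T by (auto simp: c_def intro!: continuous_intros)
  have cont: "continuous_on UNIV (\<lambda>z :: real \<times> real. g (c (fst z)))" if "continuous_on {0..T} g" for g :: "real \<Rightarrow> real"
    by (rule continuous_on_compose2[OF that])
       (auto intro!: continuous_intros continuous_on_compose2[OF c(2)] simp: c(1)[simplified])
  define \<theta> where "\<theta> z = b (c (fst z)) + a (c (fst z)) * snd z" for z :: "real \<times> real"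
  have "continuous_on UNIV \<theta>" unfolding \<theta>_def by (intro continuous_intros cont a b)
  then have \<theta>m: "\<theta> \<in> borel \<rightarrow>\<^sub>M borel" by (rule borel_measurable_continuous_onI)
  have N'b: "N' \<in> sets borel" using N' by auto
  have "AE z in (lborel \<Otimes>\<^sub>M lborel). \<theta> z \<notin> N'"
  proof (rule lborel_pair.AE_pair_measure)
    have "- (\<theta> -` N' \<inter> space borel) \<in> sets borel"
      using measurable_sets[OF \<theta>m N'b] by (intro borel_comp)
    moreover have "- (\<theta> -` N' \<inter> space borel) = {z \<in> space lborel. \<theta> z \<notin> N'}" by auto
    ultimately show "{z \<in> space (lborel \<Otimes>\<^sub>M lborel). \<theta> z \<notin> N'} \<in> sets (lborel \<Otimes>\<^sub>M lborel)"
      unfolding lborel_prod by simp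
    have "AE x in lborel. \<theta> (t, x) \<notin> N'" for t
    proof -
      have "AE x in lborel. b (c t) + a (c t) * x \<notin> N'"
      proof (rule AE_borel_affine[of "a (c t)" "\<lambda>x. x \<notin> N'"])
        show "a (c t) \<noteq> 0" using a(2)[OF c(1)] by (simp add: less_imp_neq[symmetric])
        show "Measurable.pred borel (\<lambda>x. x \<notin> N')" using N'b by simp
        show "AE x in lborel. x \<notin> N'" using N'(1) by (rule AE_not_in)
      qed
      then show ?thesis by (simp add: \<theta>_def)
    qed
    then show "AE t in lborel. AE x in lborel. \<theta> (t, x) \<notin> N'" by simp
  qed
  then have "AE z in lebesgue. \<theta> z \<notin> N'" unfolding lborel_prod by (rule AE_completion)
  then have "AE z in lebesgue. z \<in> space_time T \<longrightarrow> a (fst z) * snd z + b (fst z) \<notin> N"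
  proof eventually_elim
    case (elim z)
    show ?case
    proof
      assume "z \<in> space_time T"
      then have "c (fst z) = fst z" by (auto simp: c_def)
      then show "a (fst z) * snd z + b (fst z) \<notin> N"
        using elim N'(2) by (auto simp: \<theta>_def add.commute)
    qed
  qed
  then show ?thesis by (simp add: AE_restrict_space_iff open_Times)
qed

lemma closure_space_time: "T > 0 \<Longrightarrow> closure (space_time T) = {0..T} \<times> {0..1}"
  by (simp add: closure_Times)

lemma space_time_eq_box: "space_time T = box (0, 0) (T, 1)"
  by (auto simp: box_def Basis_prod_def)

lemma space_time_domain:
  assumes "T > 0"
  shows "open (space_time T)" "bounded (space_time T)" "convex (space_time T)" "space_time T \<noteq> {}"
  using assms by (auto simp: open_Times bounded_Times convex_Times)

text \<open>A solution of the reduced equation, together with the bound that Gronwall's inequality gives for it.\<close>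
locale extrusion_interface = extrusion_data +
  fixes l :: "real \<Rightarrow> real"
  assumes l_0: "l 0 = l0"
    and l_near: "\<And>t. t \<in> {0..T} \<Longrightarrow> \<bar>l t - le\<bar> \<le> A * \<epsilon>"
    and l_deriv: "\<And>t. t \<in> {0..T} \<Longrightarrow> (l has_real_derivative F (l t) (N t) (h (l t - M t))) (at t within {0..T})"
begin

lemma l_continuous: "continuous_on {0..T} l"
  using l_deriv by (rule DERIV_continuous_on)

lemma l_bounds: "t \<in> {0..T} \<Longrightarrow> 0 < l t \<and> l t < L"
  using l_near[of t] \<epsilon>_l by (auto simp: abs_le_iff)

definition speed :: "real \<Rightarrow> real" where "speed t = F (l t) (N t) (h (l t - M t))"

text \<open>A bound for the speed of the interface; \<open>A \<epsilon>\<close> bounds its displacement.\<close>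
definition V :: real where "V = \<Lambda> * (A + 2) * \<epsilon>"

lemma V: "0 < V" "2 * V < \<zeta> * Ne"
  using \<Lambda> \<epsilon> \<epsilon>_speed by (simp_all add: V_def add_pos_pos mult.assoc)

lemma speed_le_V:
  assumes t: "t \<in> {0..T}" shows "\<bar>speed t\<bar> \<le> V"
proof -
  have "\<bar>speed t\<bar> \<le> \<Lambda> * (\<bar>l t - le\<bar> + 2 * \<epsilon>)"
    unfolding speed_def using speed_bound[OF t] l_bounds[OF t] by simp
  also have "\<dots> \<le> \<Lambda> * (A * \<epsilon> + 2 * \<epsilon>)" using \<Lambda> l_near[OF t] by (intro mult_left_mono) auto
  also have "\<dots> = V" by (simp add: V_def algebra_simps)
  finally show ?thesis .
qed

lemma speed_continuous: "continuous_on {0..T} speed"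
proof -
  have "continuous_on {0..T} (\<lambda>t. h (l t - M t))"
    by (intro continuous_on_compose2[OF h_continuous[of UNIV]] continuous_intros l_continuous M_continuous) auto
  then show ?thesis
    unfolding speed_def[abs_def] using l_bounds h_le
    by (intro continuous_on_interface_speed l_continuous N_continuous) (auto intro: less_imp_le)
qed

lemma l_lipschitz: "V-lipschitz_on {0..T} l"
proof (rule lipschitz_onI)
  fix x y assume "x \<in> {0..T}" "y \<in> {0..T}"
  then have "norm (l x - l y) \<le> V * norm (x - y)"
    by (intro field_differentiable_bound[of "{0..T}" l speed V x y])
       (use l_deriv speed_le_V in \<open>auto simp: speed_def\<close>)
  then show "dist (l x) (l y) \<le> V * dist x y" by (simp add: dist_norm)
qed (use V in simp)

lemma l_deriv_at: "t \<in> {0<..<T} \<Longrightarrow> (l has_real_derivative speed t) (at t)"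
  using l_deriv[of t] at_within_Icc_at[of 0 t T] by (simp add: speed_def)

lemma M_deriv_at: "t \<in> {0<..<T} \<Longrightarrow> (M has_real_derivative \<zeta> * N t) (at t)"
  using M_deriv[of t] at_within_Icc_at[of 0 t T] by simp

definition f :: "real \<times> real \<Rightarrow> real" where "f z = h (l (fst z) * snd z - M (fst z))"

definition lip_f :: real where "lip_f = \<epsilon> * H * (L + 3 * (\<zeta> * Ne))"

lemma lip_f_pos: "lip_f > 0"
  using \<epsilon> H_pos pos eq_range by (simp add: lip_f_def add_pos_pos)

lemma f_lipschitz: "lip_f-lipschitz_on ({0..T} \<times> {0..1}) f"
proof (rule lipschitz_onI)
  fix z w :: "real \<times> real"
  assume "z \<in> {0..T} \<times> {0..1}" "w \<in> {0..T} \<times> {0..1}"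
  then obtain t x s y where zw: "z = (t, x)" "w = (s, y)" "t \<in> {0..T}" "x \<in> {0..1}" "s \<in> {0..T}" "y \<in> {0..1}"
    by auto
  let ?d = "dist z w"
  have d: "\<bar>t - s\<bar> \<le> ?d" "\<bar>x - y\<bar> \<le> ?d"
    using dist_fst_le[of z w] dist_snd_le[of z w] by (auto simp: zw dist_real_def)
  have "\<bar>(l t * x - M t) - (l s * y - M s)\<bar> = \<bar>l t * (x - y) + (l t - l s) * y - (M t - M s)\<bar>"
    by (simp add: algebra_simps)
  also have "\<dots> \<le> \<bar>l t\<bar> * \<bar>x - y\<bar> + \<bar>l t - l s\<bar> * \<bar>y\<bar> + \<bar>M t - M s\<bar>"
    unfolding abs_mult[symmetric] by linarith
  also have "\<dots> \<le> L * ?d + (\<zeta> * Ne * ?d) * 1 + 2 * \<zeta> * Ne * ?d"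
  proof (intro add_mono mult_mono)
    show "\<bar>l t\<bar> \<le> L" using l_bounds[OF zw(3)] by simp
    have "\<bar>l t - l s\<bar> \<le> V * \<bar>t - s\<bar>"
      using lipschitz_onD[OF l_lipschitz zw(3,5)] by (simp add: dist_real_def)
    also have "\<dots> \<le> \<zeta> * Ne * ?d" using V d by (intro mult_mono) auto
    finally show "\<bar>l t - l s\<bar> \<le> \<zeta> * Ne * ?d" .
    have "\<bar>M t - M s\<bar> \<le> 2 * \<zeta> * Ne * \<bar>t - s\<bar>" by (rule M_lipschitz[OF zw(3,5)])
    also have "\<dots> \<le> 2 * \<zeta> * Ne * ?d" using pos eq_range d by (intro mult_left_mono) auto
    finally show "\<bar>M t - M s\<bar> \<le> 2 * \<zeta> * Ne * ?d" .
  qed (use zw d pos eq_range in auto)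
  also have "\<dots> = (L + 3 * (\<zeta> * Ne)) * ?d" by (simp add: algebra_simps)
  finally have "\<epsilon> * H * \<bar>(l t * x - M t) - (l s * y - M s)\<bar> \<le> \<epsilon> * H * ((L + 3 * (\<zeta> * Ne)) * ?d)"
    using \<epsilon> H_pos by (intro mult_left_mono) auto
  then have "\<bar>f z - f w\<bar> \<le> \<epsilon> * H * ((L + 3 * (\<zeta> * Ne)) * ?d)"
    using h_dist[of "l t * x - M t" "l s * y - M s"] unfolding f_def zw by simp
  then show "dist (f z) (f w) \<le> lip_f * ?d" by (simp add: lip_f_def dist_real_def mult.assoc)
qed (use lip_f_pos in simp)

lemma f_derivatives:
  assumes z: "(t, x) \<in> space_time T" and k: "(h has_real_derivative k) (at (l t * x - M t))"
  shows "((\<lambda>s. f ((t, x) + s *\<^sub>R (1, 0))) has_real_derivative k * (speed t * x - \<zeta> * N t)) (at 0)"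
    "((\<lambda>s. f ((t, x) + s *\<^sub>R (0, 1))) has_real_derivative k * l t) (at 0)"
proof -
  have t: "t \<in> {0<..<T}" using z by auto
  have sh: "((\<lambda>s. g (t + s)) has_real_derivative d) (at 0)" if "(g has_real_derivative d) (at t)" for g :: "real \<Rightarrow> real" and d
    using that DERIV_shift[of g d 0 t] by (simp add: add.commute)
  have "((\<lambda>s. l (t + s) * x - M (t + s)) has_real_derivative speed t * x - \<zeta> * N t) (at 0)"
    by (intro derivative_intros DERIV_cmult_right sh l_deriv_at M_deriv_at t)
  then have "((\<lambda>s. h (l (t + s) * x - M (t + s))) has_real_derivative k * (speed t * x - \<zeta> * N t)) (at 0)"
    by (intro DERIV_chain2[of h]) (use k in auto)
  then show "((\<lambda>s. f ((t, x) + s *\<^sub>R (1, 0))) has_real_derivative k * (speed t * x - \<zeta> * N t)) (at 0)"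
    by (simp add: f_def)
  have "((\<lambda>s. l t * (x + s) - M t) has_real_derivative l t) (at 0)"
    by (auto intro!: derivative_eq_intros)
  then have "((\<lambda>s. h (l t * (x + s) - M t)) has_real_derivative k * l t) (at 0)"
    by (intro DERIV_chain2[of h]) (use k in auto)
  then show "((\<lambda>s. f ((t, x) + s *\<^sub>R (0, 1))) has_real_derivative k * l t) (at 0)"
    by (simp add: f_def)
qed

text \<open>The chain rule holds at every point whose label is a point of differentiability of \<open>h\<close>, and almost every point is of
that kind. Both partial derivatives are multiples of the same value of \<open>h'\<close>, which gives the last identity: the
transport equation multiplied by \<open>l\<close>. Constants are subtracted from \<open>f\<close> because the estimate concerns \<open>f - fpe\<close>.\<close>
lemma f_weak_partials:
  obtains gt gx where "gt \<in> borel_measurable (lebesgue_on (space_time T))" "gx \<in> borel_measurable (lebesgue_on (space_time T))"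
    "\<And>a. has_weak_partial (space_time T) (1, 0) (\<lambda>z. f z - a) gt" "\<And>a. has_weak_partial (space_time T) (0, 1) (\<lambda>z. f z - a) gx"
    "AE z in lebesgue_on (space_time T). \<bar>gt z\<bar> \<le> lip_f" "AE z in lebesgue_on (space_time T). \<bar>gx z\<bar> \<le> lip_f"
    "\<And>t x. (t, x) \<in> space_time T \<Longrightarrow> l t * gt (t, x) + (\<zeta> * N t - x * speed t) * gx (t, x) = 0"
proof -
  let ?\<Omega> = "space_time T"
  obtain k Nk where k: "k \<in> borel_measurable borel" and Nk: "negligible Nk"
    and dk: "\<And>s. s \<notin> Nk \<Longrightarrow> (h has_real_derivative k s) (at s)"
    using lipschitz_real_density[OF h_lipschitz] by metis
  define \<theta> where "\<theta> z = l (fst z) * snd z - M (fst z)" for z :: "real \<times> real"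
  define gt where "gt z = k (\<theta> z) * (speed (fst z) * snd z - \<zeta> * N (fst z))" for z
  define gx where "gx z = k (\<theta> z) * l (fst z)" for z
  have c: "continuous_on ?\<Omega> (\<lambda>z. g (fst z))" if "continuous_on {0..T} g" for g :: "real \<Rightarrow> real"
    by (rule continuous_on_compose2[OF that]) (auto intro!: continuous_intros)
  have meas: "g \<in> borel_measurable (lebesgue_on ?\<Omega>)" if "continuous_on ?\<Omega> g" for g :: "real \<times> real \<Rightarrow> real"
    using that by (intro continuous_imp_measurable_on_sets_lebesgue) (auto simp: open_Times)
  have \<theta>m: "\<theta> \<in> borel_measurable (lebesgue_on ?\<Omega>)"
    unfolding \<theta>_def by (intro meas continuous_intros c l_continuous M_continuous)
  have km: "(\<lambda>z. k (\<theta> z)) \<in> borel_measurable (lebesgue_on ?\<Omega>)"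
    using measurable_compose[OF \<theta>m k] .
  have gtm: "gt \<in> borel_measurable (lebesgue_on ?\<Omega>)"
    unfolding gt_def
    by (intro borel_measurable_times km meas continuous_intros c N_continuous speed_continuous)
  have gxm: "gx \<in> borel_measurable (lebesgue_on ?\<Omega>)"
    unfolding gx_def by (intro borel_measurable_times km meas continuous_intros c l_continuous)
  have "AE z in lebesgue_on ?\<Omega>. l (fst z) * snd z + (- M (fst z)) \<notin> Nk"
    using T l_bounds Nk by (intro AE_affine_fibre_avoids_negligible l_continuous continuous_intros M_continuous) auto
  then have av: "AE z in lebesgue_on ?\<Omega>. \<theta> z \<notin> Nk" by (simp add: \<theta>_def)
  have lim: "AE z in lebesgue_on ?\<Omega>. (\<lambda>n. real n * ((f (z + v /\<^sub>R real n) - a) - (f z - a))) \<longlonglongrightarrow> g z"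
    if "\<And>z. z \<in> ?\<Omega> \<Longrightarrow> \<theta> z \<notin> Nk \<Longrightarrow> ((\<lambda>s. f (z + s *\<^sub>R v)) has_real_derivative g z) (at 0)" for v a g
    using av AE_space
  proof eventually_elim
    case (elim z)
    then have "z \<in> ?\<Omega>" by simp
    from sequential_difference_quotient[OF that[OF this elim(1)]] show ?case by simp
  qed
  have wp: "has_weak_partial ?\<Omega> v (\<lambda>z. f z - a) g" "AE z in lebesgue_on ?\<Omega>. \<bar>g z\<bar> \<le> lip_f * norm v"
    if "g \<in> borel_measurable (lebesgue_on ?\<Omega>)"
      "\<And>z. z \<in> ?\<Omega> \<Longrightarrow> \<theta> z \<notin> Nk \<Longrightarrow> ((\<lambda>s. f (z + s *\<^sub>R v)) has_real_derivative g z) (at 0)" for v a g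
  proof -
    have "lip_f-lipschitz_on (closure ?\<Omega>) (\<lambda>z. f z - a)"
      using f_lipschitz unfolding closure_space_time[OF T] lipschitz_on_def by (simp add: dist_real_def)
    note has_weak_partial_lipschitz_convex[OF space_time_domain(1,3,4)[OF T] this that(1) lim[OF that(2)]]
    then show "has_weak_partial ?\<Omega> v (\<lambda>z. f z - a) g" "AE z in lebesgue_on ?\<Omega>. \<bar>g z\<bar> \<le> lip_f * norm v" by auto
  qed
  have dgt: "((\<lambda>s. f (z + s *\<^sub>R (1, 0))) has_real_derivative gt z) (at 0)" if "z \<in> ?\<Omega>" "\<theta> z \<notin> Nk" for z
  proof (cases z)
    case (Pair t x)
    then show ?thesis using f_derivatives(1)[of t x "k (\<theta> z)"] that dk[OF that(2)] by (simp add: gt_def \<theta>_def)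
  qed
  have dgx: "((\<lambda>s. f (z + s *\<^sub>R (0, 1))) has_real_derivative gx z) (at 0)" if "z \<in> ?\<Omega>" "\<theta> z \<notin> Nk" for z
  proof (cases z)
    case (Pair t x)
    then show ?thesis using f_derivatives(2)[of t x "k (\<theta> z)"] that dk[OF that(2)] by (simp add: gx_def \<theta>_def)
  qed
  show ?thesis
  proof (rule that[of gt gx])
    show "has_weak_partial ?\<Omega> (1, 0) (\<lambda>z. f z - a) gt" for a by (rule wp(1)[OF gtm dgt])
    show "has_weak_partial ?\<Omega> (0, 1) (\<lambda>z. f z - a) gx" for a by (rule wp(1)[OF gxm dgx])
    show "AE z in lebesgue_on ?\<Omega>. \<bar>gt z\<bar> \<le> lip_f" using wp(2)[OF gtm dgt] by (simp add: norm_Pair)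
    show "AE z in lebesgue_on ?\<Omega>. \<bar>gx z\<bar> \<le> lip_f" using wp(2)[OF gxm dgx] by (simp add: norm_Pair)
    show "l t * gt (t, x) + (\<zeta> * N t - x * speed t) * gx (t, x) = 0" for t x
      by (simp add: gt_def gx_def algebra_simps)
  qed (use gtm gxm in auto)
qed

lemma l_weak_derivative: "has_weak_partial {0<..<T} 1 (\<lambda>t. l t - a) speed"
proof (rule has_weak_partial_lipschitz_convex(1)[where K = V])
  show "V-lipschitz_on (closure {0<..<T}) (\<lambda>t. l t - a)"
    using l_lipschitz T unfolding lipschitz_on_def by (simp add: dist_real_def)
  show "speed \<in> borel_measurable (lebesgue_on {0<..<T})"
    using speed_continuous by (intro continuous_imp_measurable_on_sets_lebesgue) (auto intro: continuous_on_subset)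
  show "AE t in lebesgue_on {0<..<T}. (\<lambda>n. real n * ((l (t + 1 /\<^sub>R real n) - a) - (l t - a))) \<longlonglongrightarrow> speed t"
  proof (intro AE_I2)
    fix t assume "t \<in> space (lebesgue_on {0<..<T})"
    then have "(l has_real_derivative speed t) (at t)" by (intro l_deriv_at) simp
    then have "((\<lambda>s. l (t + s *\<^sub>R 1)) has_real_derivative speed t) (at 0)"
      using DERIV_shift[of l "speed t" 0 t] by (simp add: add.commute)
    from sequential_difference_quotient[OF this]
    show "(\<lambda>n. real n * ((l (t + 1 /\<^sub>R real n) - a) - (l t - a))) \<longlonglongrightarrow> speed t" by simp
  qed
qed (use T in auto)

lemma l_W1inf:
  "(\<lambda>t. l t - a) \<in> W1inf {0<..<T}"
  "W1inf_norm {0<..<T} (\<lambda>t. l t - le) \<le> ereal (A * \<epsilon> + V)"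
proof -
  have m: "(\<lambda>t. l t - a) \<in> borel_measurable (lebesgue_on {0<..<T})" for a
    using l_continuous by (intro continuous_imp_measurable_on_sets_lebesgue continuous_intros) (auto intro: continuous_on_subset)
  have sm: "speed \<in> borel_measurable (lebesgue_on {0<..<T})"
    using speed_continuous by (intro continuous_imp_measurable_on_sets_lebesgue) (auto intro: continuous_on_subset)
  have sV: "AE t in lebesgue_on {0<..<T}. \<bar>speed t\<bar> \<le> V" using speed_le_V by (intro AE_I2) auto
  have "AE t in lebesgue_on {0<..<T}. \<bar>l t - a\<bar> \<le> L + \<bar>a\<bar>"
  proof (intro AE_I2)
    fix t assume "t \<in> space (lebesgue_on {0<..<T})"
    then show "\<bar>l t - a\<bar> \<le> L + \<bar>a\<bar>" using l_bounds[of t] by auto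
  qed
  then show "(\<lambda>t. l t - a) \<in> W1inf {0<..<T}"
    using W1inf_norm_le(1)[OF _ _ m _, of a "L + \<bar>a\<bar>" "\<lambda>_. speed" "\<lambda>_. V"] sm sV l_weak_derivative by simp
  have "AE t in lebesgue_on {0<..<T}. \<bar>l t - le\<bar> \<le> A * \<epsilon>" using l_near by (intro AE_I2) auto
  then show "W1inf_norm {0<..<T} (\<lambda>t. l t - le) \<le> ereal (A * \<epsilon> + V)"
    using W1inf_norm_le(2)[OF _ _ m _, of le "A * \<epsilon>" "\<lambda>_. speed" "\<lambda>_. V"] sm sV l_weak_derivative by simp
qed

lemma f_W1inf:
  "(\<lambda>z. f z - a) \<in> W1inf (space_time T)"
  "W1inf_norm (space_time T) (\<lambda>z. f z - fpe) \<le> ereal (\<epsilon> + 2 * lip_f)"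
proof -
  let ?\<Omega> = "space_time T"
  from f_weak_partials obtain gt gx where g: "gt \<in> borel_measurable (lebesgue_on ?\<Omega>)" "gx \<in> borel_measurable (lebesgue_on ?\<Omega>)"
    "\<And>a. has_weak_partial ?\<Omega> (1, 0) (\<lambda>z. f z - a) gt" "\<And>a. has_weak_partial ?\<Omega> (0, 1) (\<lambda>z. f z - a) gx"
    "AE z in lebesgue_on ?\<Omega>. \<bar>gt z\<bar> \<le> lip_f" "AE z in lebesgue_on ?\<Omega>. \<bar>gx z\<bar> \<le> lip_f" by metis
  define g where "g b = (if b = (1, 0) then gt else gx)" for b :: "real \<times> real"
  have B: "b = (1, 0) \<or> b = (0, 1)" if "b \<in> Basis" for b :: "real \<times> real"
    using that by (auto simp: Basis_prod_def)
  have gb: "g b \<in> borel_measurable (lebesgue_on ?\<Omega>)" "AE z in lebesgue_on ?\<Omega>. \<bar>g b z\<bar> \<le> lip_f"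
    "has_weak_partial ?\<Omega> b (\<lambda>z. f z - a) (g b)" if "b \<in> Basis" for b a
    using B[OF that] g by (auto simp: g_def)
  have fm: "(\<lambda>z. f z - a) \<in> borel_measurable (lebesgue_on ?\<Omega>)" for a
  proof (rule continuous_imp_measurable_on_sets_lebesgue)
    show "continuous_on ?\<Omega> (\<lambda>z. f z - a)"
      by (intro continuous_intros continuous_on_subset[OF lipschitz_on_continuous_on[OF f_lipschitz]]) auto
  qed (auto simp: open_Times)
  have "AE z in lebesgue_on ?\<Omega>. \<bar>f z - a\<bar> \<le> 1 + \<bar>a\<bar>"
  proof (intro AE_I2)
    fix z
    have "0 < f z" "f z < 1" using h_le unfolding f_def by auto
    then show "\<bar>f z - a\<bar> \<le> 1 + \<bar>a\<bar>" by auto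
  qed
  from W1inf_norm_le(1)[OF space_time_domain(1,2)[OF T] fm this gb]
  show "(\<lambda>z. f z - a) \<in> W1inf ?\<Omega>" by blast
  have "AE z in lebesgue_on ?\<Omega>. \<bar>f z - fpe\<bar> \<le> \<epsilon>" using h_range by (intro AE_I2) (auto simp: f_def)
  from W1inf_norm_le(2)[OF space_time_domain(1,2)[OF T] fm this gb]
  show "W1inf_norm ?\<Omega> (\<lambda>z. f z - fpe) \<le> ereal (\<epsilon> + 2 * lip_f)" by simp
qed

lemma solution: "is_solution L \<zeta> \<rho> Veff Seff B Kd T l0 f0 Fin N l f"
proof -
  let ?\<Omega> = "space_time T"
  have "l \<in> W1inf_lip {0<..<T}"
    using l_W1inf(1)[of 0] l_lipschitz T by (auto simp: W1inf_lip_def)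
  moreover have "f \<in> W1inf_lip ?\<Omega>"
    using f_W1inf(1)[of 0] f_lipschitz by (auto simp: W1inf_lip_def closure_space_time[OF T])
  moreover have "\<forall>t\<in>{0<..<T}. l t \<in> {0<..<L} \<and> f (t, 1) \<in> {0<..<1}"
    using l_bounds h_le by (auto simp: f_def)
  moreover have "AE t in lebesgue_on {0<..<T}. weak_partial {0<..<T} 1 l t = F (l t) (N t) (f (t, 1))"
  proof -
    have "speed \<in> borel_measurable (lebesgue_on {0<..<T})"
      using speed_continuous by (intro continuous_imp_measurable_on_sets_lebesgue) (auto intro: continuous_on_subset)
    then have "speed \<in> Linf {0<..<T}"
      by (rule LinfI[where C = V]) (use speed_le_V in \<open>auto intro!: AE_I2\<close>)
    then have "AE t in lebesgue_on {0<..<T}. weak_partial {0<..<T} 1 l t = speed t"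
      using l_weak_derivative[of 0] by (intro weak_partial_eq_AE) auto
    then show ?thesis by (simp add: speed_def f_def)
  qed
  moreover have "AE (t, x) in lebesgue_on ?\<Omega>. weak_partial ?\<Omega> (1, 0) f (t, x)
        + alpha_p L \<zeta> \<rho> Veff Seff B Kd x (N t) (l t) (f (t, 1)) * weak_partial ?\<Omega> (0, 1) f (t, x) = 0"
  proof -
    from f_weak_partials obtain gt gx where g: "gt \<in> borel_measurable (lebesgue_on ?\<Omega>)" "gx \<in> borel_measurable (lebesgue_on ?\<Omega>)"
      "\<And>a. has_weak_partial ?\<Omega> (1, 0) (\<lambda>z. f z - a) gt" "\<And>a. has_weak_partial ?\<Omega> (0, 1) (\<lambda>z. f z - a) gx"
      "AE z in lebesgue_on ?\<Omega>. \<bar>gt z\<bar> \<le> lip_f" "AE z in lebesgue_on ?\<Omega>. \<bar>gx z\<bar> \<le> lip_f"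
      "\<And>t x. (t, x) \<in> ?\<Omega> \<Longrightarrow> l t * gt (t, x) + (\<zeta> * N t - x * speed t) * gx (t, x) = 0" by metis
    have "AE z in lebesgue_on ?\<Omega>. weak_partial ?\<Omega> (1, 0) f z = gt z"
      using g(3)[of 0] LinfI[OF g(1,5)] by (intro weak_partial_eq_AE space_time_domain T) auto
    moreover have "AE z in lebesgue_on ?\<Omega>. weak_partial ?\<Omega> (0, 1) f z = gx z"
      using g(4)[of 0] LinfI[OF g(2,6)] by (intro weak_partial_eq_AE space_time_domain T) auto
    ultimately show ?thesis using AE_space
    proof eventually_elim
      case (elim z)
      obtain t x where z: "z = (t, x)" by (cases z)
      have tx: "(t, x) \<in> ?\<Omega>" using elim(3) z by simp
      then have "l t > 0" using l_bounds[of t] by auto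
      have "alpha_p L \<zeta> \<rho> Veff Seff B Kd x (N t) (l t) (f (t, 1)) = (\<zeta> * N t - x * speed t) / l t"
        by (simp add: alpha_p_def speed_def f_def)
      moreover have "gt (t, x) + (\<zeta> * N t - x * speed t) / l t * gx (t, x)
          = (l t * gt (t, x) + (\<zeta> * N t - x * speed t) * gx (t, x)) / l t"
        using \<open>l t > 0\<close> by (simp add: field_simps)
      ultimately show ?case using g(7)[OF tx] elim(1,2) by (simp add: z)
    qed
  qed
  moreover have "\<forall>x\<in>{0<..<1}. f (0, x) = f0 x" using h_initial by (simp add: f_def l_0)
  moreover have "\<forall>t\<in>{0<..<T}. f (t, 0) = Fin t / (\<rho> * Veff * N t)"
    using h_inflow by (simp add: f_def q_def)
  ultimately show ?thesis unfolding is_solution_def using l_0 by blast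
qed

end

section \<open>Uniqueness\<close>

context extrusion_interface
begin

context
  fixes m :: "real \<Rightarrow> real" and g :: "real \<times> real \<Rightarrow> real"
  assumes sol: "is_solution L \<zeta> \<rho> Veff Seff B Kd T l0 f0 Fin N m g"
begin

definition front_speed :: "real \<Rightarrow> real" where "front_speed t = F (m t) (N t) (g (t, 1))"

lemma m_continuous: "continuous_on {0..T} m"
  and g_continuous: "continuous_on ({0..T} \<times> {0..1}) g"
  using sol T unfolding is_solution_def W1inf_lip_def closure_space_time[OF T]
  by (auto intro: lipschitz_on_continuous_on)

lemma m_range: "t \<in> {0..<T} \<Longrightarrow> 0 < m t \<and> m t < L"
  using sol l0_bounds unfolding is_solution_def by (cases "t = 0") auto

lemma m_0: "m 0 = l0"
  using sol by (simp add: is_solution_def)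

lemma g_initial: assumes x: "x \<in> {0..1}" shows "g (0, x) = f0 x"
proof -
  have c: "continuous_on {0..1} (\<lambda>x. g (0, x) - f0 x)"
    using T by (intro continuous_intros continuous_on_compose2[OF g_continuous] lipschitz_on_continuous_on[OF f0(1)]) auto
  have "g (0, x) - f0 x = 0"
    by (rule continuous_constant_on_closure[of "{0<..<1}"])
       (use sol c x in \<open>auto simp: is_solution_def\<close>)
  then show ?thesis by simp
qed

lemma g_inflow: "t \<in> {0<..<T} \<Longrightarrow> g (t, 0) = q t"
  using sol unfolding is_solution_def q_def by blast

lemma g_outflow_less_1: "t \<in> {0..<T} \<Longrightarrow> g (t, 1) < 1"
  using sol h_initial[of 1] h_le(3)[of l0] g_initial[of 1] unfolding is_solution_def by (cases "t = 0") auto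

lemma front_speed_continuous: "continuous_on {0..<T} front_speed"
  unfolding front_speed_def
proof (rule continuous_on_interface_speed)
  show "continuous_on {0..<T} m" by (rule continuous_on_subset[OF m_continuous]) auto
  show "continuous_on {0..<T} N" by (rule continuous_on_subset[OF N_continuous]) auto
  show "continuous_on {0..<T} (\<lambda>t. g (t, 1))"
    by (rule continuous_on_compose2[OF g_continuous]) (auto intro!: continuous_intros)
qed (use m_range g_outflow_less_1 in \<open>auto intro: less_imp_le\<close>)

text \<open>The speed in the equation for \<open>m\<close> is continuous in time, so the equation holds classically at every time.\<close>
lemma m_deriv: assumes t: "t \<in> {0<..<T}" shows "(m has_real_derivative front_speed t) (at t)"
proof -
  obtain K where "K-lipschitz_on {0..T} m"
    using sol T by (auto simp: is_solution_def W1inf_lip_def)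
  moreover have "AE t in lebesgue_on {0<..<T}. weak_partial {0<..<T} 1 m t = front_speed t"
    using sol unfolding is_solution_def front_speed_def by blast
  moreover have "continuous_on {0<..<T} front_speed" by (rule continuous_on_subset[OF front_speed_continuous]) auto
  ultimately show ?thesis using weak_partial_continuous_imp_derivative[OF T] t by blast
qed

text \<open>The curves \<open>t \<mapsto> (t, (s + M t) / m t)\<close> are the characteristics because \<open>m\<close> moves with its own speed.\<close>
lemma g_constant_along_characteristic:
  assumes t: "0 < t1" "t1 \<le> t2" "t2 < T"
    and s: "\<And>t. t \<in> {t1..t2} \<Longrightarrow> 0 < s + M t \<and> s + M t < m t"
  shows "g (t2, (s + M t2) / m t2) = g (t1, (s + M t1) / m t1)"
proof -
  let ?\<Omega> = "space_time T"
  define a where "a z = alpha_p L \<zeta> \<rho> Veff Seff B Kd (snd z) (N (fst z)) (m (fst z)) (g (fst z, 1))" for z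
  have a_eq: "a z = (1 / m (fst z)) * (\<zeta> * N (fst z) - snd z * front_speed (fst z))" for z
    by (simp add: a_def alpha_p_def front_speed_def)
  have W: "g \<in> W1inf ?\<Omega>" using sol by (simp add: is_solution_def W1inf_lip_def)
  have "(1, 0) \<in> (Basis :: (real \<times> real) set)" "(0, 1) \<in> (Basis :: (real \<times> real) set)"
    by (auto simp: Basis_prod_def)
  note wt = W1inf_weak_partial[OF W this(1)] and wx = W1inf_weak_partial[OF W this(2)]
  obtain K where K: "K-lipschitz_on (cbox (0, 0) (T, 1)) g"
    using sol T by (auto simp: is_solution_def W1inf_lip_def closure_space_time cbox_Pair_eq)
  have c: "continuous_on ?\<Omega> (\<lambda>z. u (fst z))" if "continuous_on {0..<T} u" for u :: "real \<Rightarrow> real"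
    by (rule continuous_on_compose2[OF that]) (auto intro!: continuous_intros)
  have ca: "continuous_on ?\<Omega> a"
    unfolding a_eq
  proof (intro continuous_intros c front_speed_continuous)
    show "continuous_on {0..<T} m" by (rule continuous_on_subset[OF m_continuous]) auto
    show "continuous_on {0..<T} N" by (rule continuous_on_subset[OF N_continuous]) auto
    show "\<forall>z\<in>?\<Omega>. m (fst z) \<noteq> 0"
    proof
      fix z assume "z \<in> ?\<Omega>"
      then show "m (fst z) \<noteq> 0" using m_range[of "fst z"] by auto
    qed
  qed
  have ae: "AE z in lebesgue_on ?\<Omega>. weak_partial ?\<Omega> (1, 0) g z + a z * weak_partial ?\<Omega> (0, 1) g z = 0"
    using sol unfolding is_solution_def a_def by (simp add: case_prod_unfold)
  have der: "((\<lambda>t. (t, (s + M t) / m t)) has_vector_derivative ((1, 0) + a (t, (s + M t) / m t) *\<^sub>R (0, 1))) (at t within {t1..t2})"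
    if t': "t \<in> {t1..t2}" for t
  proof -
    have tT: "t \<in> {0<..<T}" using t t' by auto
    have mp: "m t > 0" using m_range[of t] tT by auto
    have "((\<lambda>t. (s + M t) / m t) has_real_derivative (\<zeta> * N t * m t - (s + M t) * front_speed t) / (m t * m t)) (at t)"
      using mp by (auto intro!: derivative_eq_intros M_deriv_at[OF tT] m_deriv[OF tT])
    also have "(\<zeta> * N t * m t - (s + M t) * front_speed t) / (m t * m t) = a (t, (s + M t) / m t)"
      using mp by (simp add: a_eq field_simps)
    finally have "((\<lambda>t. (s + M t) / m t) has_vector_derivative a (t, (s + M t) / m t)) (at t within {t1..t2})"
      unfolding has_real_derivative_iff_has_vector_derivative by (rule has_vector_derivative_at_within)
    moreover have "((\<lambda>t. t) has_vector_derivative 1) (at t within {t1..t2})" by (rule has_vector_derivative_id)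
    ultimately have "((\<lambda>t. (t, (s + M t) / m t)) has_vector_derivative (1, a (t, (s + M t) / m t))) (at t within {t1..t2})"
      by (intro has_vector_derivative_Pair)
    then show ?thesis by simp
  qed
  have inside: "(t, (s + M t) / m t) \<in> ?\<Omega>" if t': "t \<in> {t1..t2}" for t
  proof -
    have "m t > 0" using s[OF t'] by linarith
    then show ?thesis using s[OF t'] t t' by simp
  qed
  show ?thesis
    by (rule transport_constant_along_characteristics[OF K,
          where c = "\<lambda>t. (t, (s + M t) / m t)" and a = a, folded space_time_eq_box])
       (fact wt wx ca ae t(2) inside der)+
qed

text \<open>The condition says that up to \<open>t0\<close> the end \<open>x = 1\<close> is an outflow boundary for \<open>g\<close>.\<close>
context
  fixes t0 :: real
  assumes t0: "0 < t0" "t0 < T" and outflow: "\<And>t. t \<in> {0<..<t0} \<Longrightarrow> front_speed t < \<zeta> * N t"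
begin

lemma m_minus_M_decreasing:
  assumes "0 \<le> a" "a \<le> b" "b \<le> t0" shows "m b - M b \<le> m a - M a"
proof -
  have "m b - M b \<le> exp (0 * (b - a)) * (m a - M a)"
  proof (rule gronwall_derivative[where w' = "\<lambda>t. front_speed t - \<zeta> * N t"])
    show "continuous_on {a..b} (\<lambda>t. m t - M t)"
      using assms t0
      by (intro continuous_intros continuous_on_subset[OF m_continuous] continuous_on_subset[OF M_continuous]) auto
    fix t assume "a < t" "t < b"
    then have t: "t \<in> {0<..<t0}" "t \<in> {0<..<T}" using assms t0 by auto
    show "((\<lambda>t. m t - M t) has_real_derivative front_speed t - \<zeta> * N t) (at t)"
      by (intro derivative_intros m_deriv M_deriv_at t)
    show "front_speed t - \<zeta> * N t \<le> 0 * (m t - M t)" using outflow[OF t(1)] by simp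
  qed (use assms in auto)
  then show ?thesis by simp
qed

text \<open>A characteristic that is followed backwards stays in \<open>x < 1\<close> because \<open>m - M\<close> is decreasing. It is inside the domain
for all times after \<open>r\<close>; the value at \<open>r\<close>, where it may touch the boundary, is reached by continuity.\<close>
lemma g_traced_back:
  assumes t: "0 \<le> r" "r < t" "t \<le> t0" and x: "0 < x" "x < 1" and r: "0 \<le> m t * x - M t + M r"
  shows "g (t, x) = g (r, (m t * x - M t + M r) / m r)" "m t * x - M t + M r \<le> m r"
proof -
  define s where "s = m t * x - M t"
  have mp: "0 < m u" if "u \<in> {r..t}" for u using m_range[of u] t t0 that by auto
  have lt: "s + M u < m u" if "u \<in> {r..t}" for u
  proof -
    have "m t * x < m t * 1" using x mp[of t] t by (intro mult_strict_left_mono) auto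
    then show ?thesis using m_minus_M_decreasing[of u t] that t by (simp add: s_def)
  qed
  then show "m t * x - M t + M r \<le> m r" using t by (simp add: s_def less_imp_le)
  have gt: "0 \<le> s + M u" if "u \<in> {r..t}" for u
  proof -
    have "0 \<le> \<zeta> * Ne / 2 * (u - r)" using pos eq_range that by simp
    then have "M r \<le> M u" using M_diff(1)[of r u] that t t0 by auto
    then show ?thesis using r by (simp add: s_def)
  qed
  have gt': "0 < s + M u" if "u \<in> {r<..t}" for u
  proof -
    have "0 < \<zeta> * Ne / 2 * (u - r)" using pos eq_range that by simp
    then have "M r < M u" using M_diff(1)[of r u] that t t0 by auto
    then show ?thesis using r by (simp add: s_def)
  qed
  have sub: "{r..t} \<subseteq> {0..T}" using t t0 by auto
  have c: "continuous_on {r..t} (\<lambda>u. g (u, (s + M u) / m u))"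
  proof (rule continuous_on_compose2[OF g_continuous])
    show "continuous_on {r..t} (\<lambda>u. (u, (s + M u) / m u))"
      by (intro continuous_intros continuous_on_subset[OF m_continuous sub] continuous_on_subset[OF M_continuous sub])
         (use mp in \<open>auto simp: less_imp_neq[symmetric]\<close>)
    show "(\<lambda>u. (u, (s + M u) / m u)) ` {r..t} \<subseteq> {0..T} \<times> {0..1}"
    proof (rule image_subsetI)
      fix u assume u: "u \<in> {r..t}"
      show "(u, (s + M u) / m u) \<in> {0..T} \<times> {0..1}"
        using gt[OF u] lt[OF u] mp[OF u] u t t0 by (auto simp: divide_simps)
    qed
  qed
  have "g (r, (s + M r) / m r) = g (t, x)"
  proof (rule continuous_constant_on_closure[of "{r<..t}" "\<lambda>u. g (u, (s + M u) / m u)"])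
    show "continuous_on (closure {r<..t}) (\<lambda>u. g (u, (s + M u) / m u))" using c t by simp
    show "r \<in> closure {r<..t}" using t by simp
    fix u assume u: "u \<in> {r<..t}"
    have "g (t, (s + M t) / m t) = g (u, (s + M u) / m u)"
    proof (rule g_constant_along_characteristic)
      fix v assume "v \<in> {u..t}"
      then have "v \<in> {r<..t}" "v \<in> {r..t}" using u by auto
      then show "0 < s + M v \<and> s + M v < m v" using gt' lt by blast
    qed (use u t t0 in auto)
    moreover have "(s + M t) / m t = x" using mp[of t] t by (simp add: s_def)
    ultimately show "g (u, (s + M u) / m u) = g (t, x)" by simp
  qed
  then show "g (t, x) = g (r, (m t * x - M t + M r) / m r)" by (simp add: s_def)
qed

text \<open>Labels \<open>s \<ge> 0\<close> are traced back to the initial line, labels \<open>s < 0\<close> to the inflow boundary at the time \<open>\<tau>(- s)\<close>.\<close>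
lemma g_representation_interior:
  assumes t: "0 < t" "t \<le> t0" and x: "0 < x" "x < 1"
  shows "g (t, x) = h (m t * x - M t)"
proof (cases "0 \<le> m t * x - M t")
  case True
  then have le: "m t * x - M t \<le> l0" and eq: "g (t, x) = g (0, (m t * x - M t) / l0)"
    using g_traced_back[of 0 t x] t x m_0 by auto
  define y where "y = (m t * x - M t) / l0"
  have "y \<in> {0..1}" "m t * x - M t = l0 * y" using True le l0_bounds by (auto simp: y_def)
  then show ?thesis using eq g_initial[of y] h_initial[of y] l0_bounds by simp
next
  case False
  define r where "r = \<tau> (M t - m t * x)"
  have "m t * x > 0" using m_range[of t] t t0 x by simp
  then have "M t - m t * x \<le> M T" "M t - m t * x < M t" using M_range[of t] t t0 by auto
  then have r: "r \<in> {0..T}" "M r = M t - m t * x"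
    using False \<tau>[of "M t - m t * x"] by (auto simp: r_def)
  have "r \<noteq> 0" using r(2) False by auto
  moreover have "r < t"
  proof (rule ccontr)
    assume "\<not> r < t"
    then have "0 \<le> \<zeta> * Ne / 2 * (r - t)" using pos eq_range by simp
    then have "M t \<le> M r" using M_diff(1)[of t r] \<open>\<not> r < t\<close> t r by auto
    then show False using r(2) \<open>m t * x > 0\<close> by simp
  qed
  ultimately have "g (t, x) = g (r, 0)" "g (r, 0) = q r"
    using g_traced_back(1)[of r t x] g_inflow[of r] t t0 x r by auto
  then show ?thesis using h_inflow[OF r(1)] r(2) by simp
qed

lemma g_representation_outflow:
  assumes t: "0 < t" "t \<le> t0"
  shows "g (t, 1) = h (m t - M t)"
proof -
  have "g (t, 1) - h (m t * 1 - M t) = 0"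
  proof (rule continuous_constant_on_closure[of "{0<..<1}" "\<lambda>x. g (t, x) - h (m t * x - M t)"])
    have "continuous_on {0..1} (\<lambda>x. g (t, x))"
      using t t0 by (intro continuous_on_compose2[OF g_continuous] continuous_intros) auto
    moreover have "continuous_on {0..1} (\<lambda>x. h (m t * x - M t))"
      by (intro continuous_on_compose2[OF h_continuous[of UNIV]] continuous_intros) auto
    ultimately show "continuous_on (closure {0<..<1}) (\<lambda>x. g (t, x) - h (m t * x - M t))"
      by (simp add: continuous_on_diff)
  qed (use g_representation_interior t in auto)
  then show ?thesis by simp
qed

text \<open>By the representation of \<open>g\<close> at \<open>x = 1\<close>, \<open>m\<close> solves the reduced equation as well. Gronwall's inequality for
\<open>(m - l)\<^sup>2\<close> concludes.\<close>
lemma m_eq_l_upto: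
  assumes t: "0 \<le> t" "t \<le> t0" shows "m t = l t"
proof -
  have "(m t - l t)\<^sup>2 \<le> exp (2 * (\<Lambda> * (1 + \<epsilon> * H)) * (t - 0)) * (m 0 - l 0)\<^sup>2"
  proof (rule gronwall_derivative[where w' = "\<lambda>s. 2 * (m s - l s) * (front_speed s - speed s)"])
    show "continuous_on {0..t} (\<lambda>s. (m s - l s)\<^sup>2)"
      using t t0 by (intro continuous_intros continuous_on_subset[OF m_continuous] continuous_on_subset[OF l_continuous]) auto
    fix s assume s: "0 < s" "s < t"
    then have sT: "s \<in> {0<..<T}" using t t0 by auto
    show "((\<lambda>s. (m s - l s)\<^sup>2) has_real_derivative 2 * (m s - l s) * (front_speed s - speed s)) (at s)"
      by (auto intro!: derivative_eq_intros m_deriv[OF sT] l_deriv_at[OF sT])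
    have "\<bar>front_speed s - speed s\<bar> = \<bar>F (m s) (N s) (h (m s - M s)) - F (l s) (N s) (h (l s - M s))\<bar>"
      using g_representation_outflow[of s] s t by (simp add: front_speed_def speed_def)
    also have "\<dots> \<le> \<Lambda> * (\<bar>m s - l s\<bar> + \<epsilon> * H * \<bar>(m s - M s) - (l s - M s)\<bar>)"
      using sT m_range[of s] l_bounds[of s] by (intro speed_lipschitz) auto
    also have "\<dots> = \<Lambda> * (1 + \<epsilon> * H) * \<bar>m s - l s\<bar>" by (simp add: algebra_simps)
    finally have "\<bar>m s - l s\<bar> * \<bar>front_speed s - speed s\<bar> \<le> \<bar>m s - l s\<bar> * (\<Lambda> * (1 + \<epsilon> * H) * \<bar>m s - l s\<bar>)"
      by (rule mult_left_mono) simp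
    moreover have "(m s - l s) * (front_speed s - speed s) \<le> \<bar>m s - l s\<bar> * \<bar>front_speed s - speed s\<bar>"
      unfolding abs_mult[symmetric] by simp
    moreover have "\<bar>m s - l s\<bar> * (\<Lambda> * (1 + \<epsilon> * H) * \<bar>m s - l s\<bar>) = \<Lambda> * (1 + \<epsilon> * H) * (m s - l s)\<^sup>2"
    proof -
      have "\<bar>m s - l s\<bar> * (\<Lambda> * (1 + \<epsilon> * H) * \<bar>m s - l s\<bar>) = \<Lambda> * (1 + \<epsilon> * H) * (\<bar>m s - l s\<bar> * \<bar>m s - l s\<bar>)"
        by (simp only: ac_simps)
      then show ?thesis by (simp only: abs_mult_self_eq power2_eq_square)
    qed
    ultimately show "2 * (m s - l s) * (front_speed s - speed s) \<le> 2 * (\<Lambda> * (1 + \<epsilon> * H)) * (m s - l s)\<^sup>2" by linarith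
  qed (use t in auto)
  also have "m 0 = l 0" by (simp add: m_0 l_0)
  finally show ?thesis by simp
qed

lemma outflow_at_t0: "front_speed t0 < \<zeta> * N t0"
proof -
  have "front_speed t0 = speed t0"
    using g_representation_outflow[of t0] m_eq_l_upto[of t0] t0 by (simp add: front_speed_def speed_def)
  also have "\<dots> \<le> V" using speed_le_V[of t0] t0 by auto
  also have "\<dots> < \<zeta> * (Ne / 2)" using V by simp
  also have "\<dots> \<le> \<zeta> * N t0" using N_bounds[of t0] t0 pos by (intro mult_left_mono) auto
  finally show ?thesis .
qed

end

text \<open>Otherwise let \<open>t0\<close> be the first time at which the inequality fails; it is positive because the data are close to the
equilibrium. Up to \<open>t0\<close> both solutions agree, so at \<open>t0\<close> the speed is still bounded by \<open>V\<close>.\<close>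
lemma outflow_everywhere:
  assumes t: "t \<in> {0..<T}" shows "front_speed t < \<zeta> * N t"
proof (rule ccontr)
  assume neg: "\<not> front_speed t < \<zeta> * N t"
  define w where "w s = \<zeta> * N s - front_speed s" for s
  define Z where "Z = {s \<in> {0..t}. w s \<le> 0}"
  have "continuous_on {0..t} w"
    unfolding w_def using t
    by (intro continuous_intros continuous_on_subset[OF front_speed_continuous] continuous_on_subset[OF N_continuous]) auto
  then have "closed ({0..t} \<inter> w -` {..0})" by (intro continuous_closed_preimage) auto
  moreover have "{0..t} \<inter> w -` {..0} = Z" by (auto simp: Z_def)
  ultimately have "closed Z" by simp
  moreover have Zne: "Z \<noteq> {}" and Zb: "bdd_below Z" using neg t by (auto simp: Z_def w_def intro!: bdd_belowI[of _ 0])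
  ultimately have InfZ: "Inf Z \<in> Z" by (intro closed_contains_Inf)
  define t0 where "t0 = Inf Z"
  have before: "front_speed s < \<zeta> * N s" if "0 \<le> s" "s < t0" for s
  proof (rule ccontr)
    assume "\<not> front_speed s < \<zeta> * N s"
    then have "s \<in> Z" using that InfZ by (auto simp: Z_def w_def t0_def)
    then have "Inf Z \<le> s" by (rule cInf_lower[OF _ Zb])
    then show False using that by (simp add: t0_def)
  qed
  have z0: "t0 \<in> {0..t}" "w t0 \<le> 0" using InfZ by (auto simp: Z_def t0_def)
  have "t0 \<noteq> 0"
  proof
    assume "t0 = 0"
    have "front_speed 0 = speed 0"
      using h_initial[of 1] g_initial[of 1] by (simp add: front_speed_def speed_def m_0 l_0)
    also have "\<dots> \<le> V" using speed_le_V[of 0] T by auto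
    also have "\<dots> < \<zeta> * (Ne / 2)" using V by simp
    also have "\<dots> \<le> \<zeta> * N 0" using N_bounds[of 0] T pos by (intro mult_left_mono) auto
    finally show False using z0(2) \<open>t0 = 0\<close> by (simp add: w_def)
  qed
  have "front_speed t0 < \<zeta> * N t0"
    by (rule outflow_at_t0) (use z0(1) \<open>t0 \<noteq> 0\<close> t before in auto)
  then show False using z0(2) by (simp add: w_def)
qed

lemma m_eq_l: assumes t: "t \<in> {0..T}" shows "m t = l t"
proof -
  have "m t - l t = 0"
  proof (rule continuous_constant_on_closure[of "{0<..<T}" "\<lambda>t. m t - l t"])
    show "continuous_on (closure {0<..<T}) (\<lambda>t. m t - l t)"
      using T by (simp add: continuous_on_diff m_continuous l_continuous)
    fix s assume "s \<in> {0<..<T}"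
    then have "m s = l s" using outflow_everywhere by (intro m_eq_l_upto[of s]) auto
    then show "m s - l s = 0" by simp
  qed (use t T in auto)
  then show ?thesis by simp
qed

lemma g_eq_f: assumes z: "z \<in> {0..T} \<times> {0..1}" shows "g z = f z"
proof -
  have "g z - f z = 0"
  proof (rule continuous_constant_on_closure[of "space_time T" "\<lambda>z. g z - f z"])
    show "continuous_on (closure (space_time T)) (\<lambda>z. g z - f z)"
      unfolding closure_space_time[OF T]
      by (intro continuous_on_diff g_continuous lipschitz_on_continuous_on[OF f_lipschitz])
    fix w assume "w \<in> space_time T"
    then obtain t x where w: "w = (t, x)" "t \<in> {0<..<T}" "x \<in> {0<..<1}" by auto
    have "g (t, x) = h (m t * x - M t)"
      using w outflow_everywhere by (intro g_representation_interior[of t]) auto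
    then show "g w - f w = 0" using m_eq_l[of t] w by (simp add: f_def)
  qed (use z T in \<open>auto simp: closure_space_time\<close>)
  then show ?thesis by simp
qed

end

end

section \<open>Existence, uniqueness and estimates\<close>

lemma lipschitz_on_divide:
  fixes u g :: "'a::metric_space \<Rightarrow> real"
  assumes S: "compact S" and u: "K-lipschitz_on S u" and g: "K'-lipschitz_on S g"
    and c: "c > 0" "\<And>x. x \<in> S \<Longrightarrow> c \<le> g x"
  obtains K'' where "K''-lipschitz_on S (\<lambda>x. u x / g x)"
proof -
  have "bounded (u ` S)"
    by (intro compact_imp_bounded compact_continuous_image lipschitz_on_continuous_on[OF u] S)
  then obtain b where b: "\<And>x. x \<in> S \<Longrightarrow> \<bar>u x\<bar> \<le> b" unfolding bounded_iff by (metis image_eqI real_norm_def)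
  have K: "K \<ge> 0" "K' \<ge> 0" using u g lipschitz_on_nonneg by blast+
  have "(K / c + max b 0 * K' / (c * c))-lipschitz_on S (\<lambda>x. u x / g x)"
  proof (rule lipschitz_onI)
    fix x y assume x: "x \<in> S" and y: "y \<in> S"
    have gp: "c \<le> g x" "c \<le> g y" "0 < g x" "0 < g y" using c(1) c(2)[OF x] c(2)[OF y] by auto
    have "\<bar>u x / g x - u y / g y\<bar> = \<bar>(u x - u y) / g x + u y * (g y - g x) / (g x * g y)\<bar>"
      using gp by (simp add: field_simps)
    also have "\<dots> \<le> \<bar>u x - u y\<bar> / g x + \<bar>u y\<bar> * \<bar>g y - g x\<bar> / (g x * g y)"
      using gp by (intro order_trans[OF abs_triangle_ineq]) (simp add: abs_mult)
    also have "\<dots> \<le> (K * dist x y) / c + max b 0 * (K' * dist x y) / (c * c)"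
    proof (intro add_mono frac_le mult_mono)
      show "\<bar>u x - u y\<bar> \<le> K * dist x y" using lipschitz_onD[OF u x y] by (simp add: dist_real_def)
      show "\<bar>g y - g x\<bar> \<le> K' * dist x y" using lipschitz_onD[OF g y x] by (simp add: dist_real_def dist_commute)
      show "\<bar>u y\<bar> \<le> max b 0" using b[OF y] by simp
    qed (use gp c K in auto)
    also have "\<dots> = (K / c + max b 0 * K' / (c * c)) * dist x y" by (simp add: add_divide_distrib distrib_right)
    finally show "dist (u x / g x) (u y / g y) \<le> (K / c + max b 0 * K' / (c * c)) * dist x y"
      by (simp add: dist_real_def)
  qed (use K c in auto)
  then show ?thesis by (rule that)
qed

text \<open>The smallness condition bounds a sum in the extended reals; this extracts the single terms.\<close>
lemma nonneg_summands_le: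
  fixes a b c d s :: ereal
  assumes "0 \<le> a" "0 \<le> b" "0 \<le> c" "0 \<le> d" "a + b + c + d \<le> s"
  shows "a \<le> s" "b \<le> s" "c \<le> s" "d \<le> s"
proof -
  have "a + 0 + 0 + 0 \<le> a + b + c + d" "0 + b + 0 + 0 \<le> a + b + c + d"
    "0 + 0 + c + 0 \<le> a + b + c + d" "0 + 0 + 0 + d \<le> a + b + c + d"
    by (intro add_mono assms order_refl)+
  then show "a \<le> s" "b \<le> s" "c \<le> s" "d \<le> s"
    using assms(5) by (simp_all only: add_0_left add_0_right)
qed

theorem theorem4p1:
  fixes L \<zeta> \<rho> Veff Seff B Kd T le Ne fpe :: real
  assumes "L > 0" "\<zeta> > 0" "\<rho> > 0" "Veff > 0" "Seff > 0" "B > 0" "Kd > 0"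
    and "T > 0"
    and "interface_speed L \<rho> Veff Seff B Kd le Ne fpe = 0"
    and "0 < fpe" "fpe < 1" "0 < le" "le < L" "Ne > 0"
  shows "\<exists>\<epsilon>0>0. \<exists>C>0. \<forall>\<epsilon>. 0 < \<epsilon> \<and> \<epsilon> \<le> \<epsilon>0 \<longrightarrow>
    (\<forall>l0 f0 Fin N.
       l0 \<in> {0<..<L} \<and> f0 \<in> W1inf_lip {0<..<1} \<and>
       Fin \<in> W1inf_lip {0<..<T} \<and> N \<in> W1inf_lip {0<..<T} \<and>
       Fin 0 / (\<rho> * Veff * N 0) = f0 0 \<and>
       W1inf_norm {0<..<1} (\<lambda>x. f0 x - fpe)
         + W1inf_norm {0<..<T} (\<lambda>t. Fin t / (\<rho> * Veff * N t) - fpe)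
         + W1inf_norm {0<..<T} (\<lambda>t. N t - Ne)
         + ereal \<bar>l0 - le\<bar> \<le> ereal \<epsilon>
       \<longrightarrow>
       (\<exists>l f.
          is_solution L \<zeta> \<rho> Veff Seff B Kd T l0 f0 Fin N l f \<and>
          (\<forall>l' f'. is_solution L \<zeta> \<rho> Veff Seff B Kd T l0 f0 Fin N l' f' \<longrightarrow>
             (\<forall>t\<in>{0..T}. l' t = l t) \<and> (\<forall>z\<in>{0..T} \<times> {0..1}. f' z = f z)) \<and>
          W1inf_norm (space_time T) (\<lambda>z. f z - fpe) \<le> ereal (C * \<epsilon>) \<and>
          W1inf_norm {0<..<T} (\<lambda>t. l t - le) \<le> ereal (C * \<epsilon>)))"
proof -
  interpret extrusion L \<zeta> \<rho> Veff Seff B Kd by unfold_locales fact+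
  have "0 < (1 - fpe) / 2" "2 * Ne \<ge> 0" using assms by auto
  then obtain \<Lambda> where \<Lambda>: "\<Lambda> > 0"
    and \<Lambda>_lip: "\<And>l l' N N' f f'. \<lbrakk>l \<le> L; l' \<le> L; \<bar>N\<bar> \<le> 2 * Ne; \<bar>N'\<bar> \<le> 2 * Ne; f \<le> 1 - (1 - fpe) / 2; f' \<le> 1 - (1 - fpe) / 2\<rbrakk>
      \<Longrightarrow> \<bar>F l N f - F l' N' f'\<bar> \<le> \<Lambda> * (\<bar>l - l'\<bar> + \<bar>N - N'\<bar> + \<bar>f - f'\<bar>)"
    by (rule interface_speed_lipschitz) blast
  have half: "1 - (1 - fpe) / 2 = (1 + fpe) / 2" by (simp add: field_simps)
  define A where "A = 2 * exp (2 * \<Lambda> * T)"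
  have A: "A > 0" by (simp add: A_def)
  define W where "W = \<Lambda> * (A + 2)"
  have W: "W > 0" using \<Lambda> A by (simp add: W_def)
  define H where "H = (2 / le + 2 / (\<zeta> * Ne)) * (L + 3 * (\<zeta> * Ne))"
  have H: "H > 0" using assms by (simp add: H_def add_pos_pos)
  \<comment> \<open>The first four entries keep the data in a fixed range, the next two keep the interface inside \<open>(0, L)\<close>, and the last one keeps its speed below \<open>\<zeta> N\<close>.\<close>
  define E where "E = {Ne / 2, (1 - fpe) / 2, fpe / 2, le / 2, le / (2 * A), (L - le) / (2 * A), \<zeta> * Ne / (4 * W)}"
  define \<epsilon>0 where "\<epsilon>0 = Min E"
  have fin: "finite E" "E \<noteq> {}" by (auto simp: E_def)
  have "\<forall>e\<in>E. e > 0" using assms A W by (auto simp: E_def)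
  then have \<epsilon>0: "\<epsilon>0 > 0" unfolding \<epsilon>0_def using fin by (simp add: Min_gr_iff)
  define C where "C = 1 + 2 * H + A + W"
  have C: "C > 0" using H A W by (simp add: C_def)
  show ?thesis
  proof (rule exI[of _ \<epsilon>0], intro conjI \<epsilon>0, rule exI[of _ C], intro conjI C allI impI)
    fix \<epsilon> l0 :: real and f0 Fin N :: "real \<Rightarrow> real"
    assume \<epsilon>: "0 < \<epsilon> \<and> \<epsilon> \<le> \<epsilon>0"
    assume data: "l0 \<in> {0<..<L} \<and> f0 \<in> W1inf_lip {0<..<1} \<and>
       Fin \<in> W1inf_lip {0<..<T} \<and> N \<in> W1inf_lip {0<..<T} \<and>
       Fin 0 / (\<rho> * Veff * N 0) = f0 0 \<and>
       W1inf_norm {0<..<1} (\<lambda>x. f0 x - fpe)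
         + W1inf_norm {0<..<T} (\<lambda>t. Fin t / (\<rho> * Veff * N t) - fpe)
         + W1inf_norm {0<..<T} (\<lambda>t. N t - Ne)
         + ereal \<bar>l0 - le\<bar> \<le> ereal \<epsilon>"
    have le_E: "\<epsilon> \<le> e" if "e \<in> E" for e
      using \<epsilon> Min_le[OF fin(1) that] by (auto simp: \<epsilon>0_def)
    have small: "\<epsilon> \<le> Ne / 2" "\<epsilon> \<le> (1 - fpe) / 2" "\<epsilon> \<le> fpe / 2" "\<epsilon> \<le> le / 2"
      "\<epsilon> \<le> le / (2 * A)" "\<epsilon> \<le> (L - le) / (2 * A)" "\<epsilon> \<le> \<zeta> * Ne / (4 * W)"
      by (rule le_E, simp add: E_def)+
    let ?a = "W1inf_norm {0<..<1} (\<lambda>x. f0 x - fpe)"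
    let ?b = "W1inf_norm {0<..<T} (\<lambda>t. Fin t / (\<rho> * Veff * N t) - fpe)"
    let ?c = "W1inf_norm {0<..<T} (\<lambda>t. N t - Ne)"
    have nn: "0 \<le> ?a" "0 \<le> ?b" "0 \<le> ?c" "0 \<le> ereal \<bar>l0 - le\<bar>"
      using assms by (auto intro!: W1inf_norm_nonneg)
    have sum: "?a + ?b + ?c + ereal \<bar>l0 - le\<bar> \<le> ereal \<epsilon>" using data by blast
    have abc: "?a \<le> ereal \<epsilon>" "?b \<le> ereal \<epsilon>" "?c \<le> ereal \<epsilon>" "ereal \<bar>l0 - le\<bar> \<le> ereal \<epsilon>"
      by (rule nonneg_summands_le[OF nn sum])+
    obtain K1 where K1: "K1-lipschitz_on {0..1} f0" using data by (auto simp: W1inf_lip_def)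
    obtain K2 where K2: "K2-lipschitz_on {0..T} Fin" using data assms by (auto simp: W1inf_lip_def)
    obtain K3 where K3: "K3-lipschitz_on {0..T} N" using data assms by (auto simp: W1inf_lip_def)
    note f0 = W1inf_norm_offset_bounds[where u = f0 and c = fpe, OF zero_less_one K1 abc(1)]
    note N = W1inf_norm_offset_bounds[where u = N and c = Ne, OF \<open>T > 0\<close> K3 abc(3)]
    have Nlow: "Ne / 2 \<le> N t" if "t \<in> {0..T}" for t
      using N(2)[OF that] small(1) by (simp add: abs_le_iff)
    have pV: "\<rho> * Veff > 0" using assms by simp
    \<comment> \<open>Only \<open>Fin\<close> and \<open>N\<close> are known to be Lipschitz; their quotient is, as \<open>N\<close> is bounded below by \<open>Ne / 2\<close>.\<close>
    obtain K4 where K4: "K4-lipschitz_on {0..T} (\<lambda>t. Fin t / (\<rho> * Veff * N t))"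
    proof (rule lipschitz_on_divide[OF compact_Icc K2])
      show "(\<bar>\<rho> * Veff\<bar> * K3)-lipschitz_on {0..T} (\<lambda>t. \<rho> * Veff * N t)"
        by (rule lipschitz_on_cmult_real[OF K3])
      show "\<rho> * Veff * (Ne / 2) > 0" using pV assms by simp
      show "\<rho> * Veff * (Ne / 2) \<le> \<rho> * Veff * N t" if "t \<in> {0..T}" for t
        using Nlow[OF that] pV by (intro mult_left_mono) auto
    qed blast
    note q = W1inf_norm_offset_bounds[where u = "\<lambda>t. Fin t / (\<rho> * Veff * N t)" and c = fpe, OF \<open>T > 0\<close> K4 abc(2)]
    interpret D: extrusion_data L \<zeta> \<rho> Veff Seff B Kd T le Ne fpe \<epsilon> \<Lambda> l0 f0 Fin N
    proof (unfold_locales)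
      have "2 * (A * \<epsilon>) \<le> le" "2 * (A * \<epsilon>) \<le> L - le" "4 * (W * \<epsilon>) \<le> \<zeta> * Ne"
        using small(5-7) A W by (simp_all add: pos_le_divide_eq ac_simps)
      moreover have "\<zeta> * Ne > 0" using assms by simp
      ultimately have "A * \<epsilon> < le" "A * \<epsilon> < L - le" "2 * (W * \<epsilon>) < \<zeta> * Ne" using assms by linarith+
      then show "2 * exp (2 * \<Lambda> * T) * \<epsilon> < le" "2 * exp (2 * \<Lambda> * T) * \<epsilon> < L - le"
        "2 * (\<Lambda> * (2 * exp (2 * \<Lambda> * T) + 2) * \<epsilon>) < \<zeta> * Ne"
        by (simp_all only: A_def W_def)
      show "\<bar>F l n f - F l' n' f'\<bar> \<le> \<Lambda> * (\<bar>l - l'\<bar> + \<bar>n - n'\<bar> + \<bar>f - f'\<bar>)"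
        if "l \<le> L" "l' \<le> L" "\<bar>n\<bar> \<le> 2 * Ne" "\<bar>n'\<bar> \<le> 2 * Ne" "f \<le> (1 + fpe) / 2" "f' \<le> (1 + fpe) / 2" for l l' n n' f f'
        using \<Lambda>_lip[unfolded half, OF that] .
      show "2 * \<epsilon> \<le> Ne" "2 * \<epsilon> \<le> 1 - fpe" "2 * \<epsilon> \<le> fpe" "2 * \<epsilon> \<le> le" using small by simp_all
      show "\<bar>l0 - le\<bar> \<le> \<epsilon>" using abc(4) by simp
      show "Fin 0 / (\<rho> * Veff * N 0) = f0 0" using data by blast
      show "0 < \<epsilon>" using \<epsilon> by blast
    qed (fact assms \<Lambda> f0 N q)+
    obtain l where l: "l 0 = l0" "\<And>t. t \<in> {0..T} \<Longrightarrow> \<bar>l t - le\<bar> \<le> D.A * \<epsilon>"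
      "\<And>t. t \<in> {0..T} \<Longrightarrow> (l has_real_derivative F (l t) (N t) (D.h (l t - D.M t))) (at t within {0..T})"
      by (rule D.interface_exists) blast
    \<comment> \<open>The reduced equation determines the interface, and with it the whole solution.\<close>
    interpret E: extrusion_interface L \<zeta> \<rho> Veff Seff B Kd T le Ne fpe \<epsilon> \<Lambda> l0 f0 Fin N l
      by unfold_locales (fact l)+
    have "E.lip_f = \<epsilon> * H" by (simp only: E.lip_f_def D.H_def H_def mult.assoc)
    then have "\<epsilon> + 2 * E.lip_f = (1 + 2 * H) * \<epsilon>" by (simp add: algebra_simps)
    also have "\<dots> \<le> C * \<epsilon>" using \<epsilon> A W by (intro mult_right_mono) (auto simp: C_def)
    finally have Cf: "\<epsilon> + 2 * E.lip_f \<le> C * \<epsilon>" .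
    have "A * \<epsilon> + E.V = (A + W) * \<epsilon>" by (simp add: E.V_def W_def A_def algebra_simps)
    also have "\<dots> \<le> C * \<epsilon>" using \<epsilon> H by (intro mult_right_mono) (auto simp: C_def)
    finally have Cl: "A * \<epsilon> + E.V \<le> C * \<epsilon>" .
    show "\<exists>l f.
          is_solution L \<zeta> \<rho> Veff Seff B Kd T l0 f0 Fin N l f \<and>
          (\<forall>l' f'. is_solution L \<zeta> \<rho> Veff Seff B Kd T l0 f0 Fin N l' f' \<longrightarrow>
             (\<forall>t\<in>{0..T}. l' t = l t) \<and> (\<forall>z\<in>{0..T} \<times> {0..1}. f' z = f z)) \<and>
          W1inf_norm (space_time T) (\<lambda>z. f z - fpe) \<le> ereal (C * \<epsilon>) \<and>
          W1inf_norm {0<..<T} (\<lambda>t. l t - le) \<le> ereal (C * \<epsilon>)"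
    proof (intro exI[of _ l] exI[of _ E.f] conjI allI impI ballI)
      show "is_solution L \<zeta> \<rho> Veff Seff B Kd T l0 f0 Fin N l E.f" by (rule E.solution)
      show "l' t = l t" if "is_solution L \<zeta> \<rho> Veff Seff B Kd T l0 f0 Fin N l' f'" "t \<in> {0..T}" for l' f' t
        using E.m_eq_l[OF that] .
      show "f' z = E.f z" if "is_solution L \<zeta> \<rho> Veff Seff B Kd T l0 f0 Fin N l' f'" "z \<in> {0..T} \<times> {0..1}" for l' f' z
        using E.g_eq_f[OF that] .
      show "W1inf_norm (space_time T) (\<lambda>z. E.f z - fpe) \<le> ereal (C * \<epsilon>)"
        using E.f_W1inf(2) Cf by (meson ereal_less_eq(3) order_trans)
      show "W1inf_norm {0<..<T} (\<lambda>t. l t - le) \<le> ereal (C * \<epsilon>)"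
        using E.l_W1inf(2) Cl unfolding A_def by (meson ereal_less_eq(3) order_trans)
    qed
  qed
qed

end
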